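(* Let $\mathcal{W}$ be the set of $2\pi$-periodic functions $v\in H^1(-\pi,\pi)$ satisfying $$\int_{-\pi}^{\pi} v(\theta)\,d\theta=0,\qquad \int_{-\pi}^{\pi} v(\theta)\cos\theta\,d\theta=0,\qquad \int_{-\pi}^{\pi} v(\theta)\sin\theta\,d\theta=0,$$ and let $$m=\inf_{v\in\mathcal{W},\,v\neq 0} J(v),\qquad J(v)=\frac{\displaystyle\int_{-\pi}^{\pi}\left(|v'|^2-|v|^2\right)d\theta}{\displaystyle\left[\int_{-\pi}^{\pi}|v|\,d\theta\right]^2}.$$ Then $m=\dfrac{1}{2(4-\pi)}$. Moreover, the minimizer of $J$ on $\mathcal{W}\setminus\{0\}$ is, up to multiplication by a nonzero constant and up to a translation in $\theta$, the odd and $\pi$-periodic function $u$ defined on $[0,\pi/2]$ by $u(\theta)=\cos\theta+\sin\theta-1$. That is, $u\in\mathcal{W}$, $J(u)=m$, and every $w\in\mathcal{W}\setminus\{0\}$ with $J(w)=m$ has the form $w(\theta)=c\,u(\theta+a)$ for some real $c\neq 0$ and $a\in\mathbb{R}$.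
   Context: Functions are real valued. A $2\pi$-periodic function in $H^1(-\pi,\pi)$ is an element of $H^1(-\pi,\pi)$ whose (continuous representative's) values at $-\pi$ and $\pi$ coincide, extended $2\pi$-periodically to $\mathbb{R}$. The functional $J$ is invariant under $v\mapsto cv$ ($c\ne0$) and under $v\mapsto v(\cdot+a)$, and $\mathcal{W}$ is stable under these operations. *)

theory Defs
  imports "HOL-Analysis.Analysis"
begin

definition test_function :: "real set \<Rightarrow> (real \<Rightarrow> real) \<Rightarrow> bool" where
  "test_function \<Omega> \<phi> \<longleftrightarrow>
     (\<forall>k x. (deriv ^^ k) \<phi> differentiable (at x)) \<and>
     compact (closure {x. \<phi> x \<noteq> 0}) \<and> closure {x. \<phi> x \<noteq> 0} \<subseteq> \<Omega>"

text \<open>Functions, rather than classes modulo null sets, are used as elements of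
  \<open>L\<^sup>2\<close> and \<open>H\<^sup>1\<close>.\<close>

definition L2 :: "real set \<Rightarrow> (real \<Rightarrow> real) set" where
  "L2 \<Omega> = {f. f \<in> borel_measurable (lebesgue_on \<Omega>) \<and>
              integrable (lebesgue_on \<Omega>) (\<lambda>x. (f x)\<^sup>2)}"

definition has_weak_deriv :: "real set \<Rightarrow> (real \<Rightarrow> real) \<Rightarrow> (real \<Rightarrow> real) \<Rightarrow> bool" where
  "has_weak_deriv \<Omega> v g \<longleftrightarrow>
     (\<forall>\<phi>. test_function \<Omega> \<phi> \<longrightarrow>
        (LINT x|lebesgue_on \<Omega>. v x * deriv \<phi> x) = - (LINT x|lebesgue_on \<Omega>. g x * \<phi> x))"

definition H1 :: "real set \<Rightarrow> (real \<Rightarrow> real) set" where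
  "H1 \<Omega> = {v \<in> L2 \<Omega>. \<exists>g\<in>L2 \<Omega>. has_weak_deriv \<Omega> v g}"

text \<open>On open sets, the weak derivative is determined up to a null set, so integrals of
  expressions in it do not depend on the choice made here.\<close>

definition weak_deriv :: "real set \<Rightarrow> (real \<Rightarrow> real) \<Rightarrow> real \<Rightarrow> real" where
  "weak_deriv \<Omega> v = (SOME g. g \<in> L2 \<Omega> \<and> has_weak_deriv \<Omega> v g)"

abbreviation period_interval :: "real set" where
  "period_interval \<equiv> {-pi<..<pi}"

text \<open>Each class in \<open>H\<^sup>1(-\<pi>, \<pi>)\<close> with equal boundary values is represented by the periodic
  extension of its continuous representative. This is the unique continuous \<open>2\<pi>\<close>-periodic
  function on the real line in the class, so equality below is equality of functions.\<close>

definition H1_per :: "(real \<Rightarrow> real) set" where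
  "H1_per = {v. continuous_on UNIV v \<and> (\<forall>x. v (x + 2 * pi) = v x) \<and> v \<in> H1 period_interval}"

definition \<W> :: "(real \<Rightarrow> real) set" where
  "\<W> = {v \<in> H1_per.
          (LINT \<theta>|lebesgue_on period_interval. v \<theta>) = 0 \<and>
          (LINT \<theta>|lebesgue_on period_interval. v \<theta> * cos \<theta>) = 0 \<and>
          (LINT \<theta>|lebesgue_on period_interval. v \<theta> * sin \<theta>) = 0}"

definition J :: "(real \<Rightarrow> real) \<Rightarrow> real" where
  "J v = (LINT \<theta>|lebesgue_on period_interval. \<bar>weak_deriv period_interval v \<theta>\<bar>\<^sup>2 - \<bar>v \<theta>\<bar>\<^sup>2) /
         (LINT \<theta>|lebesgue_on period_interval. \<bar>v \<theta>\<bar>)\<^sup>2"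

text \<open>The infimum is taken in the extended reals, where it exists without
  assuming that \<open>J\<close> is bounded below.\<close>

definition J_inf :: ereal where
  "J_inf = (INF v\<in>\<W> - {\<lambda>_. 0}. ereal (J v))"

end

theory Submission imports Defs "HOL-Analysis.Analysis" begin

text \<open>By homogeneity it suffices to show \<open>E(v) - 2 \<integral> |v| + 2 (4 - \<pi>) \<ge> 0\<close> for admissible \<open>v\<close>, where
  \<open>E(v) = \<integral> v'\<^sup>2 - v\<^sup>2\<close> over a period. Let \<open>e\<close> be the component of \<open>v\<close> that changes sign
  under translation by \<open>\<pi>/2\<close> and \<open>r = v - e\<close>; the energy splits as \<open>E(v) = E(e) + E(r)\<close>.

  After a translation \<open>e\<close> vanishes at the multiples of \<open>\<pi>/2\<close>. With \<open>f x = cos x + sin x - 1\<close>, which solves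
  \<open>f'' + f = - 1\<close> with zero boundary values on \<open>[0, \<pi>/2]\<close>, Jacobi's identity gives
  \<open>\<integral> e'\<^sup>2 - e\<^sup>2 \<ge> \<integral> e\<^sup>2 / f\<close> on each quarter period. If \<open>r = 0\<close>, this is enough, as
  \<open>e\<^sup>2 / f - 2 |e| + f = (|e| - f)\<^sup>2 / f\<close>, and equality forces \<open>|e| = f\<close>.

  In general the orthogonality relations give a pointwise bound: the squares of the four values of \<open>r\<close> at
  \<open>x + k \<pi>/2\<close> sum to at most \<open>E(r) / (2 \<pi>)\<close>. Hence the four values of \<open>v\<close> can fail to alternate in sign
  only where \<open>f\<close> is small, and the loss there is strictly dominated by \<open>E(r)\<close>.\<close>

section \<open>Square-integrable functions and their antiderivatives\<close>

text \<open>The Euler-Lagrange equation of the scaled functional is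
  \<open>v'' + v = - sgn v\<close>, so it depends on the unknown sign pattern of \<open>v\<close>;
  the profile solves it on one nodal interval of length pi/2, but a competitor need not change sign
  at equal distances. The form \<open>E\<close> is negative on constants and vanishes on cosine and
  sine. All three functions have zero alternating component, so the constraints act only on
  \<open>r\<close> and make it coercive, while \<open>e\<close> is controlled by its zeros alone.
  The delicate point is quantitative: the loss from wrong signs and the gain \<open>E(r)\<close> are
  both quadratic in the size of \<open>r\<close>, so no smallness argument separates them and the
  explicit constants have to be compared. On the analytic side, \<open>J\<close> contains an
  arbitrarily chosen weak derivative. All estimates therefore use only
  \<open>v y - v x = \<integral> g\<close> on subintervals, an identity that every weak derivative
  satisfies.\<close>

definition sqint :: "real \<Rightarrow> real \<Rightarrow> (real \<Rightarrow> real) \<Rightarrow> bool" where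
  "sqint a b g \<longleftrightarrow> g \<in> borel_measurable (lebesgue_on {a..b}) \<and> (\<lambda>x. (g x)\<^sup>2) integrable_on {a..b}"

lemma sqint_mult_abs:
  assumes "sqint a b g" "sqint a b k"
  shows "(\<lambda>x. g x * k x) absolutely_integrable_on {a..b}"
proof (rule measurable_bounded_by_integrable_imp_absolutely_integrable)
  show "(\<lambda>x. g x * k x) \<in> borel_measurable (lebesgue_on {a..b})"
    using assms unfolding sqint_def by (intro borel_measurable_times) auto
  show "(\<lambda>x. (g x)\<^sup>2 + (k x)\<^sup>2) integrable_on {a..b}"
    using assms unfolding sqint_def by (intro integrable_add) auto
  show "norm (g x * k x) \<le> (g x)\<^sup>2 + (k x)\<^sup>2" for x
  proof -
    have "2 * (\<bar>g x\<bar> * \<bar>k x\<bar>) \<le> (g x)\<^sup>2 + (k x)\<^sup>2"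
      using sum_squares_bound[of "\<bar>g x\<bar>" "\<bar>k x\<bar>"] by simp
    moreover have "0 \<le> (g x)\<^sup>2 + (k x)\<^sup>2" by simp
    ultimately show ?thesis unfolding real_norm_def abs_mult by linarith
  qed
qed auto

lemma sqint_mult:
  "sqint a b g \<Longrightarrow> sqint a b k \<Longrightarrow> (\<lambda>x. g x * k x) integrable_on {a..b}"
  using sqint_mult_abs set_lebesgue_integral_eq_integral(1) by blast

lemma sqint_continuous: "continuous_on {a..b} g \<Longrightarrow> sqint a b g"
  unfolding sqint_def
  by (auto intro!: continuous_imp_measurable_on_sets_lebesgue integrable_continuous_real continuous_intros)

lemma sqint_sq: "sqint a b g \<Longrightarrow> (\<lambda>x. (g x)\<^sup>2) integrable_on {a..b}"
  unfolding sqint_def by auto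

lemma sqint_abs_integrable: "sqint a b g \<Longrightarrow> g absolutely_integrable_on {a..b}"
  using sqint_mult_abs[of a b g "\<lambda>_. 1"] sqint_continuous[of a b "\<lambda>_. 1"] by auto

lemma sqint_integrable: "sqint a b g \<Longrightarrow> g integrable_on {a..b}"
  using sqint_abs_integrable set_lebesgue_integral_eq_integral(1) by blast

lemma sqint_cmult:
  assumes "sqint a b g" shows "sqint a b (\<lambda>x. c * g x)"
  using assms integrable_on_mult_right[of "\<lambda>x. (g x)\<^sup>2" "{a..b}" "c\<^sup>2"] unfolding sqint_def
  by (auto simp: power_mult_distrib)

lemma sqint_add:
  assumes "sqint a b g" "sqint a b k" shows "sqint a b (\<lambda>x. g x + k x)"
proof -
  have "(\<lambda>x. (g x)\<^sup>2 + (k x)\<^sup>2 + 2 * (g x * k x)) integrable_on {a..b}"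
    using assms sqint_sq sqint_mult by (intro integrable_add integrable_on_mult_right) auto
  moreover have "(\<lambda>x. (g x)\<^sup>2 + (k x)\<^sup>2 + 2 * (g x * k x)) = (\<lambda>x. (g x + k x)\<^sup>2)"
    by (auto simp: power2_eq_square algebra_simps)
  ultimately show ?thesis using assms unfolding sqint_def by auto
qed

lemma sqint_mult_continuous:
  assumes g: "sqint a b g" and p: "continuous_on {a..b} p" shows "sqint a b (\<lambda>x. p x * g x)"
proof -
  have pm: "p \<in> borel_measurable (lebesgue_on {a..b})"
    using p by (auto intro!: continuous_imp_measurable_on_sets_lebesgue)
  have "bounded ((\<lambda>x. (p x)\<^sup>2) ` {a..b})"
    by (intro compact_imp_bounded compact_continuous_image continuous_intros p) auto
  moreover have "(\<lambda>x. (g x)\<^sup>2) absolutely_integrable_on {a..b}"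
    using g by (intro nonnegative_absolutely_integrable_1) (auto simp: sqint_def)
  ultimately have "(\<lambda>x. (p x)\<^sup>2 * (g x)\<^sup>2) absolutely_integrable_on {a..b}"
    using pm by (intro absolutely_integrable_bounded_measurable_product_real borel_measurable_power) auto
  then have "(\<lambda>x. (p x * g x)\<^sup>2) integrable_on {a..b}"
    using set_lebesgue_integral_eq_integral(1) by (auto simp: power_mult_distrib)
  then show ?thesis using g pm unfolding sqint_def by auto
qed

lemma sqint_subinterval:
  assumes "sqint a b g" "a \<le> c" "d \<le> b" shows "sqint c d g"
proof -
  have sub: "{c..d} \<subseteq> {a..b}" using assms by auto
  have "g integrable_on {c..d}"
    using integrable_on_subinterval[OF sqint_integrable[OF assms(1)] sub] .
  then have "g \<in> borel_measurable (lebesgue_on {c..d})" by (rule integrable_imp_measurable)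
  then show ?thesis
    using integrable_on_subinterval[OF sqint_sq[OF assms(1)] sub] unfolding sqint_def by auto
qed

text \<open>Integrate \<open>(\<bar>g\<bar> - m)^2 \<ge> 0\<close> with \<open>m\<close> the mean of
  \<open>\<bar>g\<bar>\<close>. The factor \<open>y - x\<close> is what makes the error in the
  product rule vanish under subdivision.\<close>

lemma cauchy_schwarz_one:
  assumes g: "sqint x y g" and "x \<le> y"
  shows "(integral {x..y} (\<lambda>t. \<bar>g t\<bar>))\<^sup>2 \<le> (y - x) * integral {x..y} (\<lambda>t. (g t)\<^sup>2)"
proof (cases "x = y")
  case True then show ?thesis by simp
next
  case False
  define m where "m = integral {x..y} (\<lambda>t. \<bar>g t\<bar>) / (y - x)"
  have i1: "(\<lambda>t. \<bar>g t\<bar>) integrable_on {x..y}"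
    using sqint_abs_integrable[OF g] by (simp add: absolutely_integrable_on_def)
  have "((\<lambda>t. (g t)\<^sup>2 - 2 * m * \<bar>g t\<bar> + m\<^sup>2) has_integral
      integral {x..y} (\<lambda>t. (g t)\<^sup>2) - 2 * m * integral {x..y} (\<lambda>t. \<bar>g t\<bar>) + m\<^sup>2 * (y - x)) {x..y}"
    using has_integral_const_real[of "m\<^sup>2" x y] assms(2)
    by (intro has_integral_add has_integral_diff has_integral_mult_right integrable_integral sqint_sq g i1)
       (simp add: mult.commute)
  moreover have "0 \<le> (g t)\<^sup>2 - 2 * m * \<bar>g t\<bar> + m\<^sup>2" for t
    using zero_le_power2[of "\<bar>g t\<bar> - m"] by (simp add: power2_diff algebra_simps)
  ultimately have "0 \<le> integral {x..y} (\<lambda>t. (g t)\<^sup>2) - 2 * m * integral {x..y} (\<lambda>t. \<bar>g t\<bar>) + m\<^sup>2 * (y - x)"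
    by (rule has_integral_nonneg)
  moreover have I: "integral {x..y} (\<lambda>t. \<bar>g t\<bar>) = m * (y - x)"
    using False assms by (simp add: m_def)
  ultimately have "m * m * (y - x) \<le> integral {x..y} (\<lambda>t. (g t)\<^sup>2)"
    by (simp add: power2_eq_square algebra_simps)
  then have "(y - x) * (m * m * (y - x)) \<le> (y - x) * integral {x..y} (\<lambda>t. (g t)\<^sup>2)"
    using assms(2) by (intro mult_left_mono) auto
  moreover have "(m * (y - x))\<^sup>2 = (y - x) * (m * m * (y - x))"
    by (simp add: power2_eq_square)
  ultimately show ?thesis unfolding I by simp
qed

text \<open>Increments are prescribed instead of pointwise derivatives: \<open>v\<close> is the
  absolutely continuous representative, whose values at points and end points are meaningful, while
  \<open>g\<close> matters only up to null sets.\<close>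

definition W12 :: "real \<Rightarrow> real \<Rightarrow> (real \<Rightarrow> real) \<Rightarrow> (real \<Rightarrow> real) \<Rightarrow> bool" where
  "W12 a b v g \<longleftrightarrow> sqint a b g \<and>
     (\<forall>x y. a \<le> x \<longrightarrow> x \<le> y \<longrightarrow> y \<le> b \<longrightarrow> (g has_integral (v y - v x)) {x..y})"

lemma W12_has_integral:
  "W12 a b v g \<Longrightarrow> a \<le> x \<Longrightarrow> x \<le> y \<Longrightarrow> y \<le> b \<Longrightarrow> (g has_integral (v y - v x)) {x..y}"
  unfolding W12_def by auto

lemma W12_sqint: "W12 a b v g \<Longrightarrow> sqint a b g"
  unfolding W12_def by auto

lemma W12_subinterval:
  assumes "W12 a b v g" "a \<le> c" "d \<le> b" shows "W12 c d v g"
  using assms sqint_subinterval[of a b g c d] unfolding W12_def by auto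

lemma W12_continuous:
  assumes W: "W12 a b v g" shows "continuous_on {a..b} v"
proof -
  have "continuous_on {a..b} (\<lambda>x. v a + integral {a..x} g)"
    by (intro continuous_intros indefinite_integral_continuous_1 sqint_integrable W12_sqint[OF W])
  then show ?thesis
  proof (rule continuous_on_eq)
    show "v a + integral {a..x} g = v x" if "x \<in> {a..b}" for x
      using integral_unique[OF W12_has_integral[OF W, of a x]] that by simp
  qed
qed

lemma W12_cmult: "W12 a b v g \<Longrightarrow> W12 a b (\<lambda>x. c * v x) (\<lambda>x. c * g x)"
  unfolding W12_def by (auto intro!: sqint_cmult has_integral_mult_right simp flip: right_diff_distrib)

lemma W12_add:
  assumes "W12 a b v g" "W12 a b w k" shows "W12 a b (\<lambda>x. v x + w x) (\<lambda>x. g x + k x)"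
  unfolding W12_def
proof (intro conjI allI impI)
  show "sqint a b (\<lambda>x. g x + k x)" using assms by (auto intro: sqint_add W12_sqint)
  fix x y assume *: "a \<le> x" "x \<le> y" "y \<le> b"
  have "((\<lambda>x. g x + k x) has_integral (v y - v x) + (w y - w x)) {x..y}"
    by (intro has_integral_add W12_has_integral[OF assms(1)] W12_has_integral[OF assms(2)] *)
  then show "((\<lambda>x. g x + k x) has_integral (v y + w y - (v x + w x))) {x..y}"
    by (simp add: algebra_simps)
qed

lemma W12_diff:
  assumes "W12 a b v g" "W12 a b w k" shows "W12 a b (\<lambda>x. v x - w x) (\<lambda>x. g x - k x)"
  using W12_add[OF assms(1) W12_cmult[OF assms(2), of "-1"]] by simp

lemma W12_C1:
  assumes d: "\<And>x. x \<in> {a..b} \<Longrightarrow> (v has_real_derivative g x) (at x within {a..b})"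
    and c: "continuous_on {a..b} g"
  shows "W12 a b v g"
  unfolding W12_def
proof (intro conjI allI impI sqint_continuous c)
  fix x y assume "a \<le> x" "x \<le> y" "y \<le> b"
  then show "(g has_integral (v y - v x)) {x..y}"
    by (intro fundamental_theorem_of_calculus)
       (auto simp flip: has_real_derivative_iff_has_vector_derivative intro!: has_field_derivative_subset[OF d])
qed

lemma has_integral_shift:
  fixes f :: "real \<Rightarrow> real"
  assumes "(f has_integral i) {x + c..y + c}" shows "((\<lambda>t. f (t + c)) has_integral i) {x..y}"
  using has_integral_affinity[of f i "x + c" "y + c" 1 c] assms
  by (simp add: algebra_simps cbox_interval image_affinity_atLeastAtMost_div_diff)

lemma sqint_shift: assumes "sqint (a + c) (b + c) g" shows "sqint a b (\<lambda>x. g (x + c))"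
proof -
  have *: "(\<lambda>t. f (t + c)) integrable_on {a..b}" if "f integrable_on {a + c..b + c}" for f :: "real \<Rightarrow> real"
    using that has_integral_shift unfolding integrable_on_def by blast
  show ?thesis
    using *[OF sqint_sq[OF assms]] *[OF sqint_integrable[OF assms]] integrable_imp_measurable
    unfolding sqint_def by auto
qed

lemma W12_shift: "W12 (a + c) (b + c) v g \<Longrightarrow> W12 a b (\<lambda>x. v (x + c)) (\<lambda>x. g (x + c))"
  unfolding W12_def by (auto intro!: sqint_shift has_integral_shift)

text \<open>The increment of \<open>v w - \<integral> (g w + v k)\<close> over an interval is bounded by its length times
  \<open>\<integral> g\<^sup>2 + k\<^sup>2\<close>, so subdividing shows that it vanishes.\<close>

lemma W12_mult_has_integral:
  assumes V: "W12 a b v g" and W: "W12 a b w k" and "a \<le> b"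
  shows "((\<lambda>x. g x * w x + v x * k x) has_integral (v b * w b - v a * w a)) {a..b}"
proof -
  define h where "h = (\<lambda>x. g x * w x + v x * k x)"
  have cv: "continuous_on {a..b} v" and cw: "continuous_on {a..b} w"
    using W12_continuous V W by auto
  have hi: "h integrable_on {a..b}"
    unfolding h_def by (intro integrable_add sqint_mult sqint_continuous cv cw W12_sqint[OF V] W12_sqint[OF W])
  define D where "D x y = v y * w y - v x * w x - integral {x..y} h" for x y
  define s where "s x y = integral {x..y} (\<lambda>t. (g t)\<^sup>2 + (k t)\<^sup>2)" for x y
  have si: "(\<lambda>t. (g t)\<^sup>2 + (k t)\<^sup>2) integrable_on {a..b}"
    by (intro integrable_add sqint_sq W12_sqint[OF V] W12_sqint[OF W])
  have osc: "\<bar>u p - u q\<bar> \<le> integral {x..y} (\<lambda>t. \<bar>r t\<bar>)"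
    if "W12 a b u r" "p \<in> {x..y}" "q \<in> {x..y}" "a \<le> x" "y \<le> b" for u r p q x y
  proof -
    have main: "\<bar>u q - u p\<bar> \<le> integral {x..y} (\<lambda>t. \<bar>r t\<bar>)" if "p \<le> q" "p \<in> {x..y}" "q \<in> {x..y}" for p q
    proof -
      have ai: "r absolutely_integrable_on {x..y}"
        using sqint_abs_integrable[OF sqint_subinterval[OF W12_sqint[OF \<open>W12 a b u r\<close>]]] \<open>a \<le> x\<close> \<open>y \<le> b\<close> by auto
      have ai': "r absolutely_integrable_on {p..q}"
        by (rule absolutely_integrable_on_subinterval[OF ai]) (use that in auto)
      have "u q - u p = integral {p..q} r"
        using integral_unique[OF W12_has_integral[OF \<open>W12 a b u r\<close>, of p q]] that \<open>a \<le> x\<close> \<open>y \<le> b\<close> by auto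
      then have "\<bar>u q - u p\<bar> \<le> integral {p..q} (\<lambda>t. \<bar>r t\<bar>)"
        using ai' integral_norm_bound_integral[of r "{p..q}" "\<lambda>t. \<bar>r t\<bar>"]
        by (simp add: absolutely_integrable_on_def)
      also have "\<dots> \<le> integral {x..y} (\<lambda>t. \<bar>r t\<bar>)"
        using ai ai' that by (intro integral_subset_le) (auto simp: absolutely_integrable_on_def)
      finally show ?thesis .
    qed
    show ?thesis
      using main[of p q] main[of q p] that by (cases "p \<le> q") (auto simp: abs_minus_commute)
  qed
  have bound: "\<bar>D x y\<bar> \<le> (y - x) * s x y" if xy: "a \<le> x" "x \<le> y" "y \<le> b" for x y
  proof -
    have sg: "sqint x y g" and sk: "sqint x y k"
      using sqint_subinterval W12_sqint V W xy by blast+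
    define G K where "G = integral {x..y} (\<lambda>t. \<bar>g t\<bar>)" and "K = integral {x..y} (\<lambda>t. \<bar>k t\<bar>)"
    have ag: "(\<lambda>t. \<bar>g t\<bar>) integrable_on {x..y}" and ak: "(\<lambda>t. \<bar>k t\<bar>) integrable_on {x..y}"
      using sqint_abs_integrable sg sk by (auto simp: absolutely_integrable_on_def)
    have hi': "h integrable_on {x..y}"
      by (rule integrable_on_subinterval[OF hi]) (use xy in auto)
    \<comment> \<open>Splitting the increment of the product as
      \<open>(v y - v x) * w y + v x * (w y - w x)\<close> leaves only oscillations of
      \<open>w\<close> and \<open>v\<close> as factors of \<open>g\<close> and
      \<open>k\<close>.\<close>
    have "((\<lambda>t. g t * w y + v x * k t - h t) has_integral
        ((v y - v x) * w y + v x * (w y - w x) - integral {x..y} h)) {x..y}"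
      by (intro has_integral_diff has_integral_add has_integral_mult_left has_integral_mult_right
          W12_has_integral[OF V] W12_has_integral[OF W] xy integrable_integral hi')
    moreover have "(v y - v x) * w y + v x * (w y - w x) - integral {x..y} h = D x y"
      by (simp add: D_def algebra_simps)
    ultimately have Dh: "((\<lambda>t. g t * w y + v x * k t - h t) has_integral D x y) {x..y}" by simp
    have "norm (integral {x..y} (\<lambda>t. g t * w y + v x * k t - h t)) \<le> integral {x..y} (\<lambda>t. K * \<bar>g t\<bar> + G * \<bar>k t\<bar>)"
    proof (rule integral_norm_bound_integral)
      show "(\<lambda>t. g t * w y + v x * k t - h t) integrable_on {x..y}" using Dh by auto
      show "(\<lambda>t. K * \<bar>g t\<bar> + G * \<bar>k t\<bar>) integrable_on {x..y}"
        by (intro integrable_add integrable_on_mult_right ag ak)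
      fix t assume t: "t \<in> {x..y}"
      have "g t * w y + v x * k t - h t = (w y - w t) * g t + (v x - v t) * k t"
        by (simp add: h_def algebra_simps)
      also have "norm \<dots> \<le> \<bar>w y - w t\<bar> * \<bar>g t\<bar> + \<bar>v x - v t\<bar> * \<bar>k t\<bar>"
        by (metis abs_mult abs_triangle_ineq real_norm_def)
      also have "\<dots> \<le> K * \<bar>g t\<bar> + G * \<bar>k t\<bar>"
        unfolding G_def K_def using t xy
        by (intro add_mono mult_right_mono osc[OF V] osc[OF W]) auto
      finally show "norm (g t * w y + v x * k t - h t) \<le> K * \<bar>g t\<bar> + G * \<bar>k t\<bar>" .
    qed
    then have "\<bar>D x y\<bar> \<le> integral {x..y} (\<lambda>t. K * \<bar>g t\<bar> + G * \<bar>k t\<bar>)"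
      unfolding integral_unique[OF Dh] by simp
    also have "\<dots> = K * G + G * K"
      using ag ak by (simp add: integral_add integrable_on_mult_right G_def K_def)
    also have "\<dots> \<le> G\<^sup>2 + K\<^sup>2" using sum_squares_bound[of G K] by (simp add: algebra_simps)
    also have "\<dots> \<le> (y - x) * integral {x..y} (\<lambda>t. (g t)\<^sup>2) + (y - x) * integral {x..y} (\<lambda>t. (k t)\<^sup>2)"
      unfolding G_def K_def by (intro add_mono cauchy_schwarz_one sg sk xy)
    also have "\<dots> = (y - x) * s x y"
      unfolding s_def using sqint_sq sg sk by (subst integral_add) (auto simp: algebra_simps)
    finally show ?thesis .
  qed
  have small: "\<bar>D a b\<bar> \<le> e * (b - a)" if "e > 0" for e
  proof -
    define P where "P x y \<longleftrightarrow> (a \<le> x \<longrightarrow> y \<le> b \<longrightarrow> x \<le> y \<longrightarrow> \<bar>D x y\<bar> \<le> e * (y - x))" for x y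
    \<comment> \<open>Bisection: \<open>D\<close> is additive over adjacent intervals, and uniform
      continuity of the primitive of \<open>g^2 + k^2\<close> gives \<open>s p q \<le> e\<close> on
      short ones, so the local bounds add up.\<close>
    have "P a b" using \<open>a \<le> b\<close>
    proof (induction rule: Bolzano)
      case (trans p q r)
      show ?case unfolding P_def
      proof (intro impI)
        assume *: "a \<le> p" "r \<le> b" "p \<le> r"
        have "integral {p..q} h + integral {q..r} h = integral {p..r} h"
          by (intro Henstock_Kurzweil_Integration.integral_combine trans integrable_on_subinterval[OF hi]) (use * in auto)
        then have "D p r = D p q + D q r" unfolding D_def by simp
        moreover have "\<bar>D p q\<bar> \<le> e * (q - p)" "\<bar>D q r\<bar> \<le> e * (r - q)"
          using trans * unfolding P_def by auto
        moreover have "e * (q - p) + e * (r - q) = e * (r - p)" by (simp add: algebra_simps)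
        ultimately show "\<bar>D p r\<bar> \<le> e * (r - p)" by linarith
      qed
    next
      case (local x)
      have "uniformly_continuous_on {a..b} (\<lambda>y. s a y)"
        unfolding s_def by (intro compact_uniformly_continuous indefinite_integral_continuous_1 si) auto
      then obtain d where "d > 0" and d: "\<And>p q. p \<in> {a..b} \<Longrightarrow> q \<in> {a..b} \<Longrightarrow> dist q p < d \<Longrightarrow> dist (s a q) (s a p) < e"
        unfolding uniformly_continuous_on_def using \<open>e > 0\<close> by metis
      show ?case
      proof (intro exI[of _ d] conjI \<open>d > 0\<close> allI impI)
        fix p q assume pq: "p \<le> x \<and> x \<le> q \<and> q - p < d"
        show "P p q" unfolding P_def
        proof (intro impI)
          assume *: "a \<le> p" "q \<le> b" "p \<le> q"
          have "s a p + s p q = s a q" unfolding s_def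
            by (intro Henstock_Kurzweil_Integration.integral_combine integrable_on_subinterval[OF si]) (use * in auto)
          moreover have "dist (s a q) (s a p) < e" by (rule d) (use * pq in \<open>auto simp: dist_real_def\<close>)
          ultimately have "s p q \<le> e" by (simp add: dist_real_def)
          then have "(q - p) * s p q \<le> (q - p) * e" using * by (intro mult_left_mono) auto
          then show "\<bar>D p q\<bar> \<le> e * (q - p)" using bound[OF *(1) *(3) *(2)] by (simp add: mult.commute)
        qed
      qed
    qed
    then show ?thesis using \<open>a \<le> b\<close> unfolding P_def by auto
  qed
  have "D a b = 0"
  proof (cases "a = b")
    case True then show ?thesis using small[of 1] by simp
  next
    case False
    have "\<bar>D a b\<bar> \<le> 0 + e" if "e > 0" for e
      using small[of "e / (b - a)"] that False \<open>a \<le> b\<close> by simp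
    then have "\<bar>D a b\<bar> \<le> 0" by (rule field_le_epsilon)
    then show ?thesis by simp
  qed
  then show ?thesis
    using integrable_integral[OF hi] unfolding D_def h_def by simp
qed

lemma W12_mult:
  assumes V: "W12 a b v g" and W: "W12 a b w k"
  shows "W12 a b (\<lambda>x. v x * w x) (\<lambda>x. g x * w x + v x * k x)"
  unfolding W12_def
proof (intro conjI allI impI)
  have "sqint a b (\<lambda>x. w x * g x + v x * k x)"
    by (intro sqint_add sqint_mult_continuous W12_continuous[OF V] W12_continuous[OF W] W12_sqint[OF V] W12_sqint[OF W])
  then show "sqint a b (\<lambda>x. g x * w x + v x * k x)" by (simp add: mult.commute)
  fix x y assume "a \<le> x" "x \<le> y" "y \<le> b"
  then show "((\<lambda>x. g x * w x + v x * k x) has_integral (v y * w y - v x * w x)) {x..y}"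
    by (intro W12_mult_has_integral W12_subinterval[OF V] W12_subinterval[OF W])
qed

section \<open>Comparison inequalities for the energy\<close>

text \<open>Jacobi's identity: the right-hand side is completed to
  \<open>\<integral> (k - p w)\<^sup>2\<close> by the derivative of \<open>p w\<^sup>2\<close>.\<close>

lemma jacobi_inequality:
  assumes W: "W12 a b w k" and w0: "w a = 0" "w b = 0" and "a \<le> b"
    and p: "\<And>x. x \<in> {a..b} \<Longrightarrow> (p has_real_derivative p' x) (at x within {a..b})"
    and p': "continuous_on {a..b} p'"
  shows "integral {a..b} (\<lambda>x. - (p' x + (p x)\<^sup>2) * (w x)\<^sup>2) \<le> integral {a..b} (\<lambda>x. (k x)\<^sup>2)"
proof -
  note WP = W12_C1[OF p p']
  have cw: "continuous_on {a..b} w" and cp: "continuous_on {a..b} p"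
    using W12_continuous W WP by auto
  have ik: "((\<lambda>x. (k x)\<^sup>2) has_integral integral {a..b} (\<lambda>x. (k x)\<^sup>2)) {a..b}"
    using sqint_sq W12_sqint W by (auto intro: integrable_integral)
  have iw: "((\<lambda>x. - (p' x + (p x)\<^sup>2) * (w x)\<^sup>2) has_integral
      integral {a..b} (\<lambda>x. - (p' x + (p x)\<^sup>2) * (w x)\<^sup>2)) {a..b}"
    by (intro integrable_integral integrable_continuous_real continuous_intros cw cp p')
  have "((\<lambda>x. p' x * (w x * w x) + p x * (k x * w x + w x * k x)) has_integral
      (p b * (w b * w b) - p a * (w a * w a))) {a..b}"
    by (rule W12_mult_has_integral[OF WP W12_mult[OF W W] \<open>a \<le> b\<close>])
  then have "((\<lambda>x. p' x * (w x * w x) + p x * (k x * w x + w x * k x)) has_integral 0) {a..b}"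
    by (simp add: w0)
  from has_integral_diff[OF has_integral_diff[OF ik this] iw]
  have "0 \<le> integral {a..b} (\<lambda>x. (k x)\<^sup>2) - 0 - integral {a..b} (\<lambda>x. - (p' x + (p x)\<^sup>2) * (w x)\<^sup>2)"
  proof (rule has_integral_nonneg)
    fix x
    have "(k x)\<^sup>2 - (p' x * (w x * w x) + p x * (k x * w x + w x * k x)) - - (p' x + (p x)\<^sup>2) * (w x)\<^sup>2
        = (k x - p x * w x)\<^sup>2"
      by (simp add: power2_eq_square algebra_simps)
    then show "0 \<le> (k x)\<^sup>2 - (p' x * (w x * w x) + p x * (k x * w x + w x * k x)) - - (p' x + (p x)\<^sup>2) * (w x)\<^sup>2"
      by simp
  qed
  then show ?thesis by simp
qed

text \<open>The logarithmic derivative \<open>p\<close> of \<open>cos (l * (x - m))\<close>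
  satisfies \<open>p' + p^2 = - l^2\<close>. For \<open>l < 1\<close> the cosine stays positive on
  an interval of length at most pi centred at \<open>m\<close>, so the tangent has no pole; letting
  \<open>z = l^2\<close> tend to 1 covers length pi itself.\<close>

lemma dirichlet_inequality:
  assumes W: "W12 a b w k" and w0: "w a = 0" "w b = 0" and "a \<le> b" "b - a \<le> pi"
  shows "integral {a..b} (\<lambda>x. (w x)\<^sup>2) \<le> integral {a..b} (\<lambda>x. (k x)\<^sup>2)"
proof (rule field_le_mult_one_interval)
  fix z :: real assume z: "0 < z" "z < 1"
  define l where "l = sqrt z"
  have l: "0 < l" "l < 1" "l\<^sup>2 = z" using z by (auto simp: l_def)
  define m where "m = (a + b) / 2"
  define p where "p = (\<lambda>x. - l * tan (l * (x - m)))"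
  define p' where "p' = (\<lambda>x. - l * (inverse ((cos (l * (x - m)))\<^sup>2) * l))"
  have cpos: "cos (l * (x - m)) > 0" if "x \<in> {a..b}" for x
  proof -
    have "\<bar>x - m\<bar> \<le> pi / 2" using that assms(5) unfolding m_def by (auto simp: abs_le_iff field_simps)
    then have "l * \<bar>x - m\<bar> \<le> l * (pi / 2)" using l by (intro mult_left_mono) auto
    also have "\<dots> < pi / 2" using l pi_gt_zero by simp
    finally have "\<bar>l * (x - m)\<bar> < pi / 2" using l by (simp add: abs_mult)
    then show ?thesis by (intro cos_gt_zero_pi) auto
  qed
  have "integral {a..b} (\<lambda>x. - (p' x + (p x)\<^sup>2) * (w x)\<^sup>2) \<le> integral {a..b} (\<lambda>x. (k x)\<^sup>2)"
  proof (rule jacobi_inequality[OF W w0 \<open>a \<le> b\<close>])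
    fix x assume x: "x \<in> {a..b}"
    show "(p has_real_derivative p' x) (at x within {a..b})"
      unfolding p_def p'_def using cpos[OF x]
      by (auto intro!: derivative_eq_intros)
  next
    show "continuous_on {a..b} p'"
      unfolding p'_def using cpos by (intro continuous_intros) (metis less_irrefl power_eq_0_iff)
  qed
  also have "integral {a..b} (\<lambda>x. - (p' x + (p x)\<^sup>2) * (w x)\<^sup>2) = integral {a..b} (\<lambda>x. z * (w x)\<^sup>2)"
  proof (rule integral_cong)
    fix x assume x: "x \<in> {a..b}"
    have "inverse ((cos (l * (x - m)))\<^sup>2) = 1 + (tan (l * (x - m)))\<^sup>2"
      using tan_sec[of "l * (x - m)"] cpos[OF x] by (simp add: power_inverse)
    then have "- (p' x + (p x)\<^sup>2) = z"
      unfolding p_def p'_def l(3)[symmetric] by (simp add: power2_eq_square algebra_simps)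
    then show "- (p' x + (p x)\<^sup>2) * (w x)\<^sup>2 = z * (w x)\<^sup>2" by simp
  qed
  finally show "z * integral {a..b} (\<lambda>x. (w x)\<^sup>2) \<le> integral {a..b} (\<lambda>x. (k x)\<^sup>2)" by simp
qed

section \<open>Energy and its lower bounds by boundary values\<close>

definition energy :: "real \<Rightarrow> real \<Rightarrow> (real \<Rightarrow> real) \<Rightarrow> (real \<Rightarrow> real) \<Rightarrow> real" where
  "energy a b v g = integral {a..b} (\<lambda>x. (g x)\<^sup>2 - (v x)\<^sup>2)"

lemma energy_has_integral:
  assumes "W12 a b v g"
  shows "((\<lambda>x. (g x)\<^sup>2 - (v x)\<^sup>2) has_integral energy a b v g) {a..b}"
  unfolding energy_def
  by (intro integrable_integral integrable_diff sqint_sq W12_sqint[OF assms] sqint_continuous W12_continuous[OF assms])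

text \<open>The difference \<open>v - h\<close> vanishes at the end points, so its energy is nonnegative by Dirichlet's
  inequality; the cross terms are integrated by parts.\<close>

lemma energy_ge_test_function:
  assumes V: "W12 a b v g" and "a \<le> b" "b - a \<le> pi"
    and h: "\<And>x. (h has_real_derivative h' x) (at x)"
    and h': "\<And>x. (h' has_real_derivative h'' x) (at x)"
    and h'': "continuous_on {a..b} h''"
    and bd: "h a = v a" "h b = v b"
    and vI: "((\<lambda>x. v x * (h'' x + h x)) has_integral I) {a..b}"
    and hI: "((\<lambda>x. h x * (h'' x + h x)) has_integral I') {a..b}"
  shows "v b * h' b - v a * h' a - 2 * I + I' \<le> energy a b v g"
proof -
  have "continuous_on {a..b} h'"
    using h' by (meson DERIV_isCont continuous_at_imp_continuous_on)
  then have Wh: "W12 a b h h'"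
    by (intro W12_C1 has_field_derivative_at_within[OF h])
  have Wh': "W12 a b h' h''"
    by (intro W12_C1 has_field_derivative_at_within[OF h'] h'')
  have W: "W12 a b (\<lambda>x. v x - h x) (\<lambda>x. g x - h' x)" by (rule W12_diff[OF V Wh])
  have "integral {a..b} (\<lambda>x. (v x - h x)\<^sup>2) \<le> integral {a..b} (\<lambda>x. (g x - h' x)\<^sup>2)"
    by (rule dirichlet_inequality[OF W]) (use assms in auto)
  then have pos: "0 \<le> energy a b (\<lambda>x. v x - h x) (\<lambda>x. g x - h' x)"
    unfolding energy_def
    by (subst integral_diff) (auto intro!: sqint_sq W12_sqint[OF W] sqint_continuous W12_continuous[OF W])
  have "((\<lambda>x. (g x * h' x + v x * h'' x) * 2 - (h' x * h' x + h x * h'' x)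
       - (v x * (h'' x + h x)) * 2 + h x * (h'' x + h x)) has_integral
       (v b * h' b - v a * h' a) * 2 - (h b * h' b - h a * h' a) - I * 2 + I') {a..b}"
    by (intro has_integral_add has_integral_diff has_integral_mult_left vI hI
        W12_mult_has_integral[OF V Wh' \<open>a \<le> b\<close>] W12_mult_has_integral[OF Wh Wh' \<open>a \<le> b\<close>])
  from has_integral_add[OF this energy_has_integral[OF W]]
  have "((\<lambda>x. (g x)\<^sup>2 - (v x)\<^sup>2) has_integral
       (v b * h' b - v a * h' a) * 2 - (h b * h' b - h a * h' a) - I * 2 + I' +
       energy a b (\<lambda>x. v x - h x) (\<lambda>x. g x - h' x)) {a..b}"
    by (rule has_integral_eq_rhs[OF has_integral_eq, rotated]) (auto simp: power2_eq_square algebra_simps)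
  then have "energy a b v g = (v b * h' b - v a * h' a) * 2 - (h b * h' b - h a * h' a) - I * 2 + I' +
       energy a b (\<lambda>x. v x - h x) (\<lambda>x. g x - h' x)"
    unfolding energy_def by (rule integral_unique)
  then show ?thesis using pos bd by simp
qed

text \<open>The test function solves \<open>h'' + h = 4 * A\<close>, a constant, to which
  \<open>v\<close> is orthogonal. Any constant \<open>c * A\<close> could be prescribed on the
  right; the bound is best at \<open>c = 4 / (4 - pi)\<close>, about 4.66, and the simpler
  \<open>c = 4\<close> leaves \<open>8 * pi - 18\<close>, which exceeds \<open>2 * pi\<close>
  because \<open>pi > 3\<close>.\<close>

lemma energy_ge_mean_zero:
  assumes V: "W12 0 (pi/2) v g" and bd: "v (pi/2) = v 0" and mean: "(v has_integral 0) {0..pi/2}"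
  shows "2 * pi * (v 0)\<^sup>2 \<le> energy 0 (pi/2) v g"
proof -
  define A where "A = v 0"
  define h where "h = (\<lambda>x. 4 * A - 3 * A * (cos x + sin x))"
  define h' where "h' = (\<lambda>x. - 3 * A * (cos x - sin x))"
  define h'' where "h'' = (\<lambda>x. 3 * A * (cos x + sin x))"
  have hint: "((\<lambda>x. h x * (h'' x + h x)) has_integral
      (16 * A\<^sup>2 * (pi/2) - 12 * A\<^sup>2 * (sin (pi/2) - cos (pi/2))) -
      (16 * A\<^sup>2 * 0 - 12 * A\<^sup>2 * (sin 0 - cos 0))) {0..pi/2}"
    by (rule fundamental_theorem_of_calculus[where f = "\<lambda>x. 16 * A\<^sup>2 * x - 12 * A\<^sup>2 * (sin x - cos x)"])
       (auto intro!: derivative_eq_intros simp: h_def h''_def power2_eq_square algebra_simps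
         simp flip: has_real_derivative_iff_has_vector_derivative)
  have "v (pi/2) * h' (pi/2) - v 0 * h' 0 - 2 * 0 +
     ((16 * A\<^sup>2 * (pi/2) - 12 * A\<^sup>2 * (sin (pi/2) - cos (pi/2))) -
      (16 * A\<^sup>2 * 0 - 12 * A\<^sup>2 * (sin 0 - cos 0))) \<le> energy 0 (pi/2) v g"
  proof (rule energy_ge_test_function[OF V _ _ _ _ _ _ _ _ hint])
    show "((\<lambda>x. v x * (h'' x + h x)) has_integral 0) {0..pi/2}"
      using has_integral_mult_left[OF mean, of "4 * A"] by (simp add: h_def h''_def)
    show "(h has_real_derivative h' x) (at x)" for x
      unfolding h_def h'_def by (auto intro!: derivative_eq_intros simp: algebra_simps)
    show "(h' has_real_derivative h'' x) (at x)" for x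
      unfolding h'_def h''_def by (auto intro!: derivative_eq_intros simp: algebra_simps)
    show "continuous_on {0..pi/2} h''" unfolding h''_def by (intro continuous_intros)
  qed (auto simp: h_def bd A_def)
  then have "(8 * pi - 18) * A\<^sup>2 \<le> energy 0 (pi/2) v g"
    by (simp add: h'_def bd flip: A_def) (simp add: power2_eq_square algebra_simps)
  moreover have "2 * pi * A\<^sup>2 \<le> (8 * pi - 18) * A\<^sup>2"
    using pi_gt3 by (intro mult_right_mono) auto
  ultimately show ?thesis by (simp add: A_def)
qed

text \<open>The test function solves \<open>h'' + h = 4 A cos\<close>, and \<open>v\<close> is orthogonal to the right-hand side.\<close>

lemma energy_ge_antiperiodic:
  assumes V: "W12 0 pi v g" and bd: "v pi = - v 0" and orth: "((\<lambda>x. v x * cos x) has_integral 0) {0..pi}"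
  shows "2 * pi * (v 0)\<^sup>2 \<le> energy 0 pi v g"
proof -
  define A where "A = v 0"
  define h where "h = (\<lambda>x. A * (cos x - (pi - 2 * x) * sin x))"
  define h' where "h' = (\<lambda>x. A * (sin x - (pi - 2 * x) * cos x))"
  define h'' where "h'' = (\<lambda>x. A * (3 * cos x + (pi - 2 * x) * sin x))"
  \<comment> \<open>This integral is 0: \<open>h\<close> is itself orthogonal to cosine, hence a
    competitor, and the constant \<open>2 * pi\<close> is attained by it.\<close>
  have hint: "((\<lambda>x. h x * (h'' x + h x)) has_integral
      (4 * A\<^sup>2 * (pi/2 + sin (2*pi) / 2 + (pi - 2*pi) * cos (2*pi) / 4)) -
      (4 * A\<^sup>2 * (0/2 + sin (2*0) / 2 + (pi - 2*0) * cos (2*0) / 4))) {0..pi}"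
  proof (rule fundamental_theorem_of_calculus[where f = "\<lambda>x. 4 * A\<^sup>2 * (x/2 + sin (2*x) / 2 + (pi - 2*x) * cos (2*x) / 4)"])
    fix x :: real
    have *: "h x * (h'' x + h x) = 4 * A\<^sup>2 * (1/2 + cos (2*x) + ((pi - 2*x) * (- sin (2*x) * 2) - 2 * cos (2*x)) / 4)"
      unfolding h_def h''_def cos_double_cos sin_double by (simp add: power2_eq_square field_simps)
    then show "((\<lambda>x. 4 * A\<^sup>2 * (x/2 + sin (2*x) / 2 + (pi - 2*x) * cos (2*x) / 4)) has_vector_derivative
        h x * (h'' x + h x)) (at x within {0..pi})"
      unfolding * by (auto intro!: derivative_eq_intros simp: field_simps
         simp flip: has_real_derivative_iff_has_vector_derivative)
  qed simp
  have "v pi * h' pi - v 0 * h' 0 - 2 * 0 +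
     ((4 * A\<^sup>2 * (pi/2 + sin (2*pi) / 2 + (pi - 2*pi) * cos (2*pi) / 4)) -
      (4 * A\<^sup>2 * (0/2 + sin (2*0) / 2 + (pi - 2*0) * cos (2*0) / 4))) \<le> energy 0 pi v g"
  proof (rule energy_ge_test_function[OF V _ _ _ _ _ _ _ _ hint])
    have "(\<lambda>x. v x * cos x * (4 * A)) = (\<lambda>x. v x * (h'' x + h x))"
      by (auto simp: h_def h''_def algebra_simps)
    then show "((\<lambda>x. v x * (h'' x + h x)) has_integral 0) {0..pi}"
      using has_integral_mult_left[OF orth, of "4 * A"] by (simp only: mult_zero_left)
    show "(h has_real_derivative h' x) (at x)" for x
      unfolding h_def h'_def by (auto intro!: derivative_eq_intros simp: algebra_simps)
    show "(h' has_real_derivative h'' x) (at x)" for x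
      unfolding h'_def h''_def by (auto intro!: derivative_eq_intros simp: algebra_simps)
    show "continuous_on {0..pi} h''" unfolding h''_def by (intro continuous_intros)
  qed (auto simp: h_def bd A_def)
  then show ?thesis
    by (simp add: h'_def bd flip: A_def) (simp add: power2_eq_square algebra_simps)
qed

section \<open>Components under rotation by a quarter period\<close>

lemma integral_periodic:
  fixes f :: "real \<Rightarrow> real"
  assumes i: "\<And>x y. f integrable_on {x..y}" and per: "\<And>x. f (x + T) = f x" and ab: "a \<le> b" "b \<le> a + T"
  shows "integral {b..b + T} f = integral {a..a + T} f"
proof -
  have "((\<lambda>x. f (x + T)) has_integral integral {a + T..b + T} f) {a..b}"
    by (intro has_integral_shift integrable_integral i)
  then have 1: "integral {a..b} f = integral {a + T..b + T} f" by (simp add: per integral_unique)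
  have 2: "integral {a..b} f + integral {b..a + T} f = integral {a..a + T} f"
    by (intro Henstock_Kurzweil_Integration.integral_combine i ab)
  have 3: "integral {b..a + T} f + integral {a + T..b + T} f = integral {b..b + T} f"
    by (intro Henstock_Kurzweil_Integration.integral_combine i ab) (use ab in auto)
  show ?thesis using 1 2 3 by simp
qed

lemma has_integral_fold:
  fixes f :: "real \<Rightarrow> real"
  assumes f: "(f has_integral I) {0..2 * T}" and "T \<ge> 0"
  shows "((\<lambda>x. f x + f (x + T)) has_integral I) {0..T}"
proof -
  have i: "f integrable_on {0..T}" "f integrable_on {0 + T..T + T}"
    using \<open>T \<ge> 0\<close> by (intro integrable_on_subinterval[OF has_integral_integrable[OF f]]; force)+
  have "integral {0..T} f + integral {T..2 * T} f = I"
    using Henstock_Kurzweil_Integration.integral_combine[of 0 T "2 * T" f] assms has_integral_iff by fastforce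
  then show ?thesis
    using has_integral_add[OF integrable_integral[OF i(1)] has_integral_shift[OF integrable_integral[OF i(2)]]]
    by simp
qed

lemma has_integral_fold4:
  fixes f :: "real \<Rightarrow> real"
  assumes f: "(f has_integral I) {0..2 * pi}"
  shows "((\<lambda>x. f x + f (x + pi/2) + f (x + pi) + f (x + 3*pi/2)) has_integral I) {0..pi/2}"
proof -
  have "((\<lambda>x. f x + f (x + pi)) has_integral I) {0..2 * (pi/2)}"
    using has_integral_fold[OF f] by simp
  from has_integral_fold[OF this]
  have "((\<lambda>x. f x + f (x + pi) + (f (x + pi/2) + f (x + pi/2 + pi))) has_integral I) {0..pi/2}" by simp
  moreover have "x + pi/2 + pi = x + 3*pi/2" for x by simp
  ultimately show ?thesis by (simp only: ac_simps)
qed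

lemma quarter_turns:
  fixes x :: real
  shows "cos (x + pi/2) = - sin x" "sin (x + pi/2) = cos x" "cos (x + pi) = - cos x" "sin (x + pi) = - sin x"
    "cos (x + 3*pi/2) = sin x" "sin (x + 3*pi/2) = - cos x"
proof -
  show *: "cos (x + pi/2) = - sin x" "sin (x + pi/2) = cos x" for x :: real by (simp_all add: sin_add cos_add)
  have e: "x + 3*pi/2 = x + pi/2 + pi" by simp
  show "cos (x + 3*pi/2) = sin x" "sin (x + 3*pi/2) = - cos x"
    unfolding e cos_periodic_pi sin_periodic_pi * by simp_all
qed simp_all

text \<open>The components of \<open>v\<close> under rotation by \<open>\<pi>/2\<close> for the characters \<open>1\<close>, \<open>-1\<close>, and
  for the pair \<open>\<plusminus>i\<close> together.\<close>

definition avg_part :: "(real \<Rightarrow> real) \<Rightarrow> real \<Rightarrow> real" where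
  "avg_part v x = (v x + v (x + pi/2) + v (x + pi) + v (x + 3*pi/2)) / 4"

definition alt_part :: "(real \<Rightarrow> real) \<Rightarrow> real \<Rightarrow> real" where
  "alt_part v x = (v x - v (x + pi/2) + v (x + pi) - v (x + 3*pi/2)) / 4"

definition odd_part :: "(real \<Rightarrow> real) \<Rightarrow> real \<Rightarrow> real" where
  "odd_part v x = (v x - v (x + pi)) / 2"

lemma odd_part_quarter: "odd_part v (x + pi/2) = (v (x + pi/2) - v (x + 3*pi/2)) / 2"
proof -
  have *: "x + pi/2 + pi = x + 3*pi/2" by simp
  show ?thesis unfolding odd_part_def * ..
qed

lemma part_shift:
  "avg_part (\<lambda>x. v (x + c)) x = avg_part v (x + c)"
  "alt_part (\<lambda>x. v (x + c)) x = alt_part v (x + c)"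
  "odd_part (\<lambda>x. v (x + c)) x = odd_part v (x + c)"
  unfolding avg_part_def alt_part_def odd_part_def by (simp_all add: add_ac)

lemma part_periodic:
  assumes per: "\<And>x. v (x + 2 * pi) = v x"
  shows "avg_part v (x + pi/2) = avg_part v x" "alt_part v (x + pi/2) = - alt_part v x"
    "odd_part v (x + pi) = - odd_part v x"
proof -
  have *: "x + pi/2 + pi/2 = x + pi" "x + pi/2 + pi = x + 3*pi/2" "x + pi/2 + 3*pi/2 = x + 2 * pi"
    "x + pi + pi = x + 2 * pi" by auto
  show "avg_part v (x + pi/2) = avg_part v x" "alt_part v (x + pi/2) = - alt_part v x"
    unfolding avg_part_def alt_part_def * per by (simp_all add: field_simps)
  show "odd_part v (x + pi) = - odd_part v x"
    unfolding odd_part_def * per by (simp add: field_simps)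
qed

lemma W12_part:
  assumes W: "\<And>a b. W12 a b v g"
  shows "W12 a b (avg_part v) (avg_part g)" "W12 a b (alt_part v) (alt_part g)"
    "W12 a b (odd_part v) (odd_part g)"
proof -
  note * = W W12_shift[OF W, of a b]
  have "W12 a b (\<lambda>x. 1/4 * (v x + v (x + pi/2) + v (x + pi) + v (x + 3*pi/2)))
      (\<lambda>x. 1/4 * (g x + g (x + pi/2) + g (x + pi) + g (x + 3*pi/2)))"
    by (intro W12_cmult W12_add *)
  moreover have "W12 a b (\<lambda>x. 1/4 * (v x - v (x + pi/2) + v (x + pi) - v (x + 3*pi/2)))
      (\<lambda>x. 1/4 * (g x - g (x + pi/2) + g (x + pi) - g (x + 3*pi/2)))"
    by (intro W12_cmult W12_add W12_diff *)
  moreover have "W12 a b (\<lambda>x. 1/2 * (v x - v (x + pi))) (\<lambda>x. 1/2 * (g x - g (x + pi)))"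
    by (intro W12_cmult W12_diff *)
  ultimately show "W12 a b (avg_part v) (avg_part g)" "W12 a b (alt_part v) (alt_part g)"
    "W12 a b (odd_part v) (odd_part g)"
    unfolding avg_part_def[abs_def] alt_part_def[abs_def] odd_part_def[abs_def] by auto
qed

text \<open>The constraints are moved to \<open>{0..2 * pi}\<close>, which folds into four quarter
  periods. The derivative is carried along as a periodic function, so that translations act on the
  pair.\<close>

definition admissible :: "(real \<Rightarrow> real) \<Rightarrow> (real \<Rightarrow> real) \<Rightarrow> bool" where
  "admissible v g \<longleftrightarrow> (\<forall>a b. W12 a b v g) \<and>
     (\<forall>x. v (x + 2 * pi) = v x) \<and> (\<forall>x. g (x + 2 * pi) = g x) \<and>
     (v has_integral 0) {0..2 * pi} \<and>
     ((\<lambda>x. v x * cos x) has_integral 0) {0..2 * pi} \<and>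
     ((\<lambda>x. v x * sin x) has_integral 0) {0..2 * pi}"

lemma admissible_W12: "admissible v g \<Longrightarrow> W12 a b v g"
  and admissible_periodic: "admissible v g \<Longrightarrow> v (x + 2 * pi) = v x" "admissible v g \<Longrightarrow> g (x + 2 * pi) = g x"
  unfolding admissible_def by auto

text \<open>The span of cosine and sine is translation invariant: writing \<open>x\<close> as
  \<open>(x + c) - c\<close> expresses each new orthogonality condition through the two old
  ones.\<close>

lemma admissible_shift:
  assumes A: "admissible v g" and c: "0 \<le> c" "c \<le> 2 * pi"
  shows "admissible (\<lambda>x. v (x + c)) (\<lambda>x. g (x + c))"
  unfolding admissible_def
proof (intro conjI allI)
  note W = admissible_W12[OF A] and per = admissible_periodic[OF A]
  have shift: "((\<lambda>x. v (x + c) * p (x + c)) has_integral 0) {0..2 * pi}"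
    if "((\<lambda>x. v x * p x) has_integral 0) {0..2 * pi}" "continuous_on UNIV p" "\<And>x. p (x + 2 * pi) = p x" for p
  proof -
    have i: "(\<lambda>x. v x * p x) integrable_on {x..y}" for x y
      by (intro integrable_continuous_real continuous_intros W12_continuous[OF W] continuous_on_subset[OF that(2)]) auto
    have "integral {c..c + 2 * pi} (\<lambda>x. v x * p x) = integral {0..0 + 2 * pi} (\<lambda>x. v x * p x)"
      by (rule integral_periodic[OF i]) (use that(3) per c in auto)
    then have "((\<lambda>x. v x * p x) has_integral 0) {0 + c..2 * pi + c}"
      using i that(1) by (simp add: has_integral_iff add.commute)
    from has_integral_shift[OF this] show ?thesis .
  qed
  show "W12 a b (\<lambda>x. v (x + c)) (\<lambda>x. g (x + c))" for a b by (intro W12_shift W)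
  show "v (x + 2 * pi + c) = v (x + c)" "g (x + 2 * pi + c) = g (x + c)" for x
    using per[of "x + c"] by (simp_all add: ac_simps)
  show "((\<lambda>x. v (x + c)) has_integral 0) {0..2 * pi}"
    using shift[of "\<lambda>_. 1"] A unfolding admissible_def by auto
  have cs: "((\<lambda>x. v (x + c) * cos (x + c)) has_integral 0) {0..2 * pi}"
    "((\<lambda>x. v (x + c) * sin (x + c)) has_integral 0) {0..2 * pi}"
    using A unfolding admissible_def by (auto intro!: shift continuous_intros)
  have "((\<lambda>x. v (x + c) * cos (x + c) * cos c + v (x + c) * sin (x + c) * sin c) has_integral
      0 * cos c + 0 * sin c) {0..2 * pi}"
    by (intro has_integral_add has_integral_mult_left cs)
  moreover have "v (x + c) * cos x = v (x + c) * cos (x + c) * cos c + v (x + c) * sin (x + c) * sin c" for x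
  proof -
    have "cos x = cos (x + c) * cos c + sin (x + c) * sin c" using cos_diff[of "x + c" c] by simp
    then show ?thesis by (metis mult.assoc distrib_left)
  qed
  ultimately show "((\<lambda>x. v (x + c) * cos x) has_integral 0) {0..2 * pi}" by simp
  have "((\<lambda>x. v (x + c) * sin (x + c) * cos c - v (x + c) * cos (x + c) * sin c) has_integral
      0 * cos c - 0 * sin c) {0..2 * pi}"
    by (intro has_integral_diff has_integral_mult_left cs)
  moreover have "v (x + c) * sin x = v (x + c) * sin (x + c) * cos c - v (x + c) * cos (x + c) * sin c" for x
  proof -
    have "sin x = sin (x + c) * cos c - cos (x + c) * sin c" using sin_diff[of "x + c" c] by simp
    then show ?thesis by (metis mult.assoc right_diff_distrib)
  qed
  ultimately show "((\<lambda>x. v (x + c) * sin x) has_integral 0) {0..2 * pi}" by simp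
qed

text \<open>Energy density of \<open>v - alt_part v\<close>, summed over the four quarter turns. The
  weights 4, 2, 2 come from Parseval's identity for rotations of order four, as in
  \<open>square_parts\<close>.\<close>

definition rest_density :: "(real \<Rightarrow> real) \<Rightarrow> (real \<Rightarrow> real) \<Rightarrow> real \<Rightarrow> real" where
  "rest_density v g x = 4 * ((avg_part g x)\<^sup>2 - (avg_part v x)\<^sup>2) + 2 * ((odd_part g x)\<^sup>2 - (odd_part v x)\<^sup>2)
     + 2 * ((odd_part g (x + pi/2))\<^sup>2 - (odd_part v (x + pi/2))\<^sup>2)"

definition rest_energy :: "(real \<Rightarrow> real) \<Rightarrow> (real \<Rightarrow> real) \<Rightarrow> real" where
  "rest_energy v g = integral {0..pi/2} (rest_density v g)"

definition rest_square :: "(real \<Rightarrow> real) \<Rightarrow> real \<Rightarrow> real" where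
  "rest_square v x = 4 * (avg_part v x)\<^sup>2 + 2 * (odd_part v x)\<^sup>2 + 2 * (odd_part v (x + pi/2))\<^sup>2"

lemma rest_density_integrable:
  assumes A: "admissible v g"
  shows "rest_density v g integrable_on {a..b}"
proof -
  note W = W12_part[OF admissible_W12[OF A]]
  have "W12 a b (\<lambda>x. odd_part v (x + pi/2)) (\<lambda>x. odd_part g (x + pi/2))" by (intro W12_shift W)
  then show ?thesis unfolding rest_density_def[abs_def]
    by (intro integrable_add integrable_on_mult_right has_integral_integrable[OF energy_has_integral] W)
qed

text \<open>Bounding the two values separately would count the energy twice. Instead
  \<open>energy_ge_antiperiodic\<close> is applied to the combination \<open>R\<close> with
  coefficients \<open>o1 0\<close> and \<open>o2 0\<close>, for which \<open>R 0\<close> is the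
  whole sum of squares.\<close>

lemma energy_odd_part:
  assumes A: "admissible v g"
  shows "4 * pi * ((odd_part v 0)\<^sup>2 + (odd_part v (pi/2))\<^sup>2) \<le>
    integral {0..pi/2} (\<lambda>x. 2 * ((odd_part g x)\<^sup>2 - (odd_part v x)\<^sup>2)
     + 2 * ((odd_part g (x + pi/2))\<^sup>2 - (odd_part v (x + pi/2))\<^sup>2))" (is "_ \<le> integral _ ?d")
proof -
  define o1 p1 where "o1 = odd_part v" and "p1 = odd_part g"
  define o2 p2 where "o2 = (\<lambda>x. odd_part v (x + pi/2))" and "p2 = (\<lambda>x. odd_part g (x + pi/2))"
  have W1: "W12 a b o1 p1" for a b
    unfolding o1_def p1_def by (rule W12_part[OF admissible_W12[OF A]])
  then have W2: "W12 a b o2 p2" for a b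
    unfolding o1_def p1_def o2_def p2_def by (rule W12_shift)
  have anti: "odd_part v (x + pi/2 + pi/2) = - odd_part v x" "odd_part g (x + pi/2 + pi/2) = - odd_part g x" for x
  proof -
    have *: "x + pi/2 + pi/2 = x + pi" by simp
    show "odd_part v (x + pi/2 + pi/2) = - odd_part v x" "odd_part g (x + pi/2 + pi/2) = - odd_part g x"
      unfolding * using part_periodic(3) admissible_periodic[OF A] by auto
  qed
  have quarter: "o1 (x + pi/2) = o2 x" "p1 (x + pi/2) = p2 x" "o2 (x + pi/2) = - o1 x" "p2 (x + pi/2) = - p1 x" for x
    unfolding o1_def p1_def o2_def p2_def by (rule refl anti)+
  have di: "?d integrable_on {0..pi/2}"
    using W1 W2 unfolding o1_def p1_def o2_def p2_def
    by (intro integrable_add integrable_on_mult_right has_integral_integrable[OF energy_has_integral])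
  \<comment> \<open>Folded over the four quarter turns, cosine and sine pair only with the odd
    component; two of the three constraints enter here.\<close>
  have c1: "((\<lambda>x. o1 x * cos x - o2 x * sin x) has_integral 0) {0..pi/2}"
  proof -
    have "((\<lambda>x. v x * cos x) has_integral 0) {0..2 * pi}" using A unfolding admissible_def by auto
    from has_integral_mult_left[OF has_integral_fold4[OF this], of "1/2"]
    have "((\<lambda>x. o1 x * cos x - o2 x * sin x) has_integral 0 * (1/2)) {0..pi/2}"
      by (rule has_integral_eq[rotated])
         (unfold quarter_turns, simp add: o1_def o2_def odd_part_quarter, simp add: odd_part_def field_simps)
    then show ?thesis by simp
  qed
  have c2: "((\<lambda>x. o1 x * sin x + o2 x * cos x) has_integral 0) {0..pi/2}"
  proof -
    have "((\<lambda>x. v x * sin x) has_integral 0) {0..2 * pi}" using A unfolding admissible_def by auto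
    from has_integral_mult_left[OF has_integral_fold4[OF this], of "1/2"]
    have "((\<lambda>x. o1 x * sin x + o2 x * cos x) has_integral 0 * (1/2)) {0..pi/2}"
      by (rule has_integral_eq[rotated])
         (unfold quarter_turns, simp add: o1_def o2_def odd_part_quarter, simp add: odd_part_def field_simps)
    then show ?thesis by simp
  qed
  text \<open>For \<open>R = a o1 + b o2\<close>, rotation by \<open>\<pi>/2\<close> gives \<open>a o2 - b o1\<close>, so the energy of \<open>R\<close> is
    \<open>a\<^sup>2 + b\<^sup>2\<close> times that of \<open>o1\<close> whatever the coefficients.\<close>
  have main: "2 * pi * (a * o1 0 + b * o2 0)\<^sup>2 \<le> (a\<^sup>2 + b\<^sup>2) * (integral {0..pi/2} ?d / 2)" for a b
  proof -
    define R where "R = (\<lambda>x. a * o1 x + b * o2 x)"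
    define S where "S = (\<lambda>x. a * p1 x + b * p2 x)"
    have WR: "W12 x y R S" for x y
      unfolding R_def S_def by (intro W12_add W12_cmult W1 W2)
    have Rq: "R (x + pi/2) = a * o2 x - b * o1 x" "S (x + pi/2) = a * p2 x - b * p1 x" for x
      by (simp_all add: R_def S_def quarter)
    have alg: "x = c * (i / 2)" if "x = i * (c / 2)" for x c i :: real using that by simp
    have "((\<lambda>x. (S x)\<^sup>2 - (R x)\<^sup>2) has_integral energy 0 pi R S) {0..2 * (pi/2)}"
      using energy_has_integral[OF WR] by simp
    from has_integral_fold[OF this]
    have "((\<lambda>x. ((S x)\<^sup>2 - (R x)\<^sup>2) + ((S (x + pi/2))\<^sup>2 - (R (x + pi/2))\<^sup>2)) has_integral energy 0 pi R S) {0..pi/2}"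
      by simp
    moreover have "((S x)\<^sup>2 - (R x)\<^sup>2) + ((S (x + pi/2))\<^sup>2 - (R (x + pi/2))\<^sup>2) = ?d x * ((a\<^sup>2 + b\<^sup>2) / 2)" for x
      unfolding Rq unfolding R_def S_def o1_def p1_def o2_def p2_def
      by (simp add: power2_eq_square field_simps)
    ultimately have "((\<lambda>x. ?d x * ((a\<^sup>2 + b\<^sup>2) / 2)) has_integral energy 0 pi R S) {0..pi/2}"
      by (simp only:)
    moreover have "((\<lambda>x. ?d x * ((a\<^sup>2 + b\<^sup>2) / 2)) has_integral integral {0..pi/2} ?d * ((a\<^sup>2 + b\<^sup>2) / 2)) {0..pi/2}"
      by (rule has_integral_mult_left[OF integrable_integral[OF di]])
    ultimately have "energy 0 pi R S = integral {0..pi/2} ?d * ((a\<^sup>2 + b\<^sup>2) / 2)"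
      by (rule has_integral_unique)
    then have E: "energy 0 pi R S = (a\<^sup>2 + b\<^sup>2) * (integral {0..pi/2} ?d / 2)"
      by (rule alg)
    have "2 * pi * (R 0)\<^sup>2 \<le> energy 0 pi R S"
    proof (rule energy_ge_antiperiodic[OF WR])
      show "R pi = - R 0"
        using Rq(1)[of "pi/2"] quarter(1)[of 0] quarter(3)[of 0] by (simp add: R_def)
      have i: "(\<lambda>x. R x * cos x) integrable_on {0..2 * (pi/2)}"
        by (intro integrable_continuous_real continuous_intros W12_continuous[OF WR])
      from has_integral_fold[OF integrable_integral[OF i]]
      have "((\<lambda>x. R x * cos x + R (x + pi/2) * cos (x + pi/2)) has_integral integral {0..pi} (\<lambda>x. R x * cos x)) {0..pi/2}"
        by simp
      moreover have "R x * cos x + R (x + pi/2) * cos (x + pi/2) =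
          (o1 x * cos x - o2 x * sin x) * a + (o1 x * sin x + o2 x * cos x) * b" for x
        unfolding Rq by (simp add: R_def cos_add algebra_simps)
      ultimately have "((\<lambda>x. (o1 x * cos x - o2 x * sin x) * a + (o1 x * sin x + o2 x * cos x) * b)
          has_integral integral {0..pi} (\<lambda>x. R x * cos x)) {0..pi/2}"
        by (simp only:)
      moreover have "((\<lambda>x. (o1 x * cos x - o2 x * sin x) * a + (o1 x * sin x + o2 x * cos x) * b)
          has_integral 0 * a + 0 * b) {0..pi/2}"
        by (intro has_integral_add has_integral_mult_left c1 c2)
      ultimately have "integral {0..pi} (\<lambda>x. R x * cos x) = 0 * a + 0 * b"
        by (rule has_integral_unique)
      then show "((\<lambda>x. R x * cos x) has_integral 0) {0..pi}" using i by (simp add: has_integral_iff)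
    qed
    then show ?thesis unfolding E by (simp add: R_def)
  qed
  define s where "s = (o1 0)\<^sup>2 + (o2 0)\<^sup>2"
  have "4 * pi * s \<le> integral {0..pi/2} ?d"
  proof (cases "s = 0")
    case True
    then show ?thesis using main[of 1 0] by (simp add: s_def sum_power2_eq_zero_iff)
  next
    case False
    then have "s > 0" unfolding s_def by (simp add: less_le add_nonneg_nonneg)
    have "s * (4 * pi * s) \<le> s * integral {0..pi/2} ?d"
      using main[of "o1 0" "o2 0"] unfolding s_def by (simp add: power2_eq_square algebra_simps)
    then show ?thesis using \<open>s > 0\<close> by simp
  qed
  then show ?thesis by (simp add: s_def o1_def o2_def)
qed

text \<open>Both comparison constants are \<open>2 * pi\<close>, so the bounds for the mean and for
  the two odd values add up with exactly the weights of \<open>rest_square\<close>.\<close>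

lemma rest_energy_ge_zero:
  assumes A: "admissible v g"
  shows "2 * pi * rest_square v 0 \<le> rest_energy v g"
proof -
  note W = W12_part[OF admissible_W12[OF A]]
  have "(v has_integral 0) {0..2 * pi}" using A unfolding admissible_def by auto
  from has_integral_mult_left[OF has_integral_fold4[OF this], of "1/4"]
  have "(avg_part v has_integral 0) {0..pi/2}"
    unfolding avg_part_def[abs_def] by simp
  then have z: "2 * pi * (avg_part v 0)\<^sup>2 \<le> energy 0 (pi/2) (avg_part v) (avg_part g)"
    using part_periodic(1)[of v 0] admissible_periodic[OF A] by (intro energy_ge_mean_zero W) auto
  define d where "d = (\<lambda>x. 2 * ((odd_part g x)\<^sup>2 - (odd_part v x)\<^sup>2)
     + 2 * ((odd_part g (x + pi/2))\<^sup>2 - (odd_part v (x + pi/2))\<^sup>2))"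
  have "W12 0 (pi/2) (\<lambda>x. odd_part v (x + pi/2)) (\<lambda>x. odd_part g (x + pi/2))" by (intro W12_shift W)
  then have di: "d integrable_on {0..pi/2}" unfolding d_def
    by (intro integrable_add integrable_on_mult_right has_integral_integrable[OF energy_has_integral] W)
  have "((\<lambda>x. 4 * ((avg_part g x)\<^sup>2 - (avg_part v x)\<^sup>2) + d x) has_integral
      (4 * energy 0 (pi/2) (avg_part v) (avg_part g) + integral {0..pi/2} d)) {0..pi/2}"
    by (intro has_integral_add has_integral_mult_right energy_has_integral W integrable_integral di)
  then have "rest_energy v g = 4 * energy 0 (pi/2) (avg_part v) (avg_part g) + integral {0..pi/2} d"
    unfolding rest_energy_def rest_density_def[abs_def] d_def by (simp add: integral_unique add.assoc)
  moreover note energy_odd_part[OF A, folded d_def]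
  ultimately show ?thesis using z by (simp add: rest_square_def algebra_simps)
qed

text \<open>Translation by \<open>x\<close> carries the bound at 0 to \<open>x\<close>. The energy
  does not change, since a quarter turn fixes the mean and permutes the two odd values up to sign,
  which makes \<open>rest_density\<close> periodic with period pi/2.\<close>

lemma rest_square_le:
  assumes A: "admissible v g" and x: "x \<in> {0..pi/2}"
  shows "2 * pi * rest_square v x \<le> rest_energy v g"
proof -
  have per: "rest_density v g (y + pi/2) = rest_density v g y" for y
  proof -
    have "odd_part v (y + pi/2 + pi/2) = - odd_part v y" "odd_part g (y + pi/2 + pi/2) = - odd_part g y"
    proof -
      have *: "y + pi/2 + pi/2 = y + pi" by simp
      show "odd_part v (y + pi/2 + pi/2) = - odd_part v y" "odd_part g (y + pi/2 + pi/2) = - odd_part g y"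
        unfolding * using part_periodic(3) admissible_periodic[OF A] by auto
    qed
    then show ?thesis
      unfolding rest_density_def using part_periodic(1)[of v y] part_periodic(1)[of g y] admissible_periodic[OF A] by simp
  qed
  have dens: "rest_density (\<lambda>y. v (y + x)) (\<lambda>y. g (y + x)) = (\<lambda>y. rest_density v g (y + x))"
    unfolding rest_density_def[abs_def] part_shift by (simp add: ac_simps)
  have "2 * pi * rest_square (\<lambda>y. v (y + x)) 0 \<le> rest_energy (\<lambda>y. v (y + x)) (\<lambda>y. g (y + x))"
    by (intro rest_energy_ge_zero admissible_shift[OF A]) (use x pi_gt_zero in auto)
  also have "rest_square (\<lambda>y. v (y + x)) 0 = rest_square v x"
    unfolding rest_square_def part_shift by (simp add: ac_simps)
  also have "rest_energy (\<lambda>y. v (y + x)) (\<lambda>y. g (y + x)) = integral {0..pi/2} (\<lambda>y. rest_density v g (y + x))"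
    unfolding rest_energy_def dens ..
  also have "\<dots> = integral {0 + x..pi/2 + x} (rest_density v g)"
    by (intro integral_unique has_integral_shift integrable_integral rest_density_integrable[OF A])
  also have "\<dots> = rest_energy v g"
    using integral_periodic[of "rest_density v g" "pi/2" 0 x] rest_density_integrable[OF A] per x
    by (simp add: rest_energy_def add.commute)
  finally show ?thesis .
qed

section \<open>The profile function and the signs of four values\<close>

text \<open>Each inequality integrates the preceding one from 0, starting with
  \<open>sin y \<le> y\<close>.\<close>

lemma taylor_nonneg:
  fixes x :: real assumes "0 \<le> x"
  shows "x - x^3 / 6 \<le> sin x" "cos x \<le> 1 - x\<^sup>2 / 2 + x^4 / 24"
proof -
  have mono: "f x \<ge> 0" if "0 \<le> x" "f 0 = 0" "\<And>y. (f has_real_derivative f' y) (at y)" "\<And>y. 0 \<le> y \<Longrightarrow> 0 \<le> f' y"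
    for f f' :: "real \<Rightarrow> real" and x
    using DERIV_nonneg_imp_nondecreasing[of 0 x f] that by force
  have 1: "0 \<le> cos y - 1 + y\<^sup>2 / 2" if "0 \<le> y" for y :: real
  proof (rule mono[OF that, where f' = "\<lambda>y. y - sin y"])
    show "((\<lambda>y. cos y - 1 + y\<^sup>2 / 2) has_real_derivative z - sin z) (at z)" for z :: real
      by (auto intro!: derivative_eq_intros)
  qed (auto intro: sin_x_le_x)
  have 2: "0 \<le> sin y - y + y^3 / 6" if "0 \<le> y" for y :: real
  proof (rule mono[OF that, where f' = "\<lambda>y. cos y - 1 + y\<^sup>2 / 2"])
    show "((\<lambda>y. sin y - y + y^3 / 6) has_real_derivative cos z - 1 + z\<^sup>2 / 2) (at z)" for z :: real
      by (auto intro!: derivative_eq_intros)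
  qed (simp_all only: 1, simp)
  have 3: "0 \<le> 1 - y\<^sup>2 / 2 + y^4 / 24 - cos y" if "0 \<le> y" for y :: real
  proof (rule mono[OF that, where f' = "\<lambda>y. sin y - y + y^3 / 6"])
    show "((\<lambda>y. 1 - y\<^sup>2 / 2 + y^4 / 24 - cos y) has_real_derivative sin z - z + z^3 / 6) (at z)" for z :: real
      by (auto intro!: derivative_eq_intros)
  qed (simp_all only: 2, simp)
  show "x - x^3 / 6 \<le> sin x" "cos x \<le> 1 - x\<^sup>2 / 2 + x^4 / 24" using 2[OF assms] 3[OF assms] by auto
qed

definition profile :: "real \<Rightarrow> real" where
  "profile x = cos x + sin x - 1"

lemma profile_continuous: "continuous_on S profile"
  unfolding profile_def[abs_def] by (intro continuous_intros)

lemma profile_pos: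
  assumes "x \<in> {0..pi/2}"
  shows "0 \<le> profile x" "x \<noteq> 0 \<Longrightarrow> x \<noteq> pi/2 \<Longrightarrow> 0 < profile x"
proof -
  have s: "0 \<le> sin x" and c: "0 \<le> cos x" using assms by (auto intro: sin_ge_zero cos_ge_zero)
  have e: "(cos x + sin x)\<^sup>2 = 1\<^sup>2 + 2 * (sin x * cos x)"
    using sin_cos_squared_add[of x] by (simp add: power2_eq_square algebra_simps)
  have "1\<^sup>2 \<le> (cos x + sin x)\<^sup>2" unfolding e using s c by simp
  then show "0 \<le> profile x" using s c power2_le_imp_le[of 1 "cos x + sin x"] by (simp add: profile_def)
  assume "x \<noteq> 0" "x \<noteq> pi/2"
  then have "0 < sin x" "0 < cos x" using assms by (auto intro!: sin_gt_zero cos_gt_zero)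
  then have "1\<^sup>2 < (cos x + sin x)\<^sup>2" unfolding e by simp
  then show "0 < profile x" using s c power2_less_imp_less[of 1 "cos x + sin x"] by (simp add: profile_def)
qed

text \<open>The best constant is about \<open>0.348\<close>; the strict inequality in the main estimate needs
  more than \<open>(32 - 16 sqrt 3) / (4 \<pi>) \<approx> 0.3412\<close>.\<close>

lemma profile_primitive_ge:
  assumes "0 \<le> x" "x \<le> pi/4"
  shows "0.343 * x\<^sup>2 \<le> sin x - cos x + 1 - x"
proof -
  have x: "x \<le> 0.7854" using assms pi_approx by simp
  have "x\<^sup>2 \<le> 0.7854\<^sup>2" using assms x by (intro power_mono) auto
  \<comment> \<open>The Taylor bounds leave \<open>x^2 * (1/2 - x/6 - x^2/24)\<close>, and
    \<open>0.157 = 1/2 - 0.343\<close>.\<close>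
  then have "x / 6 + x\<^sup>2 / 24 \<le> 0.157" using x by (simp add: power2_eq_square)
  then have "x\<^sup>2 * (x / 6 + x\<^sup>2 / 24) \<le> x\<^sup>2 * 0.157" by (intro mult_left_mono) auto
  moreover have "x^3 / 6 + x^4 / 24 = x\<^sup>2 * (x / 6 + x\<^sup>2 / 24)"
    by (simp add: power2_eq_square power3_eq_cube power4_eq_xxxx algebra_simps)
  ultimately show ?thesis using taylor_nonneg[OF assms(1)] by simp
qed

lemma profile_mono:
  assumes "0 \<le> x" "x \<le> y" "y \<le> pi/4" shows "profile x \<le> profile y"
proof (rule DERIV_nonneg_imp_nondecreasing[OF assms(2)])
  fix z assume z: "x \<le> z" "z \<le> y"
  have "(profile has_real_derivative cos z - sin z) (at z)"
    unfolding profile_def[abs_def] by (auto intro!: derivative_eq_intros)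
  moreover have "cos (pi/2 - z) \<le> cos z" using z assms by (intro cos_monotone_0_pi_le) auto
  ultimately show "\<exists>d. (profile has_real_derivative d) (at z) \<and> 0 \<le> d"
    by (intro exI[of _ "cos z - sin z"]) (simp add: sin_cos_eq)
qed

text \<open>\<open>profile\<close> increases on \<open>[0, pi/4]\<close>, so the truncation lives on
  an initial interval \<open>[0, x]\<close>, with \<open>x = 0\<close> for negative \<open>t\<close>
  and \<open>x = pi/4\<close> for large \<open>t\<close>. Its integral is at most
  \<open>t * x - 0.343 * x^2\<close>, whose maximum over \<open>x\<close> is
  \<open>t^2 / (4 * 0.343)\<close>.\<close>

lemma profile_truncation_quarter:
  "integral {0..pi/4} (\<lambda>x. max 0 (t - profile x)) \<le> t\<^sup>2 / 1.372"
proof -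
  define m where "m = (\<lambda>x. max 0 (t - profile x))"
  have pos: "0 \<le> profile y" if "y \<in> {0..pi/4}" for y using profile_pos(1)[of y] that by auto
  have "\<exists>x\<in>{0..pi/4}. ((\<lambda>y. t - profile y) has_integral integral {0..x} m) {0..x} \<and> (m has_integral 0) {x..pi/4}"
  proof -
    have 1: "((\<lambda>y. t - profile y) has_integral integral {0..x} m) {0..x}"
      if "\<And>y. y \<in> {0..x} \<Longrightarrow> profile y \<le> t" for x
    proof -
      have "(m has_integral integral {0..x} m) {0..x}"
        unfolding m_def by (intro integrable_integral integrable_continuous_real continuous_intros profile_continuous)
      then show ?thesis by (rule has_integral_eq[rotated]) (use that in \<open>auto simp: m_def\<close>)
    qed
    have 2: "(m has_integral 0) {x..pi/4}" if "\<And>y. y \<in> {x..pi/4} \<Longrightarrow> t \<le> profile y" for x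
      using that by (intro has_integral_is_0) (auto simp: m_def)
    consider "t < 0" | "profile (pi/4) \<le> t" | "profile 0 \<le> t" "t \<le> profile (pi/4)"
      by (fastforce simp: profile_def)
    then show ?thesis
    proof cases
      case 1
      then have "t \<le> profile y" if "y \<in> {0..pi/4}" for y using pos[OF that] by linarith
      then have "(m has_integral 0) {0..pi/4}" by (rule 2)
      moreover have "((\<lambda>y. t - profile y) has_integral integral {0..0} m) {0..0}"
        by (simp add: has_integral_refl(2))
      ultimately show ?thesis by (intro bexI[of _ 0]) auto
    next
      case 2
      then have "profile y \<le> t" if "y \<in> {0..pi/4}" for y using profile_mono[of y "pi/4"] that by auto
      then show ?thesis using 1[of "pi/4"] by (intro bexI[of _ "pi/4"]) auto
    next
      case 3
      then obtain x where x: "0 \<le> x" "x \<le> pi/4" "profile x = t"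
        using IVT'[of profile 0 t "pi/4"] profile_continuous by auto
      have "profile y \<le> t" if "y \<in> {0..x}" for y using profile_mono[of y x] that x by auto
      moreover have "t \<le> profile y" if "y \<in> {x..pi/4}" for y using profile_mono[of x y] that x by auto
      ultimately show ?thesis using 1[of x] 2[of x] x by (intro bexI[of _ x]) auto
    qed
  qed
  then obtain x where x: "0 \<le> x" "x \<le> pi/4"
    and l: "((\<lambda>y. t - profile y) has_integral integral {0..x} m) {0..x}" and r: "(m has_integral 0) {x..pi/4}"
    by auto
  have "((\<lambda>y. t - profile y) has_integral (t * x - (sin x - cos x - x)) - (t * 0 - (sin 0 - cos 0 - 0))) {0..x}"
    using x(1)
    by (intro fundamental_theorem_of_calculus[where f = "\<lambda>x. t * x - (sin x - cos x - x)"])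
       (auto intro!: derivative_eq_intros simp: profile_def simp flip: has_real_derivative_iff_has_vector_derivative)
  from has_integral_unique[OF l this] have "integral {0..x} m = t * x - (sin x - cos x + 1 - x)" by simp
  moreover have "integral {0..x} m + integral {x..pi/4} m = integral {0..pi/4} m"
    unfolding m_def
    by (intro Henstock_Kurzweil_Integration.integral_combine x integrable_continuous_real continuous_intros profile_continuous)
  ultimately have "integral {0..pi/4} m = t * x - (sin x - cos x + 1 - x)"
    using integral_unique[OF r] by simp
  also have "\<dots> \<le> t * x - 0.343 * x\<^sup>2" using profile_primitive_ge[OF x] by simp
  also have "\<dots> \<le> t\<^sup>2 / 1.372"
    using zero_le_power2[of "t - 0.686 * x"] by (simp add: power2_eq_square algebra_simps)
  finally show ?thesis unfolding m_def .
qed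

text \<open>The reflection \<open>x \<mapsto> pi/2 - x\<close> exchanges cosine and sine and fixes
  \<open>profile\<close>, so the bound on the half interval doubles.\<close>

lemma profile_truncation:
  "integral {0..pi/2} (\<lambda>x. max 0 (t - profile x)) \<le> t\<^sup>2 / 0.686"
proof -
  define m where "m = (\<lambda>x. max 0 (t - profile x))"
  have i: "m integrable_on {x..y}" for x y
    unfolding m_def by (intro integrable_continuous_real continuous_intros profile_continuous)
  have "((\<lambda>x. m (- x)) has_integral integral {pi/4..pi/2} m) {- (pi/2)..- (pi/4)}"
    using integrable_integral[OF i, of "pi/4" "pi/2"] by (subst has_integral_reflect_real)
  then have "((\<lambda>x. m (- x)) has_integral integral {pi/4..pi/2} m) {0 + - (pi/2)..pi/4 + - (pi/2)}"
    by (simp add: field_simps)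
  from has_integral_shift[OF this]
  have "((\<lambda>x. m (pi/2 - x)) has_integral integral {pi/4..pi/2} m) {0..pi/4}" by simp
  moreover have "m (pi/2 - x) = m x" for x
    unfolding m_def profile_def sin_cos_eq[of x] cos_sin_eq[of x] by (simp add: add.commute)
  ultimately have "integral {pi/4..pi/2} m = integral {0..pi/4} m" by (simp add: integral_unique)
  moreover have "integral {0..pi/4} m + integral {pi/4..pi/2} m = integral {0..pi/2} m"
    by (intro Henstock_Kurzweil_Integration.integral_combine i) auto
  ultimately show ?thesis using profile_truncation_quarter[of t] unfolding m_def by simp
qed

text \<open>Lagrange's identity: the deficit of the squares is the sum of the six squared 2 by 2
  minors.\<close>

lemma cauchy_schwarz_four:
  fixes a0 a1 a2 a3 b0 b1 b2 b3 :: real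
  shows "a0 * b0 + a1 * b1 + a2 * b2 + a3 * b3
    \<le> sqrt (a0\<^sup>2 + a1\<^sup>2 + a2\<^sup>2 + a3\<^sup>2) * sqrt (b0\<^sup>2 + b1\<^sup>2 + b2\<^sup>2 + b3\<^sup>2)"
proof -
  have "(a0 * b0 + a1 * b1 + a2 * b2 + a3 * b3)\<^sup>2 + ((a0 * b1 - a1 * b0)\<^sup>2 + (a0 * b2 - a2 * b0)\<^sup>2
      + (a0 * b3 - a3 * b0)\<^sup>2 + (a1 * b2 - a2 * b1)\<^sup>2 + (a1 * b3 - a3 * b1)\<^sup>2 + (a2 * b3 - a3 * b2)\<^sup>2)
      = (a0\<^sup>2 + a1\<^sup>2 + a2\<^sup>2 + a3\<^sup>2) * (b0\<^sup>2 + b1\<^sup>2 + b2\<^sup>2 + b3\<^sup>2)"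
    by algebra
  moreover have "0 \<le> (a0 * b1 - a1 * b0)\<^sup>2 + (a0 * b2 - a2 * b0)\<^sup>2
      + (a0 * b3 - a3 * b0)\<^sup>2 + (a1 * b2 - a2 * b1)\<^sup>2 + (a1 * b3 - a3 * b1)\<^sup>2 + (a2 * b3 - a3 * b2)\<^sup>2"
    by simp
  ultimately have "(a0 * b0 + a1 * b1 + a2 * b2 + a3 * b3)\<^sup>2
      \<le> (a0\<^sup>2 + a1\<^sup>2 + a2\<^sup>2 + a3\<^sup>2) * (b0\<^sup>2 + b1\<^sup>2 + b2\<^sup>2 + b3\<^sup>2)" by linarith
  then show ?thesis unfolding real_sqrt_mult[symmetric] by (rule real_le_rsqrt)
qed

text \<open>The signs \<open>t0, \<dots>, t3\<close> of the four values have alternating mean \<open>S \<in> {0, \<plusminus>1/2, \<plusminus>1}\<close>; the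
  part of the sign pattern orthogonal to the alternating one has square norm \<open>4 (1 - S\<^sup>2)\<close>.\<close>

lemma four_values_bound:
  fixes v0 v1 v2 v3 F l :: real
  assumes F: "F > 0" and l: "l \<ge> 0"
    and b: "b = (v0 - v1 + v2 - v3) / 4"
    and rest: "v0\<^sup>2 + v1\<^sup>2 + v2\<^sup>2 + v3\<^sup>2 - 4 * b\<^sup>2 \<le> l\<^sup>2"
  shows "- (max 0 ((4 - 2 * sqrt 3) * l - F) + 3 * max 0 (2 / sqrt 3 * l - F))
    \<le> 4 * (b\<^sup>2 / F) - 2 * (\<bar>v0\<bar> + \<bar>v1\<bar> + \<bar>v2\<bar> + \<bar>v3\<bar>) + 4 * F"
proof -
  \<comment> \<open>Zero receives the sign 1, so that all four signs have square 1 even where a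
    value vanishes.\<close>
  define sg where "sg = (\<lambda>x::real. if x < 0 then - 1 else 1 :: real)"
  have sg: "\<bar>x\<bar> = sg x * x" "sg x = 1 \<or> sg x = - 1" for x by (auto simp: sg_def)
  define t0 t1 t2 t3 where "t0 = sg v0" and "t1 = sg v1" and "t2 = sg v2" and "t3 = sg v3"
  define S where "S = (t0 - t1 + t2 - t3) / 4"
  have "S\<^sup>2 = 1 \<or> S\<^sup>2 = 1/4 \<or> S\<^sup>2 = 0"
    using sg(2)[of v0] sg(2)[of v1] sg(2)[of v2] sg(2)[of v3]
    unfolding S_def t0_def t1_def t2_def t3_def by (auto simp: power2_eq_square)
  then have sq: "(S\<^sup>2 = 1 \<and> sqrt (4 - 4 * S\<^sup>2) = 0) \<or> (S\<^sup>2 = 1/4 \<and> sqrt (4 - 4 * S\<^sup>2) = sqrt 3) \<or>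
      (S\<^sup>2 = 0 \<and> sqrt (4 - 4 * S\<^sup>2) = 2)" by auto
  have tsq: "t0\<^sup>2 = 1" "t1\<^sup>2 = 1" "t2\<^sup>2 = 1" "t3\<^sup>2 = 1"
    unfolding t0_def t1_def t2_def t3_def sg_def by auto
  \<comment> \<open>The alternating components \<open>S\<close> of the signs and \<open>b\<close> of
    the values are split off; their product contributes \<open>4 * (S * b)\<close>, and
    Cauchy-Schwarz is spent only on the orthogonal remainders.\<close>
  have "t0 * v0 + t1 * v1 + t2 * v2 + t3 * v3 - 4 * (S * b) =
      (t0 - S) * (v0 - b) + (t1 + S) * (v1 + b) + (t2 - S) * (v2 - b) + (t3 + S) * (v3 + b)"
    unfolding b S_def by (simp add: field_simps)
  also have "\<dots> \<le> sqrt ((t0 - S)\<^sup>2 + (t1 + S)\<^sup>2 + (t2 - S)\<^sup>2 + (t3 + S)\<^sup>2) *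
      sqrt ((v0 - b)\<^sup>2 + (v1 + b)\<^sup>2 + (v2 - b)\<^sup>2 + (v3 + b)\<^sup>2)"
    by (rule cauchy_schwarz_four)
  also have "(t0 - S)\<^sup>2 + (t1 + S)\<^sup>2 + (t2 - S)\<^sup>2 + (t3 + S)\<^sup>2 = t0\<^sup>2 + t1\<^sup>2 + t2\<^sup>2 + t3\<^sup>2 - 4 * S\<^sup>2"
    unfolding S_def by (simp add: power2_eq_square field_simps)
  also have "\<dots> = 4 - 4 * S\<^sup>2" unfolding tsq by simp
  also have "(v0 - b)\<^sup>2 + (v1 + b)\<^sup>2 + (v2 - b)\<^sup>2 + (v3 + b)\<^sup>2 = v0\<^sup>2 + v1\<^sup>2 + v2\<^sup>2 + v3\<^sup>2 - 4 * b\<^sup>2"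
    unfolding b by (simp add: power2_eq_square field_simps)
  also have "sqrt (4 - 4 * S\<^sup>2) * sqrt (v0\<^sup>2 + v1\<^sup>2 + v2\<^sup>2 + v3\<^sup>2 - 4 * b\<^sup>2)
      \<le> sqrt (4 - 4 * S\<^sup>2) * l"
    using sq real_sqrt_le_mono[OF rest] l by (intro mult_left_mono) auto
  finally have *: "\<bar>v0\<bar> + \<bar>v1\<bar> + \<bar>v2\<bar> + \<bar>v3\<bar> \<le> 4 * (S * b) + sqrt (4 - 4 * S\<^sup>2) * l"
    unfolding t0_def t1_def t2_def t3_def by (simp add: sg(1))
  have "0 \<le> 4 * ((b - S * F)\<^sup>2 / F)" using F by simp
  also have "\<dots> = 4 * (b\<^sup>2 / F) - 8 * (S * b) + 4 * (S\<^sup>2 * F)"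
    using F by (simp add: power2_eq_square field_simps)
  finally have pos: "0 \<le> 4 * (b\<^sup>2 / F) - 8 * (S * b) + 4 * (S\<^sup>2 * F)" .
  have combine: "4 * F - r - 2 * s \<le> p - 2 * n + 4 * F" if "0 \<le> p - 8 * q + r" "n \<le> 4 * q + s" for p q r s n :: real
    using that by linarith
  have "4 * F - 4 * (S\<^sup>2 * F) - 2 * (sqrt (4 - 4 * S\<^sup>2) * l) \<le>
      4 * (b\<^sup>2 / F) - 2 * (\<bar>v0\<bar> + \<bar>v1\<bar> + \<bar>v2\<bar> + \<bar>v3\<bar>) + 4 * F"
    by (rule combine[OF pos *])
  \<comment> \<open>For \<open>S^2 = 1\<close> the right-hand side is 0. For
    \<open>S^2 = 1/4\<close> it is \<open>3 * F - 2 * sqrt 3 * l\<close>, covered by the second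
    truncation. For \<open>S = 0\<close> it is \<open>4 * F - 4 * l\<close>, and the coefficient
    \<open>4 - 2 * sqrt 3\<close> supplies what the second truncation leaves open.\<close>
  moreover have "- (max 0 ((4 - 2 * sqrt 3) * l - F) + 3 * max 0 (2 / sqrt 3 * l - F))
      \<le> 4 * F - 4 * (S\<^sup>2 * F) - 2 * (sqrt (4 - 4 * S\<^sup>2) * l)"
  proof -
    have r: "2 / sqrt 3 * l = 2 * sqrt 3 * l / 3"
      using real_sqrt_mult_self[of 3] by (simp add: field_simps)
    define A B where "A = max 0 ((4 - 2 * sqrt 3) * l - F)" and "B = max 0 (2 / sqrt 3 * l - F)"
    have m: "0 \<le> A" "4 * l - 2 * sqrt 3 * l - F \<le> A" "0 \<le> B" "2 * sqrt 3 * l / 3 - F \<le> B"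
      unfolding A_def B_def r by (auto simp: algebra_simps)
    from sq have "- (A + 3 * B) \<le> 4 * F - 4 * (S\<^sup>2 * F) - 2 * (sqrt (4 - 4 * S\<^sup>2) * l)"
    proof (elim disjE conjE)
      assume e: "S\<^sup>2 = 1" "sqrt (4 - 4 * S\<^sup>2) = 0"
      show ?thesis unfolding e(2) unfolding e(1) using m by simp
    next
      assume e: "S\<^sup>2 = 1/4" "sqrt (4 - 4 * S\<^sup>2) = sqrt 3"
      show ?thesis unfolding e(2) unfolding e(1) using m by simp
    next
      assume e: "S\<^sup>2 = 0" "sqrt (4 - 4 * S\<^sup>2) = 2"
      show ?thesis unfolding e(2) unfolding e(1) using m by simp
    qed
    then show ?thesis unfolding A_def B_def .
  qed
  ultimately show ?thesis by linarith
qed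

section \<open>The main inequality and its equality case\<close>

definition profile_pert :: "real \<Rightarrow> real \<Rightarrow> real" where
  "profile_pert d x = profile x + d * (cos x + sin x)"

text \<open>Adding \<open>d (cos x + sin x)\<close> keeps \<open>F'' = - F - 1\<close> and makes \<open>F\<close> positive at the end points too.\<close>

lemma jacobi_profile:
  assumes W: "W12 0 (pi/2) w k" and w0: "w 0 = 0" "w (pi/2) = 0" and "d > 0"
  defines "F \<equiv> profile_pert d"
  shows "integral {0..pi/2} (\<lambda>x. (w x)\<^sup>2 / F x) \<le> energy 0 (pi/2) w k"
    "\<And>x. x \<in> {0..pi/2} \<Longrightarrow> 0 < F x" "continuous_on {0..pi/2} F"
proof -
  have Fpos: "F x > 0" if "x \<in> {0..pi/2}" for x
  proof -
    have "0 \<le> cos x" "0 \<le> sin x" using that by (auto intro: cos_ge_zero sin_ge_zero)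
    moreover have "cos x + sin x \<noteq> 0" using profile_pos(1)[OF that] by (simp add: profile_def)
    ultimately have "0 < cos x + sin x" by linarith
    then show ?thesis using profile_pos(1)[OF that] \<open>d > 0\<close> by (simp add: F_def profile_pert_def add_nonneg_pos)
  qed
  show "\<And>x. x \<in> {0..pi/2} \<Longrightarrow> 0 < F x" by (rule Fpos)
  show cF: "continuous_on {0..pi/2} F"
    unfolding F_def profile_pert_def[abs_def] by (intro continuous_intros profile_continuous)
  define G where "G = (\<lambda>x. (1 + d) * (cos x - sin x))"
  have dF: "(F has_real_derivative G x) (at x within S)" for x S
    unfolding F_def profile_pert_def[abs_def] G_def profile_def by (auto intro!: derivative_eq_intros simp: algebra_simps)
  have dG: "(G has_real_derivative - F x - 1) (at x within S)" for x S
    unfolding F_def profile_pert_def[abs_def] G_def profile_def by (auto intro!: derivative_eq_intros simp: algebra_simps)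
  have cG: "continuous_on {0..pi/2} G" unfolding G_def by (intro continuous_intros)
  \<comment> \<open>Since \<open>p\<close> is the logarithmic derivative of \<open>F\<close>, one
    has \<open>- (p' + p^2) = - F'' / F = 1 + 1 / F\<close>; the summand 1 cancels the term
    \<open>- w^2\<close> of the energy.\<close>
  define p where "p = (\<lambda>x. G x / F x)"
  define p' where "p' = (\<lambda>x. ((- F x - 1) * F x - G x * G x) / (F x * F x))"
  have "integral {0..pi/2} (\<lambda>x. - (p' x + (p x)\<^sup>2) * (w x)\<^sup>2) \<le> integral {0..pi/2} (\<lambda>x. (k x)\<^sup>2)"
  proof (rule jacobi_inequality[OF W w0])
    fix x assume "x \<in> {0..pi/2}"
    then show "(p has_real_derivative p' x) (at x within {0..pi/2})"
      unfolding p_def p'_def using Fpos[of x] by (intro DERIV_divide dF dG) auto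
  next
    show "continuous_on {0..pi/2} p'"
      unfolding p'_def using Fpos by (intro continuous_intros cF cG) fastforce
  qed simp
  also have "integral {0..pi/2} (\<lambda>x. - (p' x + (p x)\<^sup>2) * (w x)\<^sup>2)
      = integral {0..pi/2} (\<lambda>x. (w x)\<^sup>2 / F x + (w x)\<^sup>2)"
  proof (rule integral_cong)
    fix x assume "x \<in> {0..pi/2}"
    then have F: "F x \<noteq> 0" using Fpos[of x] by simp
    have "- (p' x + (p x)\<^sup>2) = 1 / F x + 1"
      using F unfolding p_def p'_def by (simp add: power2_eq_square field_simps)
    then show "- (p' x + (p x)\<^sup>2) * (w x)\<^sup>2 = (w x)\<^sup>2 / F x + (w x)\<^sup>2"
      by (simp add: algebra_simps)
  qed
  also have "\<dots> = integral {0..pi/2} (\<lambda>x. (w x)\<^sup>2 / F x) + integral {0..pi/2} (\<lambda>x. (w x)\<^sup>2)"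
    using Fpos by (intro integral_add integrable_continuous_real continuous_intros W12_continuous[OF W] cF) fastforce
  finally show "integral {0..pi/2} (\<lambda>x. (w x)\<^sup>2 / F x) \<le> energy 0 (pi/2) w k"
    unfolding energy_def
    by (subst integral_diff) (auto intro!: sqint_sq W12_sqint[OF W] sqint_continuous W12_continuous[OF W])
qed

section \<open>The defect folded onto a quarter period\<close>

definition abs_sum :: "(real \<Rightarrow> real) \<Rightarrow> real \<Rightarrow> real" where
  "abs_sum v x = \<bar>v x\<bar> + \<bar>v (x + pi/2)\<bar> + \<bar>v (x + pi)\<bar> + \<bar>v (x + 3*pi/2)\<bar>"

lemma abs_sum_integral:
  assumes A: "admissible v g"
  shows "(abs_sum v has_integral integral {0..2*pi} (\<lambda>x. \<bar>v x\<bar>)) {0..pi/2}"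
proof -
  have "(\<lambda>x. \<bar>v x\<bar>) integrable_on {0..2*pi}"
    by (intro integrable_continuous_real continuous_intros W12_continuous[OF admissible_W12[OF A]])
  from has_integral_fold4[OF integrable_integral[OF this]] show ?thesis unfolding abs_sum_def[abs_def] .
qed

lemma square_parts:
  "(v x)\<^sup>2 + (v (x + pi/2))\<^sup>2 + (v (x + pi))\<^sup>2 + (v (x + 3*pi/2))\<^sup>2 = 4 * (alt_part v x)\<^sup>2 + rest_square v x"
  unfolding rest_square_def odd_part_quarter unfolding alt_part_def avg_part_def odd_part_def
  by (simp add: power2_eq_square field_simps)

lemma energy_parts:
  assumes A: "admissible v g"
  shows "energy 0 (2*pi) v g = 4 * energy 0 (pi/2) (alt_part v) (alt_part g) + rest_energy v g"
proof -
  note W = admissible_W12[OF A]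
  have "((\<lambda>x. 4 * ((alt_part g x)\<^sup>2 - (alt_part v x)\<^sup>2) + rest_density v g x) has_integral
      (4 * energy 0 (pi/2) (alt_part v) (alt_part g) + rest_energy v g)) {0..pi/2}"
    unfolding rest_energy_def
    by (intro has_integral_add has_integral_mult_right energy_has_integral W12_part[OF W] integrable_integral
        rest_density_integrable[OF A])
  moreover have "((\<lambda>x. 4 * ((alt_part g x)\<^sup>2 - (alt_part v x)\<^sup>2) + rest_density v g x) has_integral
      energy 0 (2*pi) v g) {0..pi/2}"
  proof (rule has_integral_eq[OF _ has_integral_fold4[OF energy_has_integral[OF W]]])
    fix x
    show "(g x)\<^sup>2 - (v x)\<^sup>2 + ((g (x + pi/2))\<^sup>2 - (v (x + pi/2))\<^sup>2) + ((g (x + pi))\<^sup>2 - (v (x + pi))\<^sup>2)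
        + ((g (x + 3*pi/2))\<^sup>2 - (v (x + 3*pi/2))\<^sup>2)
        = 4 * ((alt_part g x)\<^sup>2 - (alt_part v x)\<^sup>2) + rest_density v g x"
      using square_parts[of v x] square_parts[of g x]
      unfolding rest_square_def rest_density_def by (simp add: algebra_simps)
  qed
  ultimately show ?thesis using has_integral_unique by blast
qed

lemma profile_integral: "(profile has_integral (2 - pi/2)) {0..pi/2}"
  "((\<lambda>x. cos x + sin x) has_integral 2) {0..pi/2}"
proof -
  have "(profile has_integral ((sin (pi/2) - cos (pi/2) - pi/2) - (sin 0 - cos 0 - 0))) {0..pi/2}"
    by (intro fundamental_theorem_of_calculus[where f = "\<lambda>x. sin x - cos x - x"])
       (auto intro!: derivative_eq_intros simp: profile_def simp flip: has_real_derivative_iff_has_vector_derivative)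
  then show "(profile has_integral (2 - pi/2)) {0..pi/2}" by simp
  have "((\<lambda>x. cos x + sin x) has_integral ((sin (pi/2) - cos (pi/2)) - (sin 0 - cos 0))) {0..pi/2}"
    by (intro fundamental_theorem_of_calculus[where f = "\<lambda>x. sin x - cos x"])
       (auto intro!: derivative_eq_intros simp flip: has_real_derivative_iff_has_vector_derivative)
  then show "((\<lambda>x. cos x + sin x) has_integral 2) {0..pi/2}" by simp
qed

lemma rest_energy_nonneg: assumes A: "admissible v g" shows "0 \<le> rest_energy v g"
proof -
  have "0 \<le> 2 * pi * rest_square v 0" by (simp add: rest_square_def)
  then show ?thesis using rest_energy_ge_zero[OF A] by linarith
qed

lemma alt_part_ends:
  assumes A: "admissible v g" and "alt_part v 0 = 0" shows "alt_part v (pi/2) = 0"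
  using part_periodic(2)[of v 0] admissible_periodic[OF A] assms(2) by simp

text \<open>Jacobi's bound replaces the energy of the alternating part by a pointwise quantity. The
  constant \<open>2 * (4 - pi)\<close> is four times the integral of \<open>profile\<close>, and
  \<open>8 * d\<close> is the price of the perturbation.\<close>

lemma perturbed_defect:
  assumes A: "admissible v g" and e0: "alt_part v 0 = 0" and "d > 0"
  defines "F \<equiv> profile_pert d"
  shows "integral {0..pi/2} (\<lambda>x. 4 * ((alt_part v x)\<^sup>2 / F x) - 2 * abs_sum v x + 4 * F x) + rest_energy v g
     \<le> energy 0 (2*pi) v g - 2 * integral {0..2*pi} (\<lambda>x. \<bar>v x\<bar>) + 2 * (4 - pi) + 8 * d"
    "(\<lambda>x. 4 * ((alt_part v x)\<^sup>2 / F x) - 2 * abs_sum v x + 4 * F x) integrable_on {0..pi/2}"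
proof -
  note W = W12_part(2)[OF admissible_W12[OF A], of 0 "pi/2"]
  note J = jacobi_profile[OF W e0 alt_part_ends[OF A e0] \<open>d > 0\<close>, folded F_def]
  have "\<forall>x\<in>{0..pi/2}. F x \<noteq> 0"
    using J(2) by fastforce
  then have "(\<lambda>x. (alt_part v x)\<^sup>2 / F x) integrable_on {0..pi/2}"
    by (intro integrable_continuous_real continuous_intros W12_continuous[OF W] J(3))
  then have i: "((\<lambda>x. 4 * ((alt_part v x)\<^sup>2 / F x) - 2 * abs_sum v x + 4 * F x) has_integral
      4 * integral {0..pi/2} (\<lambda>x. (alt_part v x)\<^sup>2 / F x) - 2 * integral {0..2*pi} (\<lambda>x. \<bar>v x\<bar>)
      + 4 * ((2 - pi/2) + d * 2)) {0..pi/2}"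
    unfolding F_def profile_pert_def[abs_def]
    by (intro has_integral_add has_integral_diff has_integral_mult_right abs_sum_integral[OF A] profile_integral
        integrable_integral)
  then show "(\<lambda>x. 4 * ((alt_part v x)\<^sup>2 / F x) - 2 * abs_sum v x + 4 * F x) integrable_on {0..pi/2}" by auto
  show "integral {0..pi/2} (\<lambda>x. 4 * ((alt_part v x)\<^sup>2 / F x) - 2 * abs_sum v x + 4 * F x) + rest_energy v g
     \<le> energy 0 (2*pi) v g - 2 * integral {0..2*pi} (\<lambda>x. \<bar>v x\<bar>) + 2 * (4 - pi) + 8 * d"
    unfolding integral_unique[OF i] energy_parts[OF A] using J(1) by simp
qed

text \<open>Wrong signs cost at most the fraction 0.997 of the rest energy. That a positive fraction
  survives is what later makes equality force the rest to vanish. The perturbation costs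
  \<open>8 * d = d'\<close>, which is arbitrarily small.\<close>

lemma main_inequality:
  assumes A: "admissible v g" and e0: "alt_part v 0 = 0"
  shows "0.003 * rest_energy v g \<le>
    energy 0 (2*pi) v g - 2 * integral {0..2*pi} (\<lambda>x. \<bar>v x\<bar>) + 2 * (4 - pi)" (is "_ \<le> ?M")
proof (rule field_le_epsilon)
  fix d' :: real assume "d' > 0"
  define d where "d = d' / 8"
  have "d > 0" using \<open>d' > 0\<close> by (simp add: d_def)
  note W = W12_part(2)[OF admissible_W12[OF A], of 0 "pi/2"]
  define F where "F = profile_pert d"
  note P = perturbed_defect[OF A e0 \<open>d > 0\<close>, folded F_def]
  note J = jacobi_profile[OF W e0 alt_part_ends[OF A e0] \<open>d > 0\<close>, folded F_def]
  define D where "D = rest_energy v g"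
  have "D \<ge> 0" unfolding D_def by (rule rest_energy_nonneg[OF A])
  define l where "l = sqrt (D / (2 * pi))"
  have l: "l \<ge> 0" "l\<^sup>2 = D / (2 * pi)" using \<open>D \<ge> 0\<close> by (auto simp: l_def)
  define m where "m = (\<lambda>t x. max 0 (t - profile x))"
  define t1 t2 where "t1 = (4 - 2 * sqrt 3) * l" and "t2 = 2 / sqrt 3 * l"
  have im: "m t integrable_on {0..pi/2}" for t
    unfolding m_def by (intro integrable_continuous_real continuous_intros profile_continuous)
  have mi: "integral {0..pi/2} (m t) \<le> t\<^sup>2 / 0.686" for t
    using profile_truncation[of t] by (simp add: m_def)
  have s: "sqrt 3 * sqrt 3 = 3" by simp
  have s2: "1.732 \<le> sqrt 3" by (rule real_le_rsqrt) (simp add: power2_eq_square)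
  have i: "((\<lambda>x. - (m t1 x + 3 * m t2 x)) has_integral - (integral {0..pi/2} (m t1) + 3 * integral {0..pi/2} (m t2))) {0..pi/2}"
    by (intro has_integral_neg has_integral_add has_integral_mult_right integrable_integral im)
  \<comment> \<open>The two truncation bounds are combined with the weights 1 and 3 from
    \<open>four_values_bound\<close>. With \<open>l^2 = D / (2 * pi)\<close> the claim becomes the
    numerical comparison of \<open>4.29 / 0.686\<close> with \<open>0.997 * 2 * pi\<close>.\<close>
  have "t1\<^sup>2 + 3 * t2\<^sup>2 = (32 - 16 * sqrt 3) * l\<^sup>2"
    using s by (simp add: t1_def t2_def power2_eq_square field_simps)
  also have "\<dots> \<le> 4.29 * l\<^sup>2" using s2 by (intro mult_right_mono) auto
  finally have "t1\<^sup>2 / 0.686 + 3 * (t2\<^sup>2 / 0.686) \<le> 4.29 * l\<^sup>2 / 0.686" by simp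
  also have "\<dots> \<le> 0.997 * D"
  proof -
    have "4.29 / 0.686 \<le> 0.997 * (2 * pi)" using pi_approx by simp
    then have "4.29 / 0.686 * (D / (2 * pi)) \<le> 0.997 * (2 * pi) * (D / (2 * pi))"
      using \<open>D \<ge> 0\<close> by (intro mult_right_mono) auto
    then show ?thesis unfolding l by simp
  qed
  finally have "- (0.997 * D) \<le> - (integral {0..pi/2} (m t1) + 3 * integral {0..pi/2} (m t2))"
    using mi[of t1] mi[of t2] by linarith
  also have "\<dots> = integral {0..pi/2} (\<lambda>x. - (m t1 x + 3 * m t2 x))"
    using integral_unique[OF i] by simp
  also have "\<dots> \<le> integral {0..pi/2} (\<lambda>x. 4 * ((alt_part v x)\<^sup>2 / F x) - 2 * abs_sum v x + 4 * F x)"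
  proof (rule integral_le)
    show "(\<lambda>x. - (m t1 x + 3 * m t2 x)) integrable_on {0..pi/2}" using i by auto
    fix x assume x: "x \<in> {0..pi/2}"
    have "rest_square v x \<le> l\<^sup>2"
      using rest_square_le[OF A x] unfolding l D_def by (simp add: field_simps)
    then have "(v x)\<^sup>2 + (v (x + pi/2))\<^sup>2 + (v (x + pi))\<^sup>2 + (v (x + 3*pi/2))\<^sup>2 - 4 * (alt_part v x)\<^sup>2 \<le> l\<^sup>2"
      unfolding square_parts by simp
    from four_values_bound[OF J(2)[OF x] l(1) alt_part_def this]
    have "- (max 0 (t1 - F x) + 3 * max 0 (t2 - F x)) \<le> 4 * ((alt_part v x)\<^sup>2 / F x) - 2 * abs_sum v x + 4 * F x"
      unfolding abs_sum_def t1_def t2_def .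
    \<comment> \<open>\<open>F\<close> lies above \<open>profile\<close>, so the loss is bounded
      independently of the perturbation \<open>d\<close>.\<close>
    moreover have "max 0 (t - F x) \<le> m t x" for t
    proof -
      have "0 \<le> cos x + sin x" using profile_pos(1)[OF x] by (simp add: profile_def)
      then have "profile x \<le> F x" using \<open>d > 0\<close> by (simp add: F_def profile_pert_def)
      then show ?thesis by (simp add: m_def)
    qed
    ultimately show "- (m t1 x + 3 * m t2 x) \<le> 4 * ((alt_part v x)\<^sup>2 / F x) - 2 * abs_sum v x + 4 * F x"
      by (smt (verit))
  qed (rule P(2))
  finally show "0.003 * rest_energy v g \<le> ?M + d'"
    using P(1) unfolding D_def[symmetric] d_def by simp
qed

text \<open>The margin in \<open>main_inequality\<close> forces the rest energy to vanish, so the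
  four values alternate exactly. Then \<open>\<integral> (\<bar>e\<bar> - F)^2 / F\<close> is of
  order \<open>d\<close>, and \<open>d\<close> tending to 0 yields
  \<open>\<bar>e\<bar> = profile\<close> without dividing by \<open>profile\<close>, which is zero
  at the end points.\<close>

lemma main_equality:
  assumes A: "admissible v g" and e0: "alt_part v 0 = 0"
    and eq: "energy 0 (2*pi) v g - 2 * integral {0..2*pi} (\<lambda>x. \<bar>v x\<bar>) + 2 * (4 - pi) = 0"
  obtains s :: real where "s = 1 \<or> s = - 1"
    "\<And>x. x \<in> {0..pi/2} \<Longrightarrow> v x = s * profile x \<and> v (x + pi/2) = - s * profile x \<and>
      v (x + pi) = s * profile x \<and> v (x + 3*pi/2) = - s * profile x"
proof -
  note W = W12_part(2)[OF admissible_W12[OF A], of 0 "pi/2"]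
  define e where "e = alt_part v"
  have ce: "continuous_on {0..pi/2} e" using W12_continuous[OF W] by (simp add: e_def)
  have D0: "rest_energy v g = 0"
    using main_inequality[OF A e0] rest_energy_nonneg[OF A] eq by simp
  have parts: "v x = e x \<and> v (x + pi/2) = - e x \<and> v (x + pi) = e x \<and> v (x + 3*pi/2) = - e x"
    if x: "x \<in> {0..pi/2}" for x
  proof -
    have "rest_square v x \<le> 0" using rest_square_le[OF A x] D0 pi_gt_zero by (auto simp: mult_le_0_iff)
    then have "avg_part v x = 0" "odd_part v x = 0" "odd_part v (x + pi/2) = 0"
      unfolding rest_square_def
      using zero_le_power2[of "avg_part v x"] zero_le_power2[of "odd_part v x"] zero_le_power2[of "odd_part v (x + pi/2)"]
      by (smt (verit) power2_eq_iff zero_power2 power2_less_eq_zero_iff)+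
    then show ?thesis unfolding e_def odd_part_quarter
      unfolding alt_part_def avg_part_def odd_part_def by (simp add: field_simps)
  qed
  define r where "r = (\<lambda>x. (\<bar>e x\<bar> - profile x)\<^sup>2)"
  have cr: "continuous_on {0..pi/2} r" unfolding r_def by (intro continuous_intros ce profile_continuous)
  have "integral {0..pi/2} r \<le> 0 + \<epsilon>" if "\<epsilon> > 0" for \<epsilon>
  proof -
    \<comment> \<open>The bound 1/10 keeps \<open>F \<le> 1\<close>, so dividing by \<open>F\<close>
      only enlarges the square; \<open>\<epsilon> / 24\<close> absorbs the total error
      \<open>4 * d + 8 * d * 2\<close>.\<close>
    define d where "d = min (1/10) (\<epsilon> / 24)"
    have d: "d > 0" "d \<le> 1/10" "d \<le> \<epsilon> / 24" using that by (auto simp: d_def)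
    define F where "F = profile_pert d"
    note P = perturbed_defect[OF A e0 \<open>d > 0\<close>, folded F_def e_def]
    note J = jacobi_profile[OF W e0 alt_part_ends[OF A e0] \<open>d > 0\<close>, folded F_def]
    have "((\<lambda>x. (4 * ((e x)\<^sup>2 / F x) - 2 * abs_sum v x + 4 * F x) / 2 + 8 * d) has_integral
       integral {0..pi/2} (\<lambda>x. 4 * ((e x)\<^sup>2 / F x) - 2 * abs_sum v x + 4 * F x) / 2 + 8 * d * (pi/2)) {0..pi/2}"
      using has_integral_const_real[of "8 * d" 0 "pi/2"] P(2)
      by (intro has_integral_add has_integral_divide integrable_integral) (auto simp: mult.commute)
    note I = this
    have "integral {0..pi/2} r \<le> integral {0..pi/2} (\<lambda>x. (4 * ((e x)\<^sup>2 / F x) - 2 * abs_sum v x + 4 * F x) / 2 + 8 * d)"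
    proof (rule integral_le)
      fix x assume x: "x \<in> {0..pi/2}"
      have F: "0 < F x" by (rule J(2)[OF x])
      have c: "0 \<le> cos x + sin x" using profile_pos(1)[OF x] by (simp add: profile_def)
      have "(cos x + sin x)\<^sup>2 + (cos x - sin x)\<^sup>2 = 2"
        using sin_cos_squared_add[of x] by (simp add: power2_eq_square algebra_simps)
      then have "(cos x + sin x)\<^sup>2 \<le> 2"
        using zero_le_power2[of "cos x - sin x"] by linarith
      also have "2 \<le> (3/2 :: real)\<^sup>2" by (simp add: power2_eq_square)
      finally have "(cos x + sin x)\<^sup>2 \<le> (3/2)\<^sup>2" .
      then have c2: "cos x + sin x \<le> 3/2" by (rule power2_le_imp_le) simp
      define q where "q = d * (cos x + sin x)"
      have "q \<le> (1/10) * (3/2)" unfolding q_def using c c2 d by (intro mult_mono) auto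
      then have F1: "F x \<le> 1" using c2 unfolding F_def profile_pert_def q_def[symmetric] by (simp add: profile_def)
      have "q \<le> d * (3/2)" unfolding q_def using c2 d by (intro mult_left_mono) auto
      moreover have "0 \<le> q" unfolding q_def using c d by simp
      ultimately have "q\<^sup>2 \<le> (d * (3/2))\<^sup>2" by (intro power_mono) auto
      also have "\<dots> = d * (9/4 * d)" by (simp add: power2_eq_square)
      also have "\<dots> \<le> d * 4" using d by (intro mult_left_mono) auto
      finally have q2: "q\<^sup>2 \<le> 4 * d" by simp
      have S: "abs_sum v x = 4 * \<bar>e x\<bar>" unfolding abs_sum_def using parts[OF x] by simp
      have "r x = ((\<bar>e x\<bar> - F x) + q)\<^sup>2" by (simp add: r_def F_def profile_pert_def q_def)
      also have "\<dots> \<le> 2 * (\<bar>e x\<bar> - F x)\<^sup>2 + 2 * q\<^sup>2"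
        using zero_le_power2[of "(\<bar>e x\<bar> - F x) - q"] by (simp add: power2_eq_square algebra_simps)
      also have "(\<bar>e x\<bar> - F x)\<^sup>2 \<le> (\<bar>e x\<bar> - F x)\<^sup>2 / F x"
        using F F1 by (simp add: le_divide_eq mult_left_le)
      also have "(\<bar>e x\<bar> - F x)\<^sup>2 / F x = (e x)\<^sup>2 / F x - 2 * \<bar>e x\<bar> + F x"
        using F by (simp add: power2_eq_square field_simps)
      finally show "r x \<le> (4 * ((e x)\<^sup>2 / F x) - 2 * abs_sum v x + 4 * F x) / 2 + 8 * d"
        unfolding S using q2 by (simp add: field_simps)
    qed (use I cr in \<open>auto intro: integrable_continuous_real\<close>)
    also have "\<dots> = integral {0..pi/2} (\<lambda>x. 4 * ((e x)\<^sup>2 / F x) - 2 * abs_sum v x + 4 * F x) / 2 + 8 * d * (pi/2)"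
      by (rule integral_unique[OF I])
    also have "\<dots> \<le> 4 * d + 8 * d * 2"
      using P(1) eq D0 d(1) pi_less_4 by (intro add_mono mult_left_mono) auto
    finally show ?thesis using d by simp
  qed
  then have "integral {0..pi/2} r \<le> 0" by (rule field_le_epsilon)
  moreover have "0 \<le> integral {0..pi/2} r"
    by (intro integral_nonneg integrable_continuous_real cr) (simp add: r_def)
  ultimately have "integral {0..pi/2} r = 0" by simp
  then have r0: "\<bar>e x\<bar> = profile x" if "x \<in> {0..pi/2}" for x
    using integral_eq_0_iff[OF cr, of] that by (auto simp: r_def)
  \<comment> \<open>\<open>e\<close> has no zero in the open quarter interval, so connectedness
    gives it one sign there, read off at the midpoint.\<close>
  define s where "s = (if e (pi/4) > 0 then 1 else - 1 :: real)"
  have es: "e x = s * profile x" if x: "x \<in> {0..pi/2}" for x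
  proof (cases "x = 0 \<or> x = pi/2")
    case True
    moreover have "profile 0 = 0" "profile (pi/2) = 0" by (simp_all add: profile_def)
    ultimately have "profile x = 0" by metis
    then show ?thesis using r0[OF x] by simp
  next
    case False
    have nz: "e y \<noteq> 0" if "y \<in> {0<..<pi/2}" for y
      using r0[of y] profile_pos(2)[of y] that by auto
    have same: "0 < e x \<longleftrightarrow> 0 < e (pi/4)"
    proof (rule ccontr)
      assume ne: "(0 < e x) \<noteq> (0 < e (pi/4))"
      have cc: "connected {0<..<pi/2::real}" by simp
      have "connected (e ` {0<..<pi/2})"
        by (intro connected_continuous_image cc continuous_on_subset[OF ce]) auto
      then have "is_interval (e ` {0<..<pi/2})" by (simp add: is_interval_connected_1)
      moreover have "e x \<in> e ` {0<..<pi/2}" "e (pi/4) \<in> e ` {0<..<pi/2}" using x False by auto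
      ultimately have "0 \<in> e ` {0<..<pi/2}"
        using ne unfolding is_interval_1 by (metis linorder_not_less order_less_imp_le)
      then show False using nz by auto
    qed
    then show ?thesis using r0[OF x] unfolding s_def by (auto simp: abs_if split: if_splits)
  qed
  show thesis
  proof (rule that)
    show "s = 1 \<or> s = - 1" by (simp add: s_def)
    show "\<And>x. x \<in> {0..pi/2} \<Longrightarrow> v x = s * profile x \<and> v (x + pi/2) = - s * profile x \<and>
      v (x + pi) = s * profile x \<and> v (x + 3*pi/2) = - s * profile x"
      using parts es by auto
  qed
qed

section \<open>A smooth step function\<close>

definition smooth :: "(real \<Rightarrow> real) \<Rightarrow> bool" where
  "smooth f \<longleftrightarrow> (\<forall>k x. (deriv ^^ k) f differentiable (at x))"

lemma smooth_differentiable: "smooth f \<Longrightarrow> f differentiable (at x)"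
  unfolding smooth_def by (metis funpow_0)

lemma smooth_has_deriv: "smooth f \<Longrightarrow> (f has_real_derivative deriv f x) (at x)"
  using smooth_differentiable by (simp add: DERIV_deriv_iff_real_differentiable)

lemma smooth_continuous: "smooth f \<Longrightarrow> continuous_on S f"
  by (meson DERIV_isCont continuous_at_imp_continuous_on smooth_has_deriv)

lemma smooth_deriv_iff: "smooth f \<longleftrightarrow> (\<forall>x. f differentiable (at x)) \<and> smooth (deriv f)"
proof
  show "smooth f \<Longrightarrow> (\<forall>x. f differentiable (at x)) \<and> smooth (deriv f)"
    unfolding smooth_def by (metis funpow_0 funpow_Suc_right o_apply)
  assume r: "(\<forall>x. f differentiable (at x)) \<and> smooth (deriv f)"
  show "smooth f" unfolding smooth_def
  proof (intro allI)
    show "(deriv ^^ k) f differentiable (at x)" for k x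
      using r unfolding smooth_def by (cases k) (auto simp: funpow_Suc_right simp del: funpow.simps)
  qed
qed

lemma smooth_deriv: "smooth f \<Longrightarrow> smooth (deriv f)"
  using smooth_deriv_iff by blast

lemma deriv_eqI: "(\<And>x. (f has_real_derivative f' x) (at x)) \<Longrightarrow> deriv f = f'"
  using DERIV_imp_deriv by blast

lemma smooth_antideriv:
  assumes "\<And>x. (f has_real_derivative f' x) (at x)" "smooth f'" shows "smooth f"
  using assms deriv_eqI[OF assms(1)] smooth_deriv_iff real_differentiable_def by metis

text \<open>Smoothness by invariance: membership in a class closed under differentiation passes to
  every iterated derivative, so no formula for the k-th derivative is required.\<close>

lemma smoothI_class:
  assumes "P f" "\<And>f. P f \<Longrightarrow> \<exists>f'. P f' \<and> (\<forall>x. (f has_real_derivative f' x) (at x))"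
  shows "smooth f"
  unfolding smooth_def
proof (intro allI)
  fix k x
  have "P ((deriv ^^ k) f)"
  proof (induction k)
    case (Suc k)
    then obtain f' where "P f'" "\<forall>x. ((deriv ^^ k) f has_real_derivative f' x) (at x)"
      using assms(2) by blast
    then show ?case using deriv_eqI[of "(deriv ^^ k) f" f'] by simp
  qed (simp add: assms(1))
  then show "(deriv ^^ k) f differentiable (at x)"
    using assms(2) real_differentiable_def by blast
qed

text \<open>This shape is closed under differentiation because both arguments share the factor
  \<open>c\<close>. It covers scalar multiples as well as the difference of two steps at the same
  scale, which is the test function used for weak derivatives.\<close>

lemma smooth_diff_affine:
  assumes "smooth f" "smooth g"
  shows "smooth (\<lambda>x. r * f (c * x + d) - s * g (c * x + e))"
proof (rule smoothI_class[where P = "\<lambda>h. \<exists>f g r s. smooth f \<and> smooth g \<and> h = (\<lambda>x. r * f (c * x + d) - s * g (c * x + e))"])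
  show "\<exists>f' g' r' s'. smooth f' \<and> smooth g' \<and> (\<lambda>x. r * f (c * x + d) - s * g (c * x + e))
      = (\<lambda>x. r' * f' (c * x + d) - s' * g' (c * x + e))"
    using assms by blast
next
  fix h assume "\<exists>f g r s. smooth f \<and> smooth g \<and> h = (\<lambda>x. r * f (c * x + d) - s * g (c * x + e))"
  then obtain f g r s where *: "smooth f" "smooth g" and h: "h = (\<lambda>x. r * f (c * x + d) - s * g (c * x + e))" by blast
  define h' where "h' = (\<lambda>x. (r * c) * deriv f (c * x + d) - (s * c) * deriv g (c * x + e))"
  have "(h has_real_derivative h' x) (at x)" for x
    unfolding h h'_def
    by (auto intro!: derivative_eq_intros DERIV_chain2[OF smooth_has_deriv[OF *(1)]]
        DERIV_chain2[OF smooth_has_deriv[OF *(2)]])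
  moreover have "\<exists>f g r s. smooth f \<and> smooth g \<and> h' = (\<lambda>x. r * f (c * x + d) - s * g (c * x + e))"
    unfolding h'_def using smooth_deriv * by blast
  ultimately show "\<exists>f'. (\<exists>f g r s. smooth f \<and> smooth g \<and> f' = (\<lambda>x. r * f (c * x + d) - s * g (c * x + e))) \<and>
      (\<forall>x. (h has_real_derivative f' x) (at x))" by blast
qed

text \<open>The polynomial and the exponent make the family closed under differentiation; the bump
  itself is the member with \<open>p = 1\<close> and \<open>n = 0\<close>.\<close>

definition bump_fun :: "real poly \<Rightarrow> nat \<Rightarrow> real \<Rightarrow> real" where
  "bump_fun p n x = (if 0 < x \<and> x < 1 then poly p x / (x * (1 - x)) ^ n * exp (- (1 / (x * (1 - x)))) else 0)"

text \<open>A single term of the exponential series already bounds \<open>exp (1 / y)\<close> from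
  below.\<close>

lemma exp_neg_inverse_le:
  assumes "(y::real) > 0" shows "exp (- (1 / y)) / y ^ n \<le> fact n"
proof -
  have "(\<Sum>k\<in>{n}. (1 / y) ^ k /\<^sub>R fact k) \<le> (\<Sum>k. (1 / y) ^ k /\<^sub>R fact k)"
    by (rule sum_le_suminf) (use assms sums_summable[OF exp_converges[of "1 / y"]] in auto)
  also have "\<dots> = exp (1 / y)" using exp_converges sums_unique by metis
  finally have "fact n * ((1 / y) ^ n /\<^sub>R fact n) \<le> fact n * exp (1 / y)" by (intro mult_left_mono) auto
  then have "(1 / y) ^ n \<le> fact n * exp (1 / y)" by (simp add: mult.assoc[symmetric])
  then have "(1 / y) ^ n * exp (- (1 / y)) \<le> fact n * exp (1 / y) * exp (- (1 / y))"
    by (intro mult_right_mono) auto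
  also have "\<dots> = fact n" by (simp add: exp_minus)
  finally show ?thesis by (simp add: power_one_over)
qed

text \<open>Using the exponential bound with exponent \<open>n + 2\<close> leaves a factor
  \<open>(x * (1 - x))^2\<close>. Quadratic decay at 0 and at 1 gives derivative zero at these two
  points, where the defining formula changes.\<close>

lemma bump_fun_quadratic: "\<exists>C. \<forall>x. \<bar>bump_fun p n x\<bar> \<le> C * x\<^sup>2 \<and> \<bar>bump_fun p n x\<bar> \<le> C * (x - 1)\<^sup>2"
proof -
  have "bounded (poly p ` {0..1})" by (intro compact_imp_bounded compact_continuous_image continuous_intros) auto
  then obtain B where B: "B > 0" "\<And>x. x \<in> {0..1} \<Longrightarrow> \<bar>poly p x\<bar> \<le> B"
    unfolding bounded_pos by auto
  define C where "C = B * fact (n + 2)"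
  have C: "C > 0" using B by (simp add: C_def)
  have "\<bar>bump_fun p n x\<bar> \<le> C * x\<^sup>2 \<and> \<bar>bump_fun p n x\<bar> \<le> C * (x - 1)\<^sup>2" for x
  proof (cases "0 < x \<and> x < 1")
    case True
    define y where "y = x * (1 - x)"
    have y: "0 < y" "y \<le> x" "y \<le> 1 - x" using True by (auto simp: y_def mult_left_le mult_right_le_one_le mult_left_le_one_le)
    have "\<bar>bump_fun p n x\<bar> = \<bar>poly p x\<bar> * (exp (- (1 / y)) / y ^ (n + 2) * y\<^sup>2)"
    proof -
      have "exp (- (1 / y)) / y ^ (n + 2) * y\<^sup>2 = exp (- (1 / y)) / y ^ n"
        using y by (simp add: power_add power2_eq_square)
      then show ?thesis using True y by (simp add: bump_fun_def abs_mult flip: y_def)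
    qed
    also have "\<dots> \<le> B * (fact (n + 2) * y\<^sup>2)"
      using True y B by (intro mult_mono mult_right_mono exp_neg_inverse_le) auto
    finally have *: "\<bar>bump_fun p n x\<bar> \<le> C * y\<^sup>2" by (simp add: C_def)
    have "y\<^sup>2 \<le> x\<^sup>2" "y\<^sup>2 \<le> (1 - x)\<^sup>2" using y by (auto intro: power_mono)
    then have "C * y\<^sup>2 \<le> C * x\<^sup>2" "C * y\<^sup>2 \<le> C * (x - 1)\<^sup>2"
      using C by (auto simp: power2_commute[of x 1])
    then show ?thesis using * by linarith
  next
    case False
    then show ?thesis using C by (auto simp: bump_fun_def)
  qed
  then show ?thesis by blast
qed

lemma deriv_zero_of_quadratic:
  fixes f :: "real \<Rightarrow> real"
  assumes "\<And>x. \<bar>f x\<bar> \<le> C * (x - a)\<^sup>2" shows "(f has_real_derivative 0) (at a)"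
proof -
  have fa: "f a = 0" using assms[of a] by simp
  have "((\<lambda>h. (f (a + h) - f a) / h) \<longlongrightarrow> 0) (at 0)"
  proof (rule Lim_null_comparison[where g = "\<lambda>h. C * \<bar>h\<bar>"])
    have "norm ((f (a + h) - f a) / h) \<le> C * \<bar>h\<bar>" if "h \<noteq> 0" for h
      using assms[of "a + h"] that by (simp add: fa field_simps power2_eq_square)
    then show "\<forall>\<^sub>F h in at 0. norm ((f (a + h) - f a) / h) \<le> C * \<bar>h\<bar>"
      by (auto simp: eventually_at_filter)
    show "((\<lambda>h. C * \<bar>h\<bar>) \<longlongrightarrow> 0) (at 0)" by (auto intro!: tendsto_eq_intros)
  qed
  then show ?thesis by (simp add: DERIV_def)
qed

lemma bump_fun_deriv:
  "\<exists>q. \<forall>x. (bump_fun p n has_real_derivative bump_fun q (n + 2) x) (at x)"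
proof -
  \<comment> \<open>With \<open>y = x * (1 - x)\<close> and \<open>y' = 1 - 2 * x\<close>, the
    quotient and product rules give the numerator \<open>p' * y^2 - n * p * y' * y + p * y'\<close>
    over \<open>y ^ (n + 2)\<close>.\<close>
  define q where "q = pderiv p * [:0, 1, -1:]\<^sup>2 - smult (real n) (p * [:1, -2:] * [:0, 1, -1:]) + p * [:1, -2:]"
  obtain C where C: "\<And>x. \<bar>bump_fun p n x\<bar> \<le> C * x\<^sup>2" "\<And>x. \<bar>bump_fun p n x\<bar> \<le> C * (x - 1)\<^sup>2"
    using bump_fun_quadratic by metis
  have "(bump_fun p n has_real_derivative bump_fun q (n + 2) x) (at x)" for x
  proof -
    consider "x < 0 \<or> 1 < x" | "x = 0" | "x = 1" | "0 < x" "x < 1" by linarith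
    then show ?thesis
    proof cases
      case 1
      have "((\<lambda>_. 0) has_real_derivative bump_fun q (n + 2) x) (at x)"
        using 1 by (auto simp: bump_fun_def)
      then show ?thesis
        by (rule has_field_derivative_transform_within_open[where S = "{..<0} \<union> {1<..}"])
           (use 1 in \<open>auto simp: bump_fun_def\<close>)
    next
      case 2
      then show ?thesis using deriv_zero_of_quadratic[of "bump_fun p n" C 0] C(1) by (simp add: bump_fun_def)
    next
      case 3
      then show ?thesis using deriv_zero_of_quadratic[of "bump_fun p n" C 1] C(2) by (simp add: bump_fun_def)
    next
      case 4
      define y where "y = x * (1 - x)"
      have y: "y > 0" using 4 by (simp add: y_def)
      have dy: "((\<lambda>x. x * (1 - x)) has_real_derivative 1 - 2 * x) (at x)"
        by (auto intro!: derivative_eq_intros)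
      have "((\<lambda>x. poly p x / (x * (1 - x)) ^ n) has_real_derivative
         (poly (pderiv p) x * y ^ n - poly p x * (of_nat n * y ^ (n - 1) * (1 - 2 * x))) / (y ^ n * y ^ n)) (at x)"
        using y unfolding y_def
        by (auto intro!: derivative_eq_intros poly_DERIV dy)
      moreover have "((\<lambda>x. exp (- (1 / (x * (1 - x))))) has_real_derivative
          exp (- (1 / y)) * ((1 - 2 * x) / y\<^sup>2)) (at x)"
        using y unfolding y_def
        by (auto intro!: derivative_eq_intros dy simp: power2_eq_square right_diff_distrib diff_divide_distrib)
      ultimately have "((\<lambda>x. poly p x / (x * (1 - x)) ^ n * exp (- (1 / (x * (1 - x))))) has_real_derivative
         (poly (pderiv p) x * y ^ n - poly p x * (of_nat n * y ^ (n - 1) * (1 - 2 * x))) / (y ^ n * y ^ n) * exp (- (1 / y))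
         + poly p x / y ^ n * (exp (- (1 / y)) * ((1 - 2 * x) / y\<^sup>2))) (at x)"
        unfolding y_def by (rule DERIV_mult[THEN DERIV_cong]) (simp add: mult.commute)
      moreover have "(poly (pderiv p) x * y ^ n - poly p x * (of_nat n * y ^ (n - 1) * (1 - 2 * x))) / (y ^ n * y ^ n) * exp (- (1 / y))
         + poly p x / y ^ n * (exp (- (1 / y)) * ((1 - 2 * x) / y\<^sup>2)) = bump_fun q (n + 2) x"
      proof -
        have yq: "poly [:0, 1, -1:] x = y" "poly [:1, -2:] x = 1 - 2 * x" by (simp_all add: y_def algebra_simps)
        have pq: "poly q x = poly (pderiv p) x * y\<^sup>2 - real n * (poly p x * (1 - 2 * x) * y) + poly p x * (1 - 2 * x)"
          unfolding q_def poly_add poly_diff poly_mult poly_smult poly_power yq ..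
        have b: "bump_fun q (n + 2) x = poly q x / y ^ (n + 2) * exp (- (1 / y))"
          using 4 by (simp add: bump_fun_def y_def)
        have yn: "of_nat n * y ^ (n - 1) = of_nat n * y ^ n / y" using y by (cases n) auto
        show ?thesis unfolding b pq yn using y
          by (simp add: power_add power2_eq_square field_simps)
      qed
      ultimately have "((\<lambda>x. poly p x / (x * (1 - x)) ^ n * exp (- (1 / (x * (1 - x))))) has_real_derivative
          bump_fun q (n + 2) x) (at x)" by simp
      then show ?thesis
        by (rule has_field_derivative_transform_within_open[where S = "{0<..<1}"])
           (use 4 in \<open>auto simp: bump_fun_def\<close>)
    qed
  qed
  then show ?thesis by blast
qed

lemma bump_fun_smooth: "smooth (bump_fun p n)"
  by (rule smoothI_class[where P = "\<lambda>f. \<exists>p n. f = bump_fun p n"]) (use bump_fun_deriv in blast)+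

section \<open>The normalised bump and its primitive\<close>

definition bump :: "real \<Rightarrow> real" where
  "bump x = bump_fun 1 0 x / integral {0..1} (bump_fun 1 0)"

lemma bump_mass: "0 < integral {0..1} (bump_fun 1 0)"
proof -
  have c: "continuous_on {0..1} (bump_fun 1 0)" by (intro smooth_continuous bump_fun_smooth)
  have nn: "0 \<le> bump_fun 1 0 x" for x by (simp add: bump_fun_def)
  have "bump_fun 1 0 (1/2) \<noteq> 0" by (simp add: bump_fun_def)
  then have "integral {0..1} (bump_fun 1 0) \<noteq> 0"
    using integral_eq_0_iff[OF c] nn by force
  moreover have "0 \<le> integral {0..1} (bump_fun 1 0)"
    by (intro integral_nonneg integrable_continuous_real c nn)
  ultimately show ?thesis by simp
qed

lemma bump_nonneg: "0 \<le> bump x"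
  using bump_mass by (simp add: bump_def bump_fun_def)

lemma bump_eq_0: "x \<le> 0 \<or> 1 \<le> x \<Longrightarrow> bump x = 0"
  by (auto simp: bump_def bump_fun_def)

lemma bump_smooth: "smooth bump"
proof -
  have "smooth (\<lambda>x. 1 / integral {0..1} (bump_fun 1 0) * bump_fun 1 0 (1 * x + 0) - 0 * bump_fun 1 0 (1 * x + 0))"
    by (intro smooth_diff_affine bump_fun_smooth)
  then show ?thesis by (simp add: bump_def[abs_def])
qed

text \<open>The lower limit -1 instead of 0 makes every \<open>x \<ge> 0\<close> an interior point
  for the fundamental theorem; to the left of -1 the interval is empty and the integral has the
  right value 0.\<close>

definition smooth_step :: "real \<Rightarrow> real" where
  "smooth_step x = integral {-1..x} bump"

lemma bump_integrable: "bump integrable_on {x..y}"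
  by (intro integrable_continuous_real smooth_continuous bump_smooth)

lemma smooth_step_le_0: "x \<le> 0 \<Longrightarrow> smooth_step x = 0"
proof -
  assume "x \<le> 0"
  then have "integral {-1..x} bump = integral {-1..x} (\<lambda>_. 0)"
    by (intro integral_cong) (auto simp: bump_eq_0)
  then show ?thesis by (simp add: smooth_step_def)
qed

lemma smooth_step_1: "smooth_step 1 = 1"
proof -
  have "integral {-1..0} bump + integral {0..1} bump = integral {-1..1} bump"
    by (intro Henstock_Kurzweil_Integration.integral_combine bump_integrable) auto
  moreover have "integral {0..1} bump = 1"
    using bump_mass by (simp add: bump_def[abs_def])
  ultimately show ?thesis using smooth_step_le_0[of 0] by (simp add: smooth_step_def)
qed

lemma smooth_step_ge_1: assumes "1 \<le> x" shows "smooth_step x = 1"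
proof -
  have "integral {-1..1} bump + integral {1..x} bump = integral {-1..x} bump"
    by (intro Henstock_Kurzweil_Integration.integral_combine bump_integrable) (use assms in auto)
  moreover have "integral {1..x} bump = integral {1..x} (\<lambda>_. 0)"
    by (intro integral_cong) (auto simp: bump_eq_0)
  ultimately show ?thesis using smooth_step_1 by (simp add: smooth_step_def)
qed

lemma smooth_step_deriv: "(smooth_step has_real_derivative bump x) (at x)"
proof (cases "x < 0")
  case True
  have "((\<lambda>_. 0) has_real_derivative bump x) (at x)" using True by (simp add: bump_eq_0)
  then show ?thesis
    by (rule has_field_derivative_transform_within_open[where S = "{..<0}"])
       (use True in \<open>auto simp: smooth_step_le_0\<close>)
next
  case False
  have "((\<lambda>u. integral {-1..u} bump) has_real_derivative bump x) (at x within {-1..x + 1})"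
    by (rule integral_has_real_derivative) (use False in \<open>auto intro: smooth_continuous bump_smooth\<close>)
  moreover have "at x within {-1..x + 1} = at x"
    by (rule at_within_interior) (use False in auto)
  ultimately show ?thesis unfolding smooth_step_def[abs_def] by simp
qed

lemma smooth_step_smooth: "smooth smooth_step"
  by (rule smooth_antideriv[OF smooth_step_deriv bump_smooth])

lemma smooth_step_bounds: "0 \<le> smooth_step x" "smooth_step x \<le> 1"
proof -
  have mono: "smooth_step a \<le> smooth_step b" if "a \<le> b" for a b
    by (rule DERIV_nonneg_imp_nondecreasing[OF that]) (use smooth_step_deriv bump_nonneg in blast)
  show "0 \<le> smooth_step x"
    using mono[of 0 x] smooth_step_le_0[of 0] smooth_step_le_0[of x] by (cases "x \<le> 0") auto
  show "smooth_step x \<le> 1"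
    using mono[of x 1] smooth_step_1 smooth_step_ge_1[of x] by (cases "x \<le> 1") auto
qed

section \<open>Weak derivatives of continuous functions\<close>

lemma inverse_nat_small:
  fixes e :: real assumes "e > 0"
  obtains N :: nat where "N > 0" "\<And>n. N \<le> n \<Longrightarrow> 1 / real n < e"
proof -
  obtain m where m: "inverse (real (Suc m)) < e" using reals_Archimedean[OF assms] by blast
  have "1 / real n < e" if "Suc m \<le> n" for n
    using frac_le[of 1 1 "real (Suc m)" "real n"] that m by (auto simp: inverse_eq_divide)
  then show thesis using that[of "Suc m"] by blast
qed

text \<open>The kernel lives on \<open>(a, a + 1/n)\<close>, to the right of \<open>a\<close>, so it
  stays below pi for large \<open>n\<close>. Its primitive is a rescaled \<open>smooth_step\<close>,
  which gives mass exactly 1.\<close>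

lemma approximate_identity:
  assumes v: "continuous_on UNIV v" and a: "- pi < a" "a < pi"
  shows "(\<lambda>n. integral {-pi..pi} (\<lambda>x. v x * (real n * bump (real n * (x - a))))) \<longlonglongrightarrow> v a"
proof (rule LIMSEQ_I)
  fix r :: real assume "r > 0"
  define e where "e = r / 2"
  have "e > 0" "e < r" using \<open>r > 0\<close> by (auto simp: e_def)
  have "isCont v a" using v by (simp add: continuous_on_eq_continuous_at)
  then obtain d where d: "d > 0" "\<And>x. \<bar>x - a\<bar> < d \<Longrightarrow> \<bar>v x - v a\<bar> < e"
    using \<open>e > 0\<close> unfolding continuous_at_eps_delta dist_real_def by metis
  obtain N :: nat where N: "N > 0" "\<And>n. N \<le> n \<Longrightarrow> 1 / real n < min d (pi - a)"
    using inverse_nat_small[of "min d (pi - a)"] d(1) a by auto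
  show "\<exists>no. \<forall>n\<ge>no. norm (integral {-pi..pi} (\<lambda>x. v x * (real n * bump (real n * (x - a)))) - v a) < r"
  proof (intro exI[of _ N] allI impI)
    fix n assume "n \<ge> N"
    then have n: "real n > 0" "1 / real n < d" "1 / real n < pi - a"
      using N(1) N(2)[of n] by auto
    define k where "k = (\<lambda>x. real n * bump (real n * (x - a)))"
    have ck: "continuous_on S k" for S
      unfolding k_def by (intro continuous_intros continuous_on_compose2[OF smooth_continuous[OF bump_smooth, of UNIV]]) auto
    have cv: "continuous_on S v" for S using v continuous_on_subset by blast
    have "((\<lambda>x. smooth_step (real n * (x - a))) has_real_derivative k x) (at x within S)" for x S
      unfolding k_def
      by (rule has_field_derivative_at_within, rule DERIV_chain2[OF smooth_step_deriv, THEN DERIV_cong])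
         (auto intro!: derivative_eq_intros)
    then have "(k has_integral (smooth_step (real n * (pi - a)) - smooth_step (real n * (- pi - a)))) {-pi..pi}"
      by (intro fundamental_theorem_of_calculus) (auto simp flip: has_real_derivative_iff_has_vector_derivative)
    moreover have "smooth_step (real n * (pi - a)) = 1"
      using n by (intro smooth_step_ge_1) (simp add: field_simps)
    moreover have "smooth_step (real n * (- pi - a)) = 0"
      using n a by (intro smooth_step_le_0) (simp add: mult_le_0_iff)
    ultimately have k1: "(k has_integral 1) {-pi..pi}" by simp
    have vk: "((\<lambda>x. v x * k x) has_integral integral {-pi..pi} (\<lambda>x. v x * k x)) {-pi..pi}"
      by (intro integrable_integral integrable_continuous_real continuous_intros ck cv)
    have I: "((\<lambda>x. v x * k x - v a * k x) has_integral (integral {-pi..pi} (\<lambda>x. v x * k x) - v a * 1)) {-pi..pi}"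
      by (intro has_integral_diff has_integral_mult_right vk k1)
    have "norm (integral {-pi..pi} (\<lambda>x. v x * k x - v a * k x)) \<le> integral {-pi..pi} (\<lambda>x. e * k x)"
    proof (rule integral_norm_bound_integral)
      fix x
      have k0: "0 \<le> k x" unfolding k_def using bump_nonneg by simp
      show "norm (v x * k x - v a * k x) \<le> e * k x"
      proof (cases "k x = 0")
        case False
        then have "bump (real n * (x - a)) \<noteq> 0" by (auto simp: k_def)
        then have "0 < real n * (x - a)" "real n * (x - a) < 1"
          using bump_eq_0 by (meson not_le)+
        then have "0 < x - a" "x - a < 1 / real n" using n by (auto simp: zero_less_mult_iff field_simps)
        then have "\<bar>v x - v a\<bar> \<le> e" using d(2)[of x] n by auto
        then have "\<bar>v x - v a\<bar> * k x \<le> e * k x" using k0 by (intro mult_right_mono)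
        then show ?thesis using k0 by (simp add: abs_mult flip: left_diff_distrib)
      qed simp
    qed (use I k1 in \<open>auto intro!: integrable_on_mult_right\<close>)
    also have "\<dots> = e" using k1 by (simp add: integral_unique)
    finally have "\<bar>integral {-pi..pi} (\<lambda>x. v x * k x) - v a\<bar> \<le> e"
      unfolding integral_unique[OF I] by simp
    then show "norm (integral {-pi..pi} (\<lambda>x. v x * (real n * bump (real n * (x - a)))) - v a) < r"
      using \<open>e < r\<close> unfolding k_def by simp
  qed
qed

section \<open>Lebesgue integrals on the open interval and gauge integrals\<close>

lemma lebesgue_on_open_interval:
  fixes f :: "real \<Rightarrow> real"
  assumes "integrable (lebesgue_on {a<..<b}) f"
  shows "(f has_integral (LINT x|lebesgue_on {a<..<b}. f x)) {a..b}"
proof -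
  have "f integrable_on {a<..<b}" "(LINT x|lebesgue_on {a<..<b}. f x) = integral {a<..<b} f"
    using integrable_on_lebesgue_on[OF assms] lebesgue_integral_eq_integral[OF assms] by auto
  then show ?thesis
    by (metis has_integral_Icc_iff_Ioo integrable_integral)
qed

lemma lebesgue_on_open_continuous:
  fixes f :: "real \<Rightarrow> real"
  assumes "continuous_on UNIV f"
  shows "integrable (lebesgue_on {a<..<b}) f" "(LINT x|lebesgue_on {a<..<b}. f x) = integral {a..b} f"
proof -
  have "f absolutely_integrable_on {a..b}"
    using assms continuous_on_subset by (intro absolutely_integrable_continuous_real) blast
  then have "f absolutely_integrable_on {a<..<b}"
    by (simp add: absolutely_integrable_on_Icc_iff_Ioo)
  then show "integrable (lebesgue_on {a<..<b}) f"
    by (simp add: integrable_restrict_space set_integrable_def)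
  from integral_unique[OF lebesgue_on_open_interval[OF this]]
  show "(LINT x|lebesgue_on {a<..<b}. f x) = integral {a..b} f" by simp
qed

lemma L2_integrable:
  assumes "g \<in> L2 {a<..<b}" shows "integrable (lebesgue_on {a<..<b}) g"
proof -
  have m: "g \<in> borel_measurable (lebesgue_on {a<..<b})" and s: "integrable (lebesgue_on {a<..<b}) (\<lambda>x. (g x)\<^sup>2)"
    using assms unfolding L2_def by auto
  have "integrable (lebesgue_on {a<..<b}) (\<lambda>_. 1::real)"
    by (intro lebesgue_on_open_continuous) auto
  then have "integrable (lebesgue_on {a<..<b}) (\<lambda>x. 1 + (g x)\<^sup>2)" using s by simp
  then show ?thesis
  proof (rule Bochner_Integration.integrable_bound[OF _ m])
    have "\<bar>g x\<bar> \<le> 1 + (g x)\<^sup>2" for x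
    proof -
      have "2 * \<bar>g x\<bar> \<le> 1 + (g x)\<^sup>2" using zero_le_power2[of "\<bar>g x\<bar> - 1"] by (simp add: power2_diff)
      then show ?thesis by linarith
    qed
    then show "AE x in lebesgue_on {a<..<b}. norm (g x) \<le> norm (1 + (g x)\<^sup>2)" by simp
  qed
qed

text \<open>Test with a smooth plateau \<open>\<phi> n\<close> that rises just after
  \<open>a\<close> and falls just after \<open>b\<close>. Its derivative acts in the limit as
  evaluation at \<open>a\<close> minus evaluation at \<open>b\<close>, while the plateau, bounded by
  1, converges to the indicator of \<open>{a<..b}\<close>, so dominated convergence handles the side
  with \<open>g\<close>.\<close>

lemma weak_deriv_increment:
  assumes v: "continuous_on UNIV v" and g: "g \<in> L2 period_interval" and wd: "has_weak_deriv period_interval v g"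
    and ab: "- pi < a" "a \<le> b" "b < pi"
  shows "v b - v a = integral {a..b} g"
proof -
  define \<phi> where "\<phi> n x = smooth_step (real n * (x - a)) - smooth_step (real n * (x - b))" for n x
  define \<phi>' where "\<phi>' n x = real n * bump (real n * (x - a)) - real n * bump (real n * (x - b))" for n x
  have gi: "integrable (lebesgue_on period_interval) g" by (rule L2_integrable[OF g])
  have d\<phi>: "(\<phi> n has_real_derivative \<phi>' n x) (at x)" for n x
  proof -
    have "((\<lambda>x. smooth_step (real n * (x - c))) has_real_derivative real n * bump (real n * (x - c))) (at x)" for c
      by (rule DERIV_chain2[OF smooth_step_deriv, THEN DERIV_cong]) (auto intro!: derivative_eq_intros)
    then show ?thesis unfolding \<phi>_def \<phi>'_def by (intro DERIV_diff)
  qed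
  have smooth: "smooth (\<phi> n)" for n
    using smooth_diff_affine[OF smooth_step_smooth smooth_step_smooth, of 1 "real n" "- (real n * a)" 1 "- (real n * b)"]
    by (simp add: \<phi>_def[abs_def] right_diff_distrib)
  have zero: "\<phi> n x = 0" if "n > 0" "x \<le> a \<or> b + 1 / real n \<le> x" for n x
  proof -
    have "real n > 0" using that by simp
    from that(2) show ?thesis
    proof
      assume "x \<le> a"
      then have "real n * (x - a) \<le> 0" "real n * (x - b) \<le> 0" using ab by (auto simp: mult_le_0_iff)
      then show ?thesis by (simp add: \<phi>_def smooth_step_le_0)
    next
      assume x: "b + 1 / real n \<le> x"
      then have "1 \<le> real n * (x - b)" using \<open>real n > 0\<close> by (simp add: field_simps)
      moreover have "real n * (x - b) \<le> real n * (x - a)" using ab by (intro mult_left_mono) auto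
      ultimately show ?thesis by (simp add: \<phi>_def smooth_step_ge_1)
    qed
  qed
  \<comment> \<open>The plateau extends beyond \<open>b\<close> up to \<open>b + 1/n\<close>, so
    \<open>n\<close> must be large enough for the support to remain left of pi.\<close>
  obtain N :: nat where N: "N > 0" "\<And>n. N \<le> n \<Longrightarrow> 1 / real n < pi - b"
    using inverse_nat_small[of "pi - b"] ab by auto
  have test: "test_function period_interval (\<phi> n)" if "n \<ge> N" for n
  proof -
    have n: "n > 0" "1 / real n < pi - b"
      using that N(1) N(2)[of n] by auto
    have "{x. \<phi> n x \<noteq> 0} \<subseteq> {a..b + 1 / real n}"
    proof
      fix x assume "x \<in> {x. \<phi> n x \<noteq> 0}"
      then have "\<not> (x \<le> a \<or> b + 1 / real n \<le> x)" using zero[OF n(1), of x] by blast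
      then show "x \<in> {a..b + 1 / real n}" by auto
    qed
    then have cl: "closure {x. \<phi> n x \<noteq> 0} \<subseteq> {a..b + 1 / real n}" by (intro closure_minimal) auto
    then have "bounded (closure {x. \<phi> n x \<noteq> 0})" using bounded_closed_interval bounded_subset by blast
    then show ?thesis using smooth cl n(2) ab unfolding test_function_def smooth_def
      by (auto simp: compact_eq_bounded_closed)
  qed
  have eq: "integral {-pi..pi} (\<lambda>x. v x * \<phi>' n x) = - (LINT x|lebesgue_on period_interval. g x * \<phi> n x)" if "n \<ge> N" for n
  proof -
    have "continuous_on UNIV (\<phi>' n)"
      using smooth_continuous[OF smooth_deriv[OF smooth]] deriv_eqI[OF d\<phi>] by metis
    then have "(LINT x|lebesgue_on period_interval. v x * \<phi>' n x) = integral {-pi..pi} (\<lambda>x. v x * \<phi>' n x)"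
      by (intro lebesgue_on_open_continuous continuous_intros v)
    then show ?thesis using wd test[OF that] deriv_eqI[OF d\<phi>, of n] unfolding has_weak_deriv_def by auto
  qed
  have lim1: "(\<lambda>n. integral {-pi..pi} (\<lambda>x. v x * \<phi>' n x)) \<longlonglongrightarrow> v a - v b"
  proof -
    have cb: "continuous_on UNIV (\<lambda>x. real n * bump (real n * (x - c)))" for n c
      by (intro continuous_intros continuous_on_compose2[OF smooth_continuous[OF bump_smooth, of UNIV]]) auto
    have i: "(\<lambda>x. v x * (real n * bump (real n * (x - c)))) integrable_on {-pi..pi}" for n c
      by (intro integrable_continuous_real continuous_on_subset[OF continuous_on_mult[OF v cb]]) auto
    have "integral {-pi..pi} (\<lambda>x. v x * \<phi>' n x) =
        integral {-pi..pi} (\<lambda>x. v x * (real n * bump (real n * (x - a)))) -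
        integral {-pi..pi} (\<lambda>x. v x * (real n * bump (real n * (x - b))))" for n
      unfolding integral_diff[OF i i, symmetric] \<phi>'_def by (simp add: algebra_simps)
    then show ?thesis using ab by (simp only:) (intro tendsto_diff approximate_identity v; simp)
  qed
  have lim2: "(\<lambda>n. LINT x|lebesgue_on period_interval. g x * \<phi> n x) \<longlonglongrightarrow>
      (LINT x|lebesgue_on period_interval. g x * indicator {a<..b} x)"
  proof (rule integral_dominated_convergence[where w = "\<lambda>x. \<bar>g x\<bar>"])
    have gm: "g \<in> borel_measurable (lebesgue_on period_interval)" using gi by auto
    have "(indicator {a<..b} :: real \<Rightarrow> real) \<in> borel_measurable (lebesgue_on period_interval)"
      by (intro measurable_restrict_space1 borel_measurable_indicator) auto
    with gm show "(\<lambda>x. g x * indicator {a<..b} x) \<in> borel_measurable (lebesgue_on period_interval)" by simp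
    have "\<phi> n \<in> borel_measurable (lebesgue_on period_interval)" for n
      by (intro continuous_imp_measurable_on_sets_lebesgue smooth_continuous smooth) auto
    with gm show "(\<lambda>x. g x * \<phi> n x) \<in> borel_measurable (lebesgue_on period_interval)" for n by simp
    show "integrable (lebesgue_on period_interval) (\<lambda>x. \<bar>g x\<bar>)" using gi by simp
    have "(\<lambda>n. \<phi> n x) \<longlonglongrightarrow> indicator {a<..b} x" for x
    proof (rule tendsto_eventually)
      consider "x \<le> a" | "a < x" "x \<le> b" | "b < x" by linarith
      then show "\<forall>\<^sub>F n in sequentially. \<phi> n x = indicator {a<..b} x"
      proof cases
        case 1
        then show ?thesis using zero by (auto simp: eventually_sequentially intro!: exI[of _ 1])
      next
        case 2
        obtain M :: nat where M: "M > 0" "\<And>n. M \<le> n \<Longrightarrow> 1 / real n < x - a"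
          using inverse_nat_small[of "x - a"] 2 by auto
        have "\<phi> n x = 1" if "n \<ge> M" for n
        proof -
          have "1 / real n < x - a" "real n > 0" using that M(1) M(2)[of n] by auto
          then have "1 \<le> real n * (x - a)" by (simp add: field_simps)
          moreover have "real n * (x - b) \<le> 0" using 2 by (simp add: mult_le_0_iff)
          ultimately show ?thesis by (simp add: \<phi>_def smooth_step_ge_1 smooth_step_le_0)
        qed
        then show ?thesis using 2 by (auto simp: eventually_sequentially intro!: exI[of _ M])
      next
        case 3
        obtain M :: nat where M: "M > 0" "\<And>n. M \<le> n \<Longrightarrow> 1 / real n < x - b"
          using inverse_nat_small[of "x - b"] 3 by auto
        have "\<phi> n x = 0" if "n \<ge> M" for n
        proof -
          have "1 / real n < x - b" "n > 0" using that M(1) M(2)[of n] by auto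
          then show ?thesis by (intro zero) auto
        qed
        then show ?thesis using 3 by (auto simp: eventually_sequentially intro!: exI[of _ M])
      qed
    qed
    then show "AE x in lebesgue_on period_interval. (\<lambda>n. g x * \<phi> n x) \<longlonglongrightarrow> g x * indicator {a<..b} x"
      by (intro AE_I2 tendsto_mult_left)
    have "\<bar>\<phi> n x\<bar> \<le> 1" for n x
      using smooth_step_bounds[of "real n * (x - a)"] smooth_step_bounds[of "real n * (x - b)"]
      unfolding \<phi>_def by linarith
    then show "AE x in lebesgue_on period_interval. norm (g x * \<phi> n x) \<le> \<bar>g x\<bar>" for n
      by (auto simp: abs_mult intro!: mult_left_le)
  qed
  have gI: "integrable (lebesgue_on period_interval) (\<lambda>x. g x * indicator {a<..b} x)"
    by (intro integrable_real_mult_indicator gi) (use ab in \<open>auto simp: sets_restrict_space_iff\<close>)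
  have "(\<lambda>n. integral {-pi..pi} (\<lambda>x. v x * \<phi>' n x)) \<longlonglongrightarrow>
      - (LINT x|lebesgue_on period_interval. g x * indicator {a<..b} x)"
  proof (rule Lim_transform_eventually[OF tendsto_minus[OF lim2]])
    show "\<forall>\<^sub>F n in sequentially. - (LINT x|lebesgue_on period_interval. g x * \<phi> n x) =
        integral {-pi..pi} (\<lambda>x. v x * \<phi>' n x)"
      using eq by (auto simp: eventually_sequentially intro!: exI[of _ N])
  qed
  from LIMSEQ_unique[OF lim1 this]
  have "v b - v a = (LINT x|lebesgue_on period_interval. g x * indicator {a<..b} x)" by simp
  also have "\<dots> = integral {-pi..pi} (\<lambda>x. g x * indicator {a<..b} x)"
    using lebesgue_on_open_interval[OF gI] by (simp add: integral_unique)
  also have "(\<lambda>x. g x * indicator {a<..b} x) = (\<lambda>x. if x \<in> {a<..b} then g x else 0)"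
    by (auto simp: indicator_def)
  also have "integral {-pi..pi} \<dots> = integral {a<..b} g"
  proof -
    have "{a<..b} \<inter> {-pi..pi} = {a<..b}" using ab by auto
    then show ?thesis by (simp only: Henstock_Kurzweil_Integration.integral_restrict_Int)
  qed
  also have "\<dots> = integral {a..b} g"
    by (rule integral_spike_set) (auto intro: negligible_subset[of "{a}"])
  finally show ?thesis .
qed

section \<open>Uniqueness and periodic extension of weak derivatives\<close>

text \<open>Derivatives need agree only in the open interval, as its end points form a null set.
  This permits gluing pieces whose derivatives disagree at the junctions.\<close>

lemma W12_spike:
  assumes W: "W12 a b v g" and eq: "\<And>x. a < x \<Longrightarrow> x < b \<Longrightarrow> g' x = g x" and v: "\<And>x. a \<le> x \<Longrightarrow> x \<le> b \<Longrightarrow> v' x = v x"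
  shows "W12 a b v' g'"
  unfolding W12_def
proof (intro conjI allI impI)
  have s: "(\<lambda>x. f (g' x)) integrable_on {a..b}" if "(\<lambda>x. f (g x)) integrable_on {a..b}" for f :: "real \<Rightarrow> real"
    using integrable_spike_interior[of a b "\<lambda>x. f (g' x)" "\<lambda>x. f (g x)"] that eq by (simp add: box_real)
  show "sqint a b g'"
    using s[of "\<lambda>x. x"] s[of "\<lambda>x. x\<^sup>2"] integrable_imp_measurable sqint_integrable[OF W12_sqint[OF W]] sqint_sq[OF W12_sqint[OF W]]
    unfolding sqint_def by auto
  fix x y assume xy: "a \<le> x" "x \<le> y" "y \<le> b"
  have "(g' has_integral (v y - v x)) (cbox x y)"
    by (rule has_integral_spike_interior[of g]) (use W12_has_integral[OF W xy] eq xy in \<open>auto simp: box_real\<close>)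
  then show "(g' has_integral (v' y - v' x)) {x..y}" using v xy by (simp add: box_real)
qed

lemma W12_join:
  assumes W1: "W12 a b v g" and W2: "W12 b c v g" and abc: "a \<le> b" "b \<le> c"
  shows "W12 a c v g"
  unfolding W12_def
proof (intro conjI allI impI)
  have c: "f integrable_on {a..c}" if "f integrable_on {a..b}" "f integrable_on {b..c}" for f :: "real \<Rightarrow> real"
    using Henstock_Kurzweil_Integration.integrable_combine[OF abc that] .
  show "sqint a c g"
    using c[OF sqint_integrable[OF W12_sqint[OF W1]] sqint_integrable[OF W12_sqint[OF W2]]]
      c[OF sqint_sq[OF W12_sqint[OF W1]] sqint_sq[OF W12_sqint[OF W2]]] integrable_imp_measurable
    unfolding sqint_def by auto
  fix x y assume xy: "a \<le> x" "x \<le> y" "y \<le> c"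
  consider "y \<le> b" | "b \<le> x" | "x \<le> b" "b \<le> y" by linarith
  then show "(g has_integral (v y - v x)) {x..y}"
  proof cases
    case 1 then show ?thesis using W12_has_integral[OF W1] xy by auto
  next
    case 2 then show ?thesis using W12_has_integral[OF W2] xy by auto
  next
    case 3
    have "(g has_integral ((v b - v x) + (v y - v b))) {x..y}"
      by (rule has_integral_combine[of x b y]) (use 3 xy W12_has_integral[OF W1] W12_has_integral[OF W2] in auto)
    then show ?thesis by simp
  qed
qed

lemma W12_tiling:
  assumes "T > 0" and W: "\<And>k::int. W12 (c + of_int k * T) (c + of_int (k + 1) * T) v g"
  shows "W12 a b v g"
proof -
  have W': "W12 (c - real n * T) (c + real n * T) v g" for n
  proof (induction n)
    case 0
    have "W12 (c + of_int 0 * T) (c + of_int 1 * T) v g" using W[of 0] by simp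
    then show ?case using \<open>T > 0\<close> by (auto intro: W12_subinterval)
  next
    case (Suc n)
    have 1: "W12 (c - real (Suc n) * T) (c - real n * T) v g"
      using W[of "- int (Suc n)"] by (simp add: algebra_simps)
    have 2: "W12 (c + real n * T) (c + real (Suc n) * T) v g"
      using W[of "int n"] by (simp add: algebra_simps)
    have "0 \<le> real n * T" using \<open>T > 0\<close> by simp
    then show ?case
      by (intro W12_join[OF W12_join[OF 1 Suc.IH] 2]) (use \<open>T > 0\<close> in \<open>auto simp: algebra_simps\<close>)
  qed
  obtain n :: nat where n: "max (c - a) (b - c) / T < real n" using reals_Archimedean2 by blast
  then have "max (c - a) (b - c) < real n * T" using \<open>T > 0\<close> by (simp add: divide_less_eq)
  then show ?thesis by (intro W12_subinterval[OF W'[of n]]) auto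
qed

text \<open>The Riemann sums of \<open>|k|\<close> are the error sums of Henstock's lemma for \<open>k\<close>.\<close>

lemma null_antideriv_abs:
  assumes W: "W12 a b (\<lambda>_. 0) k"
  shows "integral {a..b} (\<lambda>x. \<bar>k x\<bar>) = 0"
proof -
  have ai: "k absolutely_integrable_on {a..b}" by (rule sqint_abs_integrable[OF W12_sqint[OF W]])
  then have ik: "k integrable_on cbox a b" and ia: "(\<lambda>x. \<bar>k x\<bar>) integrable_on cbox a b"
    unfolding absolutely_integrable_on_def by (auto simp: box_real)
  have "integral {a..b} (\<lambda>x. \<bar>k x\<bar>) \<le> 0 + e" if "e > 0" for e
  proof -
    have half: "0 < e / 2" using that by simp
    obtain \<gamma> where \<gamma>: "gauge \<gamma>" "\<And>p. \<lbrakk>p tagged_partial_division_of (cbox a b); \<gamma> fine p\<rbrakk> \<Longrightarrow>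
             sum (\<lambda>(x,K). norm (measure lborel K *\<^sub>R k x - integral K k)) p < e / 2"
    proof (rule Henstock_lemma[OF ik half])
      fix \<gamma> assume 1: "gauge \<gamma>" and 2: "\<And>p. \<lbrakk>p tagged_partial_division_of (cbox a b); \<gamma> fine p\<rbrakk> \<Longrightarrow>
             sum (\<lambda>(x,K). norm (measure lborel K *\<^sub>R k x - integral K k)) p < e / 2"
      show thesis by (rule that[OF 1]) (rule 2)
    qed
    have "\<exists>\<delta>. gauge \<delta> \<and> (\<forall>p. p tagged_division_of (cbox a b) \<and> \<delta> fine p \<longrightarrow>
         norm ((\<Sum>(x,K)\<in>p. measure lborel K *\<^sub>R \<bar>k x\<bar>) - integral (cbox a b) (\<lambda>x. \<bar>k x\<bar>)) < e / 2)"
      by (rule integrable_integral[OF ia, unfolded has_integral, THEN spec, THEN mp, OF half])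
    then obtain \<delta> where \<delta>: "gauge \<delta>" "\<forall>p. p tagged_division_of (cbox a b) \<and> \<delta> fine p \<longrightarrow>
         norm ((\<Sum>(x,K)\<in>p. measure lborel K *\<^sub>R \<bar>k x\<bar>) - integral (cbox a b) (\<lambda>x. \<bar>k x\<bar>)) < e / 2"
      by (elim exE conjE)
    obtain p where p: "p tagged_division_of cbox a b" "(\<lambda>x. \<gamma> x \<inter> \<delta> x) fine p"
      using fine_division_exists[OF gauge_Int[OF \<gamma>(1) \<delta>(1)]] by blast
    then have fine: "\<gamma> fine p" "\<delta> fine p" by (auto simp: fine_Int)
    have "(\<Sum>(x,K)\<in>p. measure lborel K *\<^sub>R \<bar>k x\<bar>) = (\<Sum>(x,K)\<in>p. norm (measure lborel K *\<^sub>R k x - integral K k))"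
    proof (rule sum.cong[OF refl], clarify)
      fix x K assume xK: "(x, K) \<in> p"
      then obtain c d where K: "K = cbox c d" "K \<subseteq> cbox a b" "x \<in> K"
        using tagged_division_ofD(2,3,4)[OF p(1) xK] by blast
      then have "c \<le> d" "{c..d} \<subseteq> {a..b}" by (auto simp: box_real)
      then have "a \<le> c" "d \<le> b" by auto
      then have "integral K k = 0"
        using integral_unique[OF W12_has_integral[OF W, of c d]] \<open>c \<le> d\<close> K(1) by (simp add: box_real)
      then show "measure lborel K *\<^sub>R \<bar>k x\<bar> = norm (measure lborel K *\<^sub>R k x - integral K k)"
        by (simp add: abs_mult)
    qed
    moreover have "(\<Sum>(x,K)\<in>p. norm (measure lborel K *\<^sub>R k x - integral K k)) < e / 2"
      by (rule \<gamma>(2)[OF _ fine(1)]) (use p(1) in \<open>simp add: tagged_division_of_def\<close>) 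
    moreover have "norm ((\<Sum>(x,K)\<in>p. measure lborel K *\<^sub>R \<bar>k x\<bar>) - integral (cbox a b) (\<lambda>x. \<bar>k x\<bar>)) < e / 2"
      using \<delta>(2) p(1) fine(2) by blast
    ultimately show ?thesis unfolding box_real(2) real_norm_def by linarith
  qed
  then have "integral {a..b} (\<lambda>x. \<bar>k x\<bar>) \<le> 0" by (rule field_le_epsilon)
  moreover have "0 \<le> integral {a..b} (\<lambda>x. \<bar>k x\<bar>)" using ia by (intro integral_nonneg) (auto simp: box_real)
  ultimately show ?thesis by simp
qed

text \<open>The difference of two derivatives of \<open>v\<close> integrates to 0 over every
  subinterval, hence vanishes almost everywhere. The derivative chosen inside \<open>J\<close> may
  thus be exchanged for an explicit one.\<close>

lemma energy_unique:
  assumes W1: "W12 a b v g" and W2: "W12 a b v h"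
  shows "energy a b v g = energy a b v h"
proof -
  define k where "k = (\<lambda>x. g x - h x)"
  have W: "W12 a b (\<lambda>_. 0) k" using W12_diff[OF W1 W2] by (simp add: k_def)
  have ai: "(\<lambda>x. \<bar>k x\<bar>) absolutely_integrable_on {a..b}"
    using absolutely_integrable_norm[OF sqint_abs_integrable[OF W12_sqint[OF W]]] by (simp add: o_def)
  then have "integrable (lebesgue_on {a..b}) (\<lambda>x. \<bar>k x\<bar>)"
    by (simp add: integrable_restrict_space set_integrable_def)
  moreover from lebesgue_integral_eq_integral[OF this]
  have "(LINT x|lebesgue_on {a..b}. \<bar>k x\<bar>) = 0" using null_antideriv_abs[OF W] by simp
  ultimately have "AE x in lebesgue_on {a..b}. \<bar>k x\<bar> = 0"
    by (subst (asm) integral_nonneg_eq_0_iff_AE) auto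
  then have "AE x in lebesgue. x \<in> {a..b} \<longrightarrow> k x = 0"
    by (subst (asm) AE_restrict_space_iff) auto
  then obtain N where N: "negligible N" "{x. \<not> (x \<in> {a..b} \<longrightarrow> k x = 0)} \<subseteq> N"
    unfolding eventually_ae_filter_negligible by blast
  show ?thesis unfolding energy_def
    by (rule integral_spike[OF N(1)]) (use N(2) in \<open>auto simp: k_def\<close>)
qed

text \<open>The increment formula says that \<open>v\<close> minus the primitive of \<open>g\<close>
  is constant on the open interval. Both are continuous up to the boundary, so the constant persists
  on the closed interval.\<close>

lemma weak_deriv_W12:
  assumes v: "continuous_on UNIV v" and g: "g \<in> L2 period_interval" and wd: "has_weak_deriv period_interval v g"
  shows "W12 (- pi) pi v g"
proof -
  have gi: "g integrable_on {-pi..pi}" and g2: "(\<lambda>x. (g x)\<^sup>2) integrable_on {-pi..pi}"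
    using lebesgue_on_open_interval[OF L2_integrable[OF g]] lebesgue_on_open_interval[of "-pi" pi "\<lambda>x. (g x)\<^sup>2"] g
    unfolding L2_def by auto
  have sub: "g integrable_on {x..y}" if "- pi \<le> x" "y \<le> pi" for x y
    by (rule integrable_on_subinterval[OF gi]) (use that in auto)
  define c where "c = v 0 - integral {-pi..0} g"
  have "v x - integral {-pi..x} g = c" if "x \<in> {-pi..pi}" for x
  proof (rule continuous_constant_on_closure[where S = period_interval and f = "\<lambda>x. v x - integral {-pi..x} g"])
    show "continuous_on (closure period_interval) (\<lambda>x. v x - integral {-pi..x} g)"
      using pi_gt_zero
      by (auto intro!: continuous_intros continuous_on_subset[OF v] indefinite_integral_continuous_1 gi)
    show "x \<in> closure period_interval" using that pi_gt_zero by simp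
    fix y assume y: "y \<in> period_interval"
    show "v y - integral {-pi..y} g = c"
    proof (cases "0 \<le> y")
      case True
      have "integral {-pi..0} g + integral {0..y} g = integral {-pi..y} g"
        by (intro Henstock_Kurzweil_Integration.integral_combine sub) (use True y in auto)
      then show ?thesis using weak_deriv_increment[OF v g wd, of 0 y] True y by (simp add: c_def)
    next
      case False
      have "integral {-pi..y} g + integral {y..0} g = integral {-pi..0} g"
        by (intro Henstock_Kurzweil_Integration.integral_combine sub) (use False y in auto)
      then show ?thesis using weak_deriv_increment[OF v g wd, of y 0] False y by (simp add: c_def)
    qed
  qed
  note const = this
  show ?thesis unfolding W12_def
  proof (intro conjI allI impI)
    show "sqint (- pi) pi g" using g2 integrable_imp_measurable[OF gi] by (simp add: sqint_def)
    fix x y assume xy: "- pi \<le> x" "x \<le> y" "y \<le> pi"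
    have "integral {-pi..x} g + integral {x..y} g = integral {-pi..y} g"
      by (intro Henstock_Kurzweil_Integration.integral_combine sub) (use xy in auto)
    then have "integral {x..y} g = v y - v x" using const[of x] const[of y] xy by simp
    then show "(g has_integral (v y - v x)) {x..y}"
      using integrable_integral[OF sub[OF xy(1,3)]] by simp
  qed
qed

text \<open>Integration by parts against a test function, which vanishes at both end points. This
  converse puts the extremal function, whose derivative is continuous, into
  \<open>H1\<close>.\<close>

lemma W12_has_weak_deriv:
  assumes W: "W12 (- pi) pi v g" and v: "continuous_on UNIV v" and g: "continuous_on UNIV g"
  shows "has_weak_deriv period_interval v g"
  unfolding has_weak_deriv_def
proof (intro allI impI)
  fix \<phi> assume t: "test_function period_interval \<phi>"
  then have s: "smooth \<phi>" unfolding test_function_def smooth_def by auto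
  have "\<phi> x = 0" if "x \<notin> period_interval" for x
    using t that closure_subset[of "{x. \<phi> x \<noteq> 0}"] unfolding test_function_def by auto
  then have z: "\<phi> pi = 0" "\<phi> (- pi) = 0" by auto
  have c: "continuous_on UNIV \<phi>" "continuous_on UNIV (deriv \<phi>)"
    using smooth_continuous smooth_deriv s by auto
  have W\<phi>: "W12 (- pi) pi \<phi> (deriv \<phi>)"
    by (intro W12_C1 has_field_derivative_at_within[OF smooth_has_deriv[OF s]] continuous_on_subset[OF c(2)]) auto
  have "integral {-pi..pi} (\<lambda>x. g x * \<phi> x + v x * deriv \<phi> x) = 0"
    using integral_unique[OF W12_mult_has_integral[OF W W\<phi>]] z pi_gt_zero by simp
  moreover have "integral {-pi..pi} (\<lambda>x. g x * \<phi> x + v x * deriv \<phi> x) =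
      integral {-pi..pi} (\<lambda>x. g x * \<phi> x) + integral {-pi..pi} (\<lambda>x. v x * deriv \<phi> x)"
    by (intro integral_add integrable_continuous_real continuous_intros)
       (auto intro: continuous_on_subset[OF v] continuous_on_subset[OF g] continuous_on_subset[OF c(1)] continuous_on_subset[OF c(2)])
  moreover have "(LINT x|lebesgue_on period_interval. v x * deriv \<phi> x) = integral {-pi..pi} (\<lambda>x. v x * deriv \<phi> x)"
    "(LINT x|lebesgue_on period_interval. g x * \<phi> x) = integral {-pi..pi} (\<lambda>x. g x * \<phi> x)"
    by (intro lebesgue_on_open_continuous continuous_intros v g c)+
  ultimately show "(LINT x|lebesgue_on period_interval. v x * deriv \<phi> x) = - (LINT x|lebesgue_on period_interval. g x * \<phi> x)"
    by simp
qed

lemma continuous_L2: "continuous_on UNIV v \<Longrightarrow> v \<in> L2 {a<..<b}"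
  unfolding L2_def
  by (auto intro!: lebesgue_on_open_continuous continuous_intros continuous_imp_measurable_on_sets_lebesgue
      intro: continuous_on_subset)

text \<open>A weak derivative carries information only on the open period interval. The floor term
  moves every \<open>x\<close> into \<open>[-pi, pi)\<close>; the arbitrary values at the junctions
  form a null set.\<close>

definition periodize :: "(real \<Rightarrow> real) \<Rightarrow> real \<Rightarrow> real" where
  "periodize g x = g (x - of_int \<lfloor>(x + pi) / (2 * pi)\<rfloor> * (2 * pi))"

lemma periodic_of_int:
  fixes v :: "real \<Rightarrow> real"
  assumes "\<And>x. v (x + T) = v x" shows "v (x + of_int k * T) = v x"
proof -
  have n: "v (x + of_nat n * T) = v x" for n :: nat and x
  proof (induction n)
    case (Suc n)
    have "v (x + of_nat (Suc n) * T) = v ((x + of_nat n * T) + T)" by (simp add: algebra_simps)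
    then show ?case using assms Suc by simp
  qed simp
  show ?thesis
  proof (cases k)
    case (nonneg n) then show ?thesis using n by simp
  next
    case (neg n)
    have "x + of_int k * T + of_nat (Suc n) * T = x" unfolding neg by (simp add: algebra_simps)
    then show ?thesis using n[of "x + of_int k * T" "Suc n"] by metis
  qed
qed

lemma periodize_periodic: "periodize g (x + 2 * pi) = periodize g x"
proof -
  have "(x + 2 * pi + pi) / (2 * pi) = (x + pi) / (2 * pi) + 1" by (simp add: field_simps)
  then show ?thesis unfolding periodize_def by (simp add: algebra_simps)
qed

lemma periodize_eq: "- pi < x \<Longrightarrow> x < pi \<Longrightarrow> periodize g (x + of_int k * (2 * pi)) = g x"
proof -
  assume x: "- pi < x" "x < pi"
  have "\<lfloor>(x + pi) / (2 * pi)\<rfloor> = 0" using x by (intro floor_unique) (auto simp: field_simps)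
  then have "periodize g x = g x" by (simp add: periodize_def)
  then show ?thesis using periodic_of_int[where v = "periodize g" and T = "2 * pi", OF periodize_periodic] by simp
qed

lemma W12_periodize:
  assumes W: "W12 (- pi) pi v g" and per: "\<And>x. v (x + 2 * pi) = v x"
  shows "W12 a b v (periodize g)"
proof (rule W12_tiling[where T = "2 * pi" and c = "- pi"])
  fix k :: int
  define c where "c = - of_int k * (2 * pi)"
  have "W12 (- pi - c) (pi - c) (\<lambda>x. v (x + c)) (\<lambda>x. g (x + c))"
    by (rule W12_shift) (use W in simp)
  then have "W12 (- pi - c) (pi - c) v (periodize g)"
  proof (rule W12_spike)
    fix x assume "- pi - c < x" "x < pi - c"
    then show "periodize g x = g (x + c)"
      using periodize_eq[of "x + c" g k] by (simp add: c_def)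
  next
    show "v x = v (x + c)" for x
      using periodic_of_int[of v "2 * pi" x "- k"] per by (simp add: c_def)
  qed
  then show "W12 (- pi + of_int k * (2 * pi)) (- pi + of_int (k + 1) * (2 * pi)) v (periodize g)"
    by (simp add: c_def algebra_simps)
qed simp

section \<open>The extremal function\<close>

lemma periodic_eqI:
  fixes v w :: "real \<Rightarrow> real"
  assumes per: "\<And>x. v (x + T) = v x" "\<And>x. w (x + T) = w x" and "T > 0"
    and eq: "\<And>x. x \<in> {0..T} \<Longrightarrow> v x = w x"
  shows "v x = w x"
proof -
  define k where "k = \<lfloor>x / T\<rfloor>"
  define y where "y = x - of_int k * T"
  have "of_int k \<le> x / T" "x / T < of_int k + 1" unfolding k_def by linarith+
  then have "y \<in> {0..T}" using \<open>T > 0\<close> by (auto simp: y_def field_simps)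
  then have "v y = w y" by (rule eq)
  moreover have "v (y + of_int k * T) = v y" "w (y + of_int k * T) = w y"
    using periodic_of_int per by metis+
  ultimately show ?thesis by (simp add: y_def)
qed

text \<open>The bridge between the functional and the estimates: Lebesgue integrals over the open
  interval become gauge integrals over \<open>[0, 2 * pi]\<close>, and the chosen weak derivative is
  replaced by its periodization, which leaves the energy unchanged.\<close>

lemma J_admissible:
  assumes w: "w \<in> \<W>"
  shows "\<exists>g. admissible w g \<and> J w = energy 0 (2 * pi) w g / (integral {0..2 * pi} (\<lambda>x. \<bar>w x\<bar>))\<^sup>2"
proof -
  have cw: "continuous_on UNIV w" and per: "\<And>x. w (x + 2 * pi) = w x" and H: "w \<in> H1 period_interval"
    and orth: "(LINT \<theta>|lebesgue_on period_interval. w \<theta>) = 0"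
      "(LINT \<theta>|lebesgue_on period_interval. w \<theta> * cos \<theta>) = 0"
      "(LINT \<theta>|lebesgue_on period_interval. w \<theta> * sin \<theta>) = 0"
    using w unfolding \<W>_def H1_per_def by auto
  define g where "g = weak_deriv period_interval w"
  have g: "g \<in> L2 period_interval" "has_weak_deriv period_interval w g"
    using someI_ex[of "\<lambda>g. g \<in> L2 period_interval \<and> has_weak_deriv period_interval w g"] H
    unfolding g_def weak_deriv_def H1_def by auto
  define G where "G = periodize g"
  note W0 = weak_deriv_W12[OF cw g]
  have W: "W12 a b w G" for a b unfolding G_def by (rule W12_periodize[OF W0 per])
  have shift: "integral {-pi..pi} f = integral {0..2 * pi} f"
    if "\<And>x y. f integrable_on {x..y}" "\<And>x. f (x + 2 * pi) = f x" for f :: "real \<Rightarrow> real"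
    using integral_periodic[OF that, of "- pi" 0] by simp
  have cont: "(f has_integral (LINT x|lebesgue_on period_interval. f x)) {0..2 * pi}"
    if "continuous_on UNIV f" "\<And>x. f (x + 2 * pi) = f x" for f :: "real \<Rightarrow> real"
  proof -
    have i: "f integrable_on {x..y}" for x y
      by (intro integrable_continuous_real continuous_on_subset[OF that(1)]) auto
    show ?thesis unfolding lebesgue_on_open_continuous(2)[OF that(1)] shift[OF i that(2)]
      by (rule integrable_integral[OF i])
  qed
  have A: "admissible w G" unfolding admissible_def
  proof (intro conjI allI)
    show "(w has_integral 0) {0..2 * pi}" using cont[OF cw per] orth by simp
    show "((\<lambda>x. w x * cos x) has_integral 0) {0..2 * pi}"
      using cont[of "\<lambda>x. w x * cos x"] orth per by (simp add: continuous_on_mult[OF cw] continuous_intros)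
    show "((\<lambda>x. w x * sin x) has_integral 0) {0..2 * pi}"
      using cont[of "\<lambda>x. w x * sin x"] orth per by (simp add: continuous_on_mult[OF cw] continuous_intros)
  qed (use W per periodize_periodic in \<open>auto simp: G_def\<close>)
  have N: "(LINT \<theta>|lebesgue_on period_interval. \<bar>w \<theta>\<bar>) = integral {0..2 * pi} (\<lambda>x. \<bar>w x\<bar>)"
    using cont[of "\<lambda>x. \<bar>w x\<bar>"] per by (simp add: integral_unique continuous_on_rabs[OF cw])
  have "integrable (lebesgue_on period_interval) (\<lambda>x. (w x)\<^sup>2)"
    by (intro lebesgue_on_open_continuous continuous_intros cw)
  moreover have "integrable (lebesgue_on period_interval) (\<lambda>x. (g x)\<^sup>2)" using g unfolding L2_def by auto
  ultimately have "integrable (lebesgue_on period_interval) (\<lambda>x. \<bar>g x\<bar>\<^sup>2 - \<bar>w x\<bar>\<^sup>2)" by simp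
  from integral_unique[OF lebesgue_on_open_interval[OF this]]
  have "(LINT x|lebesgue_on period_interval. \<bar>g x\<bar>\<^sup>2 - \<bar>w x\<bar>\<^sup>2) = energy (- pi) pi w g"
    by (simp add: energy_def)
  also have "\<dots> = energy (- pi) pi w G" by (rule energy_unique[OF W0 W])
  also have "\<dots> = energy 0 (2 * pi) w G"
    unfolding energy_def
    by (intro shift has_integral_integrable[OF energy_has_integral[OF W]])
       (simp add: per admissible_periodic[OF A])
  finally have "J w = energy 0 (2 * pi) w G / (integral {0..2 * pi} (\<lambda>x. \<bar>w x\<bar>))\<^sup>2"
    unfolding J_def N g_def by simp
  then show ?thesis using A by blast
qed

text \<open>On the first quarter,
  \<open>(cos x + sin x - 1) * (1 + sin x + cos x) = sin (2 * x)\<close>. With absolute values in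
  the denominator the quotient is one formula on the whole line, so oddness and periodicity need no
  cases.\<close>

definition extremal :: "real \<Rightarrow> real" where
  "extremal x = sin (2 * x) / (1 + \<bar>sin x\<bar> + \<bar>cos x\<bar>)"

lemma extremal_odd: "extremal (- x) = - extremal x"
  by (simp add: extremal_def)

lemma extremal_quarter: "extremal (x + pi/2) = - extremal x"
proof -
  have "sin (2 * (x + pi/2)) = - sin (2 * x)" by (simp add: distrib_left sin_add)
  then show ?thesis by (simp add: extremal_def sin_add cos_add add.commute add.left_commute)
qed

lemma extremal_periodic: "extremal (x + pi) = extremal x" "extremal (x + 3*pi/2) = - extremal x"
  "extremal (x + 2 * pi) = extremal x"
proof -
  have *: "extremal (y + pi) = extremal y" for y
    using extremal_quarter[of "y + pi/2"] extremal_quarter[of y] by (simp add: add.assoc)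
  then show "extremal (x + pi) = extremal x" .
  have "x + 3*pi/2 = x + pi/2 + pi" "x + 2 * pi = x + pi + pi" by auto
  then show "extremal (x + 3*pi/2) = - extremal x" "extremal (x + 2 * pi) = extremal x"
    using * extremal_quarter[of x] by metis+
qed

lemma extremal_continuous: "continuous_on S extremal"
  unfolding extremal_def[abs_def]
  by (intro continuous_intros ballI) (smt (verit) abs_ge_zero)

lemma extremal_profile: assumes "x \<in> {0..pi/2}" shows "extremal x = profile x"
proof -
  have sc: "0 \<le> sin x" "0 \<le> cos x" using assms by (auto intro: sin_ge_zero cos_ge_zero)
  have "profile x * (1 + sin x + cos x) = sin (2 * x)"
    using sin_cos_squared_add[of x] unfolding profile_def sin_double by (simp add: power2_eq_square algebra_simps)
  moreover have "1 + sin x + cos x > 0" using sc by linarith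
  ultimately show ?thesis using sc by (simp add: extremal_def divide_eq_eq)
qed

text \<open>On one quarter period this is calculus with \<open>profile\<close>; since function and
  derivative both change sign under a quarter turn, the statement spreads to all translates of that
  interval in both directions.\<close>

lemma extremal_W12: "W12 a b extremal (\<lambda>x. \<bar>cos x\<bar> - \<bar>sin x\<bar>)"
proof (rule W12_tiling[where T = "pi/2" and c = 0])
  define h :: "real \<Rightarrow> real" where "h = (\<lambda>x. \<bar>cos x\<bar> - \<bar>sin x\<bar>)"
  have hq: "h (x + pi/2) = - h x" for x by (simp add: h_def sin_add cos_add)
  have "W12 0 (pi/2) profile (\<lambda>x. cos x - sin x)"
    unfolding profile_def[abs_def]
    by (rule W12_C1) (auto intro!: derivative_eq_intros continuous_intros)
  then have W0: "W12 0 (pi/2) extremal h"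
    by (rule W12_spike) (auto simp: h_def extremal_profile abs_of_nonneg sin_ge_zero cos_ge_zero)
  have up: "W12 (a + pi/2) (b + pi/2) extremal h" if "W12 a b extremal h" for a b
  proof -
    have "W12 (a + pi/2) (b + pi/2) (\<lambda>x. - 1 * extremal (x + - (pi/2))) (\<lambda>x. - 1 * h (x + - (pi/2)))"
      by (intro W12_cmult W12_shift) (use that in simp)
    then show ?thesis
    proof (rule W12_spike)
      show "h x = - 1 * h (x + - (pi/2))" for x using hq[of "x - pi/2"] by simp
      show "extremal x = - 1 * extremal (x + - (pi/2))" for x using extremal_quarter[of "x - pi/2"] by simp
    qed
  qed
  have down: "W12 (a - pi/2) (b - pi/2) extremal h" if "W12 a b extremal h" for a b
  proof -
    have "W12 (a - pi/2) (b - pi/2) (\<lambda>x. - 1 * extremal (x + pi/2)) (\<lambda>x. - 1 * h (x + pi/2))"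
      by (intro W12_cmult W12_shift) (use that in simp)
    then show ?thesis by (rule W12_spike) (simp_all add: hq extremal_quarter)
  qed
  have P: "W12 (0 + of_int k * (pi/2)) (0 + of_int (k + 1) * (pi/2)) extremal h" for k :: int
  proof (induction k rule: int_induct[where k = 0])
    case base show ?case using W0 by simp
  next
    case (step1 i)
    have "0 + of_int i * (pi/2) + pi/2 = 0 + of_int (i + 1) * (pi/2)"
      "0 + of_int (i + 1) * (pi/2) + pi/2 = 0 + of_int (i + 1 + 1) * (pi/2)" by (simp_all add: field_simps)
    then show ?case using up[OF step1(2)] by (simp only:)
  next
    case (step2 i)
    have "0 + of_int i * (pi/2) - pi/2 = 0 + of_int (i - 1) * (pi/2)"
      "0 + of_int (i + 1) * (pi/2) - pi/2 = 0 + of_int (i - 1 + 1) * (pi/2)" by (simp_all add: field_simps)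
    then show ?case using down[OF step2(2)] by (simp only:)
  qed
  then show "W12 (0 + of_int k * (pi/2)) (0 + of_int (k + 1) * (pi/2)) extremal (\<lambda>x. \<bar>cos x\<bar> - \<bar>sin x\<bar>)" for k :: int
    unfolding h_def .
qed simp

text \<open>The function alternates under quarter turns, so its integral against \<open>p\<close>
  folds to one against the alternating sum of \<open>p\<close>, which vanishes for 1, cosine and
  sine.\<close>

lemma extremal_admissible: "admissible extremal (\<lambda>x. \<bar>cos x\<bar> - \<bar>sin x\<bar>)"
proof -
  have *: "((\<lambda>x. extremal x * p x) has_integral 0) {0..2 * pi}"
    if "continuous_on UNIV p" "\<And>x. p x - p (x + pi/2) + p (x + pi) - p (x + 3*pi/2) = 0" for p
  proof -
    have i: "(\<lambda>x. extremal x * p x) integrable_on {0..2 * pi}"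
      by (intro integrable_continuous_real continuous_intros extremal_continuous continuous_on_subset[OF that(1)]) auto
    have "extremal x * p x + extremal (x + pi/2) * p (x + pi/2) + extremal (x + pi) * p (x + pi)
        + extremal (x + 3*pi/2) * p (x + 3*pi/2)
        = extremal x * (p x - p (x + pi/2) + p (x + pi) - p (x + 3*pi/2))" for x
      unfolding extremal_periodic extremal_quarter by (simp add: algebra_simps)
    then have "((\<lambda>x. 0) has_integral integral {0..2 * pi} (\<lambda>x. extremal x * p x)) {0..pi/2}"
      using has_integral_fold4[OF integrable_integral[OF i]] that(2) by simp
    then have "integral {0..2 * pi} (\<lambda>x. extremal x * p x) = 0"
      using has_integral_unique has_integral_0 by blast
    then show ?thesis using i by (simp add: has_integral_iff)
  qed
  have "((\<lambda>x. extremal x * 1) has_integral 0) {0..2 * pi}" by (rule *) simp_all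
  moreover have "((\<lambda>x. extremal x * cos x) has_integral 0) {0..2 * pi}"
    by (rule *) (unfold quarter_turns, auto intro!: continuous_intros)
  moreover have "((\<lambda>x. extremal x * sin x) has_integral 0) {0..2 * pi}"
    by (rule *) (unfold quarter_turns, auto intro!: continuous_intros)
  ultimately show ?thesis unfolding admissible_def
    using extremal_W12 by (simp add: extremal_periodic)
qed

lemma extremal_in_W: "extremal \<in> \<W>"
proof -
  define h :: "real \<Rightarrow> real" where "h = (\<lambda>x. \<bar>cos x\<bar> - \<bar>sin x\<bar>)"
  have ch: "continuous_on UNIV h" unfolding h_def by (intro continuous_intros)
  have "has_weak_deriv period_interval extremal h"
    by (rule W12_has_weak_deriv) (use extremal_W12 ch extremal_continuous in \<open>auto simp: h_def\<close>)
  then have H: "extremal \<in> H1 period_interval"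
    unfolding H1_def using continuous_L2[OF ch] continuous_L2[OF extremal_continuous] by auto
  have int: "(LINT x|lebesgue_on period_interval. extremal x * p x) = 0"
    if "((\<lambda>x. extremal x * p x) has_integral 0) {0..2 * pi}" "continuous_on UNIV p" "\<And>x. p (x + 2 * pi) = p x" for p
  proof -
    have c: "continuous_on UNIV (\<lambda>x. extremal x * p x)" by (intro continuous_intros extremal_continuous that)
    have i: "(\<lambda>x. extremal x * p x) integrable_on {x..y}" for x y
      by (intro integrable_continuous_real continuous_on_subset[OF c]) auto
    have "integral {-pi..-pi + 2 * pi} (\<lambda>x. extremal x * p x) = integral {0..0 + 2 * pi} (\<lambda>x. extremal x * p x)"
      by (rule integral_periodic[OF i, symmetric]) (auto simp: extremal_periodic that)
    then show ?thesis unfolding lebesgue_on_open_continuous(2)[OF c] using integral_unique[OF that(1)] by simp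
  qed
  have "continuous_on UNIV (cos :: real \<Rightarrow> real)" "continuous_on UNIV (sin :: real \<Rightarrow> real)"
    by (intro continuous_intros)+
  then show ?thesis unfolding \<W>_def H1_per_def
    using extremal_admissible int[of "\<lambda>_. 1"] int[of cos] int[of sin] H extremal_continuous
    unfolding admissible_def by auto
qed

text \<open>The two values agree, as testing \<open>u'' + u = - sgn u\<close> with \<open>u\<close>
  predicts. The quotient is therefore \<open>K / K^2 = 1 / K\<close> with
  \<open>K = 2 * (4 - pi)\<close>.\<close>

lemma extremal_values:
  "integral {0..2 * pi} (\<lambda>x. \<bar>extremal x\<bar>) = 2 * (4 - pi)"
  "energy 0 (2 * pi) extremal (\<lambda>x. \<bar>cos x\<bar> - \<bar>sin x\<bar>) = 2 * (4 - pi)"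
proof -
  have "((\<lambda>x. 4 * profile x) has_integral integral {0..2 * pi} (\<lambda>x. \<bar>extremal x\<bar>)) {0..pi/2}"
    by (rule has_integral_eq[OF _ abs_sum_integral[OF extremal_admissible]])
       (simp add: abs_sum_def extremal_periodic extremal_quarter extremal_profile profile_pos(1))
  then show "integral {0..2 * pi} (\<lambda>x. \<bar>extremal x\<bar>) = 2 * (4 - pi)"
    using has_integral_unique[OF _ has_integral_mult_right[OF profile_integral(1), of 4]] by simp
  define h :: "real \<Rightarrow> real" where "h = (\<lambda>x. \<bar>cos x\<bar> - \<bar>sin x\<bar>)"
  have hp: "(h (x + pi/2))\<^sup>2 = (h x)\<^sup>2" "(h (x + pi))\<^sup>2 = (h x)\<^sup>2" "(h (x + 3*pi/2))\<^sup>2 = (h x)\<^sup>2" for x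
    unfolding h_def quarter_turns by (simp_all add: power2_commute)
  have "((\<lambda>x. 4 * (2 * (cos x + sin x) - 1 - 4 * (sin x * cos x))) has_integral energy 0 (2 * pi) extremal h) {0..pi/2}"
  proof (rule has_integral_eq[OF _ has_integral_fold4[OF energy_has_integral[OF extremal_W12[folded h_def]]]])
    fix x assume x: "x \<in> {0..pi/2}"
    have sc: "0 \<le> sin x" "0 \<le> cos x" using x by (auto intro: sin_ge_zero cos_ge_zero)
    have "(h x)\<^sup>2 - (profile x)\<^sup>2 = 2 * (cos x + sin x) - 1 - 4 * (sin x * cos x)"
      using sc sin_cos_squared_add[of x] by (simp add: h_def profile_def power2_eq_square algebra_simps)
    then show "(h x)\<^sup>2 - (extremal x)\<^sup>2 + ((h (x + pi/2))\<^sup>2 - (extremal (x + pi/2))\<^sup>2)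
        + ((h (x + pi))\<^sup>2 - (extremal (x + pi))\<^sup>2) + ((h (x + 3*pi/2))\<^sup>2 - (extremal (x + 3*pi/2))\<^sup>2)
        = 4 * (2 * (cos x + sin x) - 1 - 4 * (sin x * cos x))"
      unfolding hp extremal_periodic extremal_quarter extremal_profile[OF x] by simp
  qed
  moreover have "((\<lambda>x. 4 * (2 * (cos x + sin x) - 1 - 4 * (sin x * cos x))) has_integral
      (4 * (2 * (sin (pi/2) - cos (pi/2)) - pi/2 - 2 * (sin (pi/2))\<^sup>2)) - (4 * (2 * (sin 0 - cos 0) - 0 - 2 * (sin 0)\<^sup>2))) {0..pi/2}"
    by (rule fundamental_theorem_of_calculus[where f = "\<lambda>x. 4 * (2 * (sin x - cos x) - x - 2 * (sin x)\<^sup>2)"])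
       (auto intro!: derivative_eq_intros simp: algebra_simps simp flip: has_real_derivative_iff_has_vector_derivative)
  ultimately have "energy 0 (2 * pi) extremal h = (4 * (2 * (sin (pi/2) - cos (pi/2)) - pi/2 - 2 * (sin (pi/2))\<^sup>2))
      - (4 * (2 * (sin 0 - cos 0) - 0 - 2 * (sin 0)\<^sup>2))"
    by (rule has_integral_unique)
  then show "energy 0 (2 * pi) extremal (\<lambda>x. \<bar>cos x\<bar> - \<bar>sin x\<bar>) = 2 * (4 - pi)"
    unfolding h_def by simp
qed

text \<open>The alternating part takes opposite values at 0 and pi/2, so it has a zero
  \<open>c\<close> between them. Translating this zero to the origin makes the preceding estimates
  applicable, and undoing it produces the shift \<open>a = - c\<close>.\<close>

lemma sharp_inequality:
  assumes A: "admissible v g"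
  shows "0 \<le> energy 0 (2*pi) v g - 2 * integral {0..2*pi} (\<lambda>x. \<bar>v x\<bar>) + 2 * (4 - pi)"
    and "energy 0 (2*pi) v g - 2 * integral {0..2*pi} (\<lambda>x. \<bar>v x\<bar>) + 2 * (4 - pi) = 0 \<Longrightarrow> \<exists>s a. s \<noteq> 0 \<and> v = (\<lambda>x. s * extremal (x + a))"
proof -
  let ?M = "\<lambda>v g. energy 0 (2*pi) v g - 2 * integral {0..2*pi} (\<lambda>x. \<bar>v x\<bar>) + 2 * (4 - pi)"
  have "continuous_on {0..pi/2} (alt_part v)"
    by (rule W12_continuous[OF W12_part(2)[OF admissible_W12[OF A]]])
  moreover have "alt_part v (pi/2) = - alt_part v 0"
    using part_periodic(2)[of v 0] admissible_periodic[OF A] by simp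
  ultimately obtain c where c: "0 \<le> c" "c \<le> pi/2" "alt_part v c = 0"
    using IVT'[of "alt_part v" 0 0 "pi/2"] IVT2'[of "alt_part v" "pi/2" 0 0] by fastforce
  define V where "V = (\<lambda>x. v (x + c))"
  define G where "G = (\<lambda>x. g (x + c))"
  have AV: "admissible V G" unfolding V_def G_def by (rule admissible_shift[OF A]) (use c pi_gt_zero in linarith)+
  have V0: "alt_part V 0 = 0" using c part_shift(2)[of v c 0] by (simp add: V_def)
  have shift: "integral {0..2 * pi} (\<lambda>x. f (x + c)) = integral {0..2 * pi} f"
    if "\<And>x y. f integrable_on {x..y}" "\<And>x. f (x + 2 * pi) = f x" for f :: "real \<Rightarrow> real"
  proof -
    have "integral {0..2 * pi} (\<lambda>x. f (x + c)) = integral {0 + c..2 * pi + c} f"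
      by (intro integral_unique has_integral_shift integrable_integral that)
    also have "\<dots> = integral {0..2 * pi} f"
      using integral_periodic[OF that, of 0 c] c pi_gt_zero by (simp add: add.commute)
    finally show ?thesis .
  qed
  have "energy 0 (2*pi) V G = energy 0 (2*pi) v g"
    unfolding energy_def V_def G_def
    by (rule shift[of "\<lambda>x. (g x)\<^sup>2 - (v x)\<^sup>2"])
       (auto intro: has_integral_integrable[OF energy_has_integral[OF admissible_W12[OF A]]] simp: admissible_periodic[OF A])
  moreover have "integral {0..2*pi} (\<lambda>x. \<bar>V x\<bar>) = integral {0..2*pi} (\<lambda>x. \<bar>v x\<bar>)"
    unfolding V_def
    by (rule shift[of "\<lambda>x. \<bar>v x\<bar>"])
       (auto intro!: integrable_continuous_real continuous_intros W12_continuous[OF admissible_W12[OF A]] simp: admissible_periodic[OF A])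
  ultimately have M: "?M V G = ?M v g" by simp
  show "0 \<le> ?M v g"
    unfolding M[symmetric] by (rule order_trans[OF _ main_inequality[OF AV V0]]) (simp add: rest_energy_nonneg[OF AV])
  assume "?M v g = 0"
  then have "?M V G = 0" unfolding M .
  from main_equality[OF AV V0 this] obtain s where s: "s = 1 \<or> s = - 1"
    and eq: "\<And>x. x \<in> {0..pi/2} \<Longrightarrow> V x = s * profile x \<and> V (x + pi/2) = - s * profile x \<and>
      V (x + pi) = s * profile x \<and> V (x + 3*pi/2) = - s * profile x" by metis
  have base: "V x = s * extremal x" if "x \<in> {0..2 * pi}" for x
  proof -
    have four: "V y = s * extremal y \<and> V (y + pi/2) = s * extremal (y + pi/2) \<and>
        V (y + pi) = s * extremal (y + pi) \<and> V (y + 3*pi/2) = s * extremal (y + 3*pi/2)" if "y \<in> {0..pi/2}" for y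
      unfolding extremal_periodic extremal_quarter extremal_profile[OF that] using eq[OF that] by simp
    consider "x \<le> pi/2" | "pi/2 \<le> x" "x \<le> pi" | "pi \<le> x" "x \<le> 3*pi/2" | "3*pi/2 \<le> x"
      by linarith
    then show ?thesis
    proof cases
      case 1 then show ?thesis using four[of x] that by simp
    next
      case 2 then show ?thesis using four[of "x - pi/2"] by simp
    next
      case 3 then show ?thesis using four[of "x - pi"] by simp
    next
      case 4 then show ?thesis using four[of "x - 3*pi/2"] that by simp
    qed
  qed
  have all: "V x = s * extremal x" for x
    by (rule periodic_eqI[where T = "2 * pi" and v = V and w = "\<lambda>x. s * extremal x"])
       (simp_all add: admissible_periodic[OF AV] extremal_periodic base)
  have "v = (\<lambda>x. s * extremal (x + - c))"
  proof
    show "v x = s * extremal (x + - c)" for x using all[of "x - c"] by (simp add: V_def)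
  qed
  then show "\<exists>s a. s \<noteq> 0 \<and> v = (\<lambda>x. s * extremal (x + a))" using s by (intro exI[of _ s] exI[of _ "- c"]) auto
qed

section \<open>Rescaling and the variational problem\<close>

lemma admissible_cmult: "admissible v g \<Longrightarrow> admissible (\<lambda>x. t * v x) (\<lambda>x. t * g x)"
  unfolding admissible_def
  by (auto intro: W12_cmult simp: mult.assoc dest: has_integral_mult_right[where c = t])

lemma ratio_bound:
  assumes A: "admissible v g" and nz: "v \<noteq> (\<lambda>_. 0)"
  defines "E \<equiv> energy 0 (2*pi) v g" and "N \<equiv> integral {0..2*pi} (\<lambda>x. \<bar>v x\<bar>)"
  shows "1 / (2 * (4 - pi)) \<le> E / N\<^sup>2"
    and "E / N\<^sup>2 = 1 / (2 * (4 - pi)) \<Longrightarrow> \<exists>s a. s \<noteq> 0 \<and> v = (\<lambda>x. s * extremal (x + a))"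
proof -
  define K where "K = 2 * (4 - pi)"
  have K: "K > 0" using pi_less_4 by (simp add: K_def)
  have cv: "continuous_on {0..2*pi} v" by (rule W12_continuous[OF admissible_W12[OF A]])
  have "N \<noteq> 0"
  proof
    assume "N = 0"
    moreover have "continuous_on {0..2*pi} (\<lambda>x. \<bar>v x\<bar>)" by (intro continuous_intros cv)
    ultimately have "\<forall>x\<in>{0..2*pi}. \<bar>v x\<bar> = 0"
      using integral_eq_0_iff[of 0 "2*pi" "\<lambda>x. \<bar>v x\<bar>"] pi_gt_zero unfolding N_def by simp
    then have "v x = 0" for x
      using periodic_eqI[of v "2 * pi" "\<lambda>_. 0" x] admissible_periodic[OF A] by simp
    then show False using nz by auto
  qed
  moreover have "0 \<le> N" unfolding N_def
    by (intro integral_nonneg integrable_continuous_real continuous_intros cv) auto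
  ultimately have N: "N > 0" by simp
  \<comment> \<open>At this scale \<open>\<integral> \<bar>t * v\<bar> = K\<close>, the value for
    the extremal function, and the defect is exactly \<open>K^2 * (E / N^2 - 1 / K)\<close>.\<close>
  define t where "t = K / N"
  have t: "t > 0" using K N by (simp add: t_def)
  note S = sharp_inequality[OF admissible_cmult[OF A, of t]]
  have M: "energy 0 (2*pi) (\<lambda>x. t * v x) (\<lambda>x. t * g x) - 2 * integral {0..2*pi} (\<lambda>x. \<bar>t * v x\<bar>) + 2 * (4 - pi)
      = t\<^sup>2 * E - K"
  proof -
    have "energy 0 (2*pi) (\<lambda>x. t * v x) (\<lambda>x. t * g x) = t\<^sup>2 * E"
      unfolding energy_def E_def by (simp add: power_mult_distrib flip: right_diff_distrib)
    moreover have "integral {0..2*pi} (\<lambda>x. \<bar>t * v x\<bar>) = t * N"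
      unfolding N_def using t by (simp add: abs_mult)
    moreover have "t * N = K" using N by (simp add: t_def)
    ultimately show ?thesis by (simp add: K_def)
  qed
  have "t\<^sup>2 * E - K = K\<^sup>2 * (E / N\<^sup>2 - 1 / K)"
    using K N by (simp add: t_def power2_eq_square field_simps)
  note M' = M[unfolded this]
  have "0 \<le> E / N\<^sup>2 - 1 / K"
    using S(1) unfolding M' using K by (simp add: zero_le_mult_iff)
  then show "1 / (2 * (4 - pi)) \<le> E / N\<^sup>2" by (simp add: K_def)
  assume "E / N\<^sup>2 = 1 / (2 * (4 - pi))"
  then obtain s a where s: "s \<noteq> 0" "(\<lambda>x. t * v x) = (\<lambda>x. s * extremal (x + a))"
    using S(2) unfolding M' K_def by auto
  have "v = (\<lambda>x. (s / t) * extremal (x + a))"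
  proof
    show "v x = (s / t) * extremal (x + a)" for x
      using fun_cong[OF s(2), of x] t by (simp add: field_simps)
  qed
  then show "\<exists>s a. s \<noteq> 0 \<and> v = (\<lambda>x. s * extremal (x + a))"
    using s(1) t by (intro exI[of _ "s / t"] exI[of _ a]) auto
qed

theorem theorem1:
  shows "J_inf = ereal (1 / (2 * (4 - pi))) \<and>
    (\<exists>u :: real \<Rightarrow> real.
        (\<forall>\<theta>. u (- \<theta>) = - u \<theta>) \<and>
        (\<forall>\<theta>. u (\<theta> + pi) = u \<theta>) \<and>
        (\<forall>\<theta>\<in>{0..pi / 2}. u \<theta> = cos \<theta> + sin \<theta> - 1) \<and>
        u \<in> \<W> - {\<lambda>_. 0} \<and> ereal (J u) = J_inf \<and>
        (\<forall>w\<in>\<W> - {\<lambda>_. 0}. ereal (J w) = J_inf \<longrightarrow>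
            (\<exists>c a :: real. c \<noteq> 0 \<and> w = (\<lambda>\<theta>. c * u (\<theta> + a)))))"
proof -
  define m where "m = 1 / (2 * (4 - pi))"
  have bound: "m \<le> J w" and equal: "J w = m \<Longrightarrow> \<exists>c a. c \<noteq> 0 \<and> w = (\<lambda>x. c * extremal (x + a))"
    if "w \<in> \<W> - {\<lambda>_. 0}" for w
  proof -
    have "w \<in> \<W>" using that by simp
    from J_admissible[OF this] obtain g where g: "admissible w g"
      "J w = energy 0 (2 * pi) w g / (integral {0..2 * pi} (\<lambda>x. \<bar>w x\<bar>))\<^sup>2" by blast
    have "w \<noteq> (\<lambda>_. 0)" using that by simp
    note R = ratio_bound[OF g(1) this, folded g(2) m_def]
    show "m \<le> J w" by (rule R(1))
    show "J w = m \<Longrightarrow> \<exists>c a. c \<noteq> 0 \<and> w = (\<lambda>x. c * extremal (x + a))" by (rule R(2))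
  qed
  have "extremal (pi/4) \<noteq> 0"
    using extremal_profile[of "pi/4"] profile_pos(2)[of "pi/4"] by simp
  then have nz: "extremal \<noteq> (\<lambda>_. 0)" by metis
  have Ju: "J extremal = m"
  proof -
    obtain g where g: "admissible extremal g"
      "J extremal = energy 0 (2 * pi) extremal g / (integral {0..2 * pi} (\<lambda>x. \<bar>extremal x\<bar>))\<^sup>2"
      using J_admissible[OF extremal_in_W] by blast
    \<comment> \<open>\<open>g\<close> stems from the weak derivative chosen in \<open>J\<close>;
      uniqueness of the energy allows computing with
      \<open>\<bar>cos x\<bar> - \<bar>sin x\<bar>\<close> instead.\<close>
    have "energy 0 (2 * pi) extremal g = 2 * (4 - pi)"
      using energy_unique[OF admissible_W12[OF g(1)] extremal_W12] extremal_values(2) by simp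
    then show ?thesis unfolding g(2) extremal_values(1) m_def using pi_less_4 by (simp add: power2_eq_square)
  qed
  have mem: "extremal \<in> \<W> - {\<lambda>_. 0}" using extremal_in_W nz by simp
  have inf: "J_inf = ereal m"
    unfolding J_inf_def
  proof (rule antisym)
    show "(INF v\<in>\<W> - {\<lambda>_. 0}. ereal (J v)) \<le> ereal m"
      using INF_lower[OF mem, of "\<lambda>v. ereal (J v)"] Ju by simp
    show "ereal m \<le> (INF v\<in>\<W> - {\<lambda>_. 0}. ereal (J v))"
      by (rule INF_greatest) (use bound in simp)
  qed
  have "\<forall>\<theta>\<in>{0..pi / 2}. extremal \<theta> = cos \<theta> + sin \<theta> - 1"
    using extremal_profile by (simp add: profile_def)
  moreover have "\<forall>w\<in>\<W> - {\<lambda>_. 0}. ereal (J w) = J_inf \<longrightarrow> (\<exists>c a. c \<noteq> 0 \<and> w = (\<lambda>\<theta>. c * extremal (\<theta> + a)))"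
    using equal unfolding inf by simp
  ultimately show ?thesis
    using inf mem Ju extremal_odd extremal_periodic(1) unfolding m_def[symmetric]
    by (intro conjI exI[of _ extremal]) auto
qed

end
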